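(* If $R$ is an SMLL net and $S$ is its normal form for $\to$, then $[R]=[S]$.
   Context: SMLL formulas: $A ::= 1 \mid \bot \mid X \mid X^\bot \mid A\otimes A \mid A ⅋ A$ (⅋ is "par"), involutive negation. SMLL nets: axiom, cut, $\otimes$, ⅋, one, bot links (each bot link with a box of conclusions $\bot,\Gamma$, $\bot$ its lock) and $n$-ary sync links on positive or negative formulas (in-edges: positive premisses and negative conclusions), satisfying the switching acyclicity criterion. Reduction $\to$ (depth 0 only): axiom/cut; $\otimes$/⅋ cut to two cuts; pushing a sync above a $\otimes$ or ⅋ link; moving a sync from the positive conclusion $P$ of an axiom to its conclusion $P^\bot$, or from premiss $P^\bot$ of a cut to its premiss $P$; erasing a sync whose premisses are all conclusions of one links; opening a box whose lock is cut against a one link. The SIAM $M_R$: positions are pairs $(e,m)$ ($e$ an edge, $m$ the address in $\{\mathbf{l},\mathbf{r}\}^*$ of an atom occurrence in its type) and $(e,i)$, $i\in\mathbb{N}$, $e$ a box lock; INIT$(R)$/FIN$(R)$ are the negative/positive atom occurrences in conclusions of $R$, ONES$(R)$ positions on conclusions of one links, BOTBOX$(R)$ the positions $(e,i)$ on locks. States are functions $\mathbf{T}:\mathrm{INIT}(R)\cup L\to\mathrm{POS}(R)$, $L\subseteq\mathrm{ONES}(R)$; initial state $\mathbf{I}_R$ = identity on INIT$(R)$; final states have image FIN$(R)\cup B$, $B\subseteq$ BOTBOX$(R)$. Transitions: tokens move up on negative, down on positive positions, pass through axioms and cuts to the dual edge, add/strip $\mathbf{l},\mathbf{r}$ at $\otimes$/⅋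 links, cross a sync link all together only when all positions of its in-edges are occupied; a new token may be created on the conclusion of an active one link; a token reaching a lock $(e,\varepsilon)$ becomes $(e,0)$ and unlocks the box; tokens enter a box only if it is unlocked. Runs from $\mathbf{I}_R$ terminate and reach a unique normal state. The interpretation $[R]\in(\mathrm{INIT}(R)\rightharpoonup\mathrm{FIN}(R))\cup\{\Box\}$ is $\Box$ if that normal state is not final (deadlock), and otherwise the restriction of the final state to the elements of INIT$(R)$ not mapped into BOTBOX$(R)$. Conclusions of $R$ and $S$ are identified, so they share initial and final positions. *)

theory Defs
  imports "HOL-Library.Multiset"
begin

section \<open>Formulas\<close>

datatype fm = UnitF | BotF | VarF nat | NVarF nat | TensF fm fm | ParF fm fm

primrec dual :: "fm \<Rightarrow> fm" where
  "dual UnitF = BotF"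
| "dual BotF = UnitF"
| "dual (VarF x) = NVarF x"
| "dual (NVarF x) = VarF x"
| "dual (TensF A B) = ParF (dual A) (dual B)"
| "dual (ParF A B) = TensF (dual A) (dual B)"

lemma dual_dual [simp]: "dual (dual A) = A"
  by (induction A) auto

text \<open>Polarised formulas are hereditarily polarised: \<open>P ::= 1 | X | P \<otimes> P\<close>, and dually
  for the negative ones. A formula may be neither.\<close>

primrec positive :: "fm \<Rightarrow> bool" where
  "positive UnitF = True"
| "positive BotF = False"
| "positive (VarF x) = True"
| "positive (NVarF x) = False"
| "positive (TensF A B) = (positive A \<and> positive B)"
| "positive (ParF A B) = False"

primrec negative :: "fm \<Rightarrow> bool" where
  "negative UnitF = False"
| "negative BotF = True"
| "negative (VarF x) = False"
| "negative (NVarF x) = True"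
| "negative (TensF A B) = False"
| "negative (ParF A B) = (negative A \<and> negative B)"

datatype dir = Lft | Rgt

type_synonym addr = "dir list"

text \<open>The addresses of the occurrences of positive atoms (\<open>1\<close>, \<open>X\<close>) and of negative atoms
  (\<open>\<bottom>\<close>, \<open>X\<^sup>\<bottom>\<close>) in an arbitrary formula.\<close>

primrec pos_atoms :: "fm \<Rightarrow> addr set" where
  "pos_atoms UnitF = {[]}"
| "pos_atoms BotF = {}"
| "pos_atoms (VarF x) = {[]}"
| "pos_atoms (NVarF x) = {}"
| "pos_atoms (TensF A B) = Cons Lft ` pos_atoms A \<union> Cons Rgt ` pos_atoms B"
| "pos_atoms (ParF A B) = Cons Lft ` pos_atoms A \<union> Cons Rgt ` pos_atoms B"

primrec neg_atoms :: "fm \<Rightarrow> addr set" where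
  "neg_atoms UnitF = {}"
| "neg_atoms BotF = {[]}"
| "neg_atoms (VarF x) = {}"
| "neg_atoms (NVarF x) = {[]}"
| "neg_atoms (TensF A B) = Cons Lft ` neg_atoms A \<union> Cons Rgt ` neg_atoms B"
| "neg_atoms (ParF A B) = Cons Lft ` neg_atoms A \<union> Cons Rgt ` neg_atoms B"

section \<open>Structures\<close>

text \<open>A structure is a graph given by its multiset of links; each link lists the edges it is
  incident to. The premisses of \<open>Tens a b c\<close> and \<open>Par a b c\<close> are \<open>a\<close> and \<open>b\<close>, the conclusion
  is \<open>c\<close>. \<open>Sync\<close> carries the list of pairs (i-th premiss, i-th conclusion). \<open>Bot e C\<close> is a bot link with
  lock \<open>e\<close> together with its box, whose content is \<open>C\<close>: a conclusion of \<open>C\<close> and the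
  corresponding conclusion of the box are one and the same edge.\<close>

datatype 'e link =
    Ax 'e 'e
  | Cut 'e 'e
  | Tens 'e 'e 'e
  | Par 'e 'e 'e
  | One 'e
  | Bot 'e "'e link multiset"
  | Sync "('e \<times> 'e) list"

text \<open>An edge is a name with a formula; thus nets with the same conclusion edges have the same
  initial and final positions.\<close>

type_synonym edge = "nat \<times> fm"

abbreviation ty :: "edge \<Rightarrow> fm" where "ty \<equiv> snd"

type_synonym net = "edge link multiset"

fun prems :: "'e link \<Rightarrow> 'e multiset" where
  "prems (Cut a b) = {#a, b#}"
| "prems (Tens a b c) = {#a, b#}"
| "prems (Par a b c) = {#a, b#}"
| "prems (Sync xs) = mset (map fst xs)"
| "prems _ = {#}"

primrec concls :: "'e link \<Rightarrow> 'e multiset" where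
  "concls (Ax a b) = {#a, b#}"
| "concls (Cut a b) = {#}"
| "concls (Tens a b c) = {#c#}"
| "concls (Par a b c) = {#c#}"
| "concls (One a) = {#a#}"
| "concls (Bot a C) =
     add_mset a (sum_mset (image_mset concls C) - sum_mset (image_mset prems C))"
| "concls (Sync xs) = mset (map snd xs)"

definition net_concls :: "'e link multiset \<Rightarrow> 'e multiset" where
  "net_concls R = sum_mset (image_mset concls R) - sum_mset (image_mset prems R)"

text \<open>The edges produced by links at any depth; an edge crossing the border of a box
  is counted only once, at the link inside the box that concludes it.\<close>

primrec link_edges :: "'e link \<Rightarrow> 'e multiset" where
  "link_edges (Ax a b) = {#a, b#}"
| "link_edges (Cut a b) = {#}"
| "link_edges (Tens a b c) = {#c#}"
| "link_edges (Par a b c) = {#c#}"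
| "link_edges (One a) = {#a#}"
| "link_edges (Bot a C) = add_mset a (sum_mset (image_mset link_edges C))"
| "link_edges (Sync xs) = mset (map snd xs)"

definition edges :: "'e link multiset \<Rightarrow> 'e multiset" where
  "edges R = sum_mset (image_mset link_edges R)"

text \<open>The structure itself and the contents of all its boxes, at every depth.\<close>

inductive_set levels :: "'e link multiset \<Rightarrow> 'e link multiset set"
  for R :: "'e link multiset" where
  "R \<in> levels R"
| "L \<in> levels R \<Longrightarrow> Bot e C \<in># L \<Longrightarrow> C \<in> levels R"

fun typed :: "edge link \<Rightarrow> bool" where
  "typed (Ax a b) \<longleftrightarrow> ty b = dual (ty a)"
| "typed (Cut a b) \<longleftrightarrow> ty b = dual (ty a)"
| "typed (Tens a b c) \<longleftrightarrow> ty c = TensF (ty a) (ty b)"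
| "typed (Par a b c) \<longleftrightarrow> ty c = ParF (ty a) (ty b)"
| "typed (One a) \<longleftrightarrow> ty a = UnitF"
| "typed (Bot a C) \<longleftrightarrow> ty a = BotF"
| "typed (Sync xs) \<longleftrightarrow>
     xs \<noteq> [] \<and> (\<forall>(p, c) \<in> set xs. ty p = ty c \<and> (positive (ty p) \<or> negative (ty p)))"

definition smll_structure :: "net \<Rightarrow> bool" where
  "smll_structure R \<longleftrightarrow>
     (\<forall>L \<in> levels R. (\<forall>l \<in># L. typed l) \<and>
        sum_mset (image_mset prems L) \<subseteq># sum_mset (image_mset concls L)) \<and>
     (\<forall>e. count (edges R) e \<le> 1)"

section \<open>Correctness\<close>

text \<open>The pairs (in-edge, out-edge) of a sync link. In-edges are the positive premisses and the
  negative conclusions, out-edges the others.\<close>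

definition arcs :: "(edge \<times> edge) list \<Rightarrow> (edge \<times> edge) list" where
  "arcs xs = map (\<lambda>(p, c). if positive (ty p) then (p, c) else (c, p)) xs"

definition in_edges :: "(edge \<times> edge) list \<Rightarrow> edge set" where
  "in_edges xs = fst ` set (arcs xs)"

definition out_edges :: "(edge \<times> edge) list \<Rightarrow> edge set" where
  "out_edges xs = snd ` set (arcs xs)"

text \<open>A switching path uses at most one of the edges in \<open>switched l\<close>: the two premisses of a
  par link, respectively the out-edges of a sync link.\<close>

fun switched :: "edge link \<Rightarrow> edge set" where
  "switched (Par a b c) = {a, b}"
| "switched (Sync xs) = out_edges xs"
| "switched _ = {}"

definition joins :: "'e \<Rightarrow> 'e link \<Rightarrow> 'e link \<Rightarrow> bool" where
  "joins e l l' \<longleftrightarrow> e \<in># concls l \<and> e \<in># prems l' \<or> e \<in># concls l' \<and> e \<in># prems l"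

text \<open>Undirected elementary cycles at one level; a bot link with its box is a single node,
  incident to the lock and to the other conclusions of the box.\<close>

definition switching_cycle :: "net \<Rightarrow> edge link list \<Rightarrow> edge list \<Rightarrow> bool" where
  "switching_cycle L ls es \<longleftrightarrow>
     ls \<noteq> [] \<and> length es = length ls \<and> set ls \<subseteq> set_mset L \<and> distinct ls \<and> distinct es \<and>
     (\<forall>i < length ls. joins (es ! i) (ls ! i) (ls ! (Suc i mod length ls))) \<and>
     (\<forall>l \<in># L. card (switched l \<inter> set es) \<le> 1)"

definition smll_net :: "net \<Rightarrow> bool" where
  "smll_net R \<longleftrightarrow>
     smll_structure R \<and> (\<forall>L \<in> levels R. \<nexists>ls es. switching_cycle L ls es)"

section \<open>Reduction\<close>

text \<open>Rewriting at depth 0. The edges kept by each rule are chosen so that the conclusions of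
  the net keep their names. In the axiom rule the renamed edge may be produced inside a box.\<close>

inductive red :: "net \<Rightarrow> net \<Rightarrow> bool" where
  ax_cut:
    "x \<in> {Ax e f, Ax f e} \<Longrightarrow> k \<in> {Cut f g, Cut g f} \<Longrightarrow>
     red ({#x, k#} + G) (image_mset (map_link (\<lambda>a. if a = g then e else a)) G)"
| tens_par:
    "k \<in> {Cut c d, Cut d c} \<Longrightarrow>
     red ({#Tens a b c, Par a' b' d, k#} + G) ({#Cut a a', Cut b b'#} + G)"
| sync_tens:
    "R = {#Tens a b c, Sync (xs @ (c, d) # ys)#} + G \<Longrightarrow>
     a' \<notin># edges R \<Longrightarrow> b' \<notin># edges R \<Longrightarrow> a' \<noteq> b' \<Longrightarrow> ty a' = ty a \<Longrightarrow> ty b' = ty b \<Longrightarrow>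
     red R ({#Sync (xs @ (a, a') # (b, b') # ys), Tens a' b' d#} + G)"
| sync_par:
    "R = {#Par a b c, Sync (xs @ (c, d) # ys)#} + G \<Longrightarrow>
     a' \<notin># edges R \<Longrightarrow> b' \<notin># edges R \<Longrightarrow> a' \<noteq> b' \<Longrightarrow> ty a' = ty a \<Longrightarrow> ty b' = ty b \<Longrightarrow>
     red R ({#Sync (xs @ (a, a') # (b, b') # ys), Par a' b' d#} + G)"
| sync_ax:
    "R = {#x, Sync (xs @ (f, g) # ys)#} + G \<Longrightarrow> x \<in> {Ax e f, Ax f e} \<Longrightarrow> positive (ty f) \<Longrightarrow>
     h \<notin># edges R \<Longrightarrow> ty h = ty e \<Longrightarrow>
     red R ({#Ax h g, Sync (xs @ (h, e) # ys)#} + G)"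
| sync_cut:
    "R = {#k, Sync (xs @ (f, g) # ys)#} + G \<Longrightarrow> k \<in> {Cut g h, Cut h g} \<Longrightarrow> negative (ty g) \<Longrightarrow>
     h' \<notin># edges R \<Longrightarrow> ty h' = ty h \<Longrightarrow>
     red R ({#Cut f h', Sync (xs @ (h, h') # ys)#} + G)"
| sync_one:
    "red (add_mset (Sync xs) (mset (map (\<lambda>(p, c). One p) xs)) + G)
         (mset (map (\<lambda>(p, c). One c) xs) + G)"
| open_box:
    "k \<in> {Cut e f, Cut f e} \<Longrightarrow> red ({#Bot e C, One f, k#} + G) (C + G)"

section \<open>The machine\<close>

datatype pos = Pos edge addr | Lock edge nat

definition locks :: "net \<Rightarrow> edge set" where
  "locks R = {e. \<exists>L \<in> levels R. \<exists>C. Bot e C \<in># L}"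

definition POS :: "net \<Rightarrow> pos set" where
  "POS R = {Pos e m | e m. e \<in># edges R \<and> m \<in> pos_atoms (ty e) \<union> neg_atoms (ty e)}
         \<union> {Lock e i | e i. e \<in> locks R}"

definition INIT :: "net \<Rightarrow> pos set" where
  "INIT R = {Pos e m | e m. e \<in># net_concls R \<and> m \<in> neg_atoms (ty e)}"

definition FIN :: "net \<Rightarrow> pos set" where
  "FIN R = {Pos e m | e m. e \<in># net_concls R \<and> m \<in> pos_atoms (ty e)}"

definition ONES :: "net \<Rightarrow> pos set" where
  "ONES R = {Pos e [] | e. \<exists>L \<in> levels R. One e \<in># L}"

definition BOTBOX :: "net \<Rightarrow> pos set" where
  "BOTBOX R = {Lock e i | e i. e \<in> locks R}"

type_synonym state = "pos \<rightharpoonup> pos"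

definition is_state :: "net \<Rightarrow> state \<Rightarrow> bool" where
  "is_state R T \<longleftrightarrow> (\<exists>L \<subseteq> ONES R. dom T = INIT R \<union> L) \<and> ran T \<subseteq> POS R"

definition initial :: "net \<Rightarrow> state" where
  "initial R = (\<lambda>p. if p \<in> INIT R then Some p else None)"

definition final :: "net \<Rightarrow> state \<Rightarrow> bool" where
  "final R T \<longleftrightarrow> is_state R T \<and> (\<exists>B \<subseteq> BOTBOX R. ran T = FIN R \<union> B)"

text \<open>A link is active if all the boxes containing it are unlocked. Tokens are moved by active
  links only: as the edges at the border of a box are concluded by links inside it, tokens
  cannot enter a locked box.\<close>

inductive active :: "net \<Rightarrow> state \<Rightarrow> edge link \<Rightarrow> bool"
  for R :: net and T :: state where
  "l \<in># R \<Longrightarrow> active R T l"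
| "active R T (Bot e C) \<Longrightarrow> Lock e 0 \<in> ran T \<Longrightarrow> l \<in># C \<Longrightarrow> active R T l"

text \<open>Moves of a single token through a link.\<close>

inductive move :: "edge link \<Rightarrow> pos \<Rightarrow> pos \<Rightarrow> bool" where
  "m \<in> neg_atoms (ty e) \<Longrightarrow> move (Ax e f) (Pos e m) (Pos f m)"
| "m \<in> neg_atoms (ty f) \<Longrightarrow> move (Ax e f) (Pos f m) (Pos e m)"
| "m \<in> pos_atoms (ty e) \<Longrightarrow> move (Cut e f) (Pos e m) (Pos f m)"
| "m \<in> pos_atoms (ty f) \<Longrightarrow> move (Cut e f) (Pos f m) (Pos e m)"
| "l \<in> {Tens a b c, Par a b c} \<Longrightarrow> m \<in> pos_atoms (ty a) \<Longrightarrow> move l (Pos a m) (Pos c (Lft # m))"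
| "l \<in> {Tens a b c, Par a b c} \<Longrightarrow> m \<in> pos_atoms (ty b) \<Longrightarrow> move l (Pos b m) (Pos c (Rgt # m))"
| "l \<in> {Tens a b c, Par a b c} \<Longrightarrow> m \<in> neg_atoms (ty a) \<Longrightarrow> move l (Pos c (Lft # m)) (Pos a m)"
| "l \<in> {Tens a b c, Par a b c} \<Longrightarrow> m \<in> neg_atoms (ty b) \<Longrightarrow> move l (Pos c (Rgt # m)) (Pos b m)"
| "move (Bot e C) (Pos e []) (Lock e 0)"

definition in_pos :: "(edge \<times> edge) list \<Rightarrow> pos set" where
  "in_pos xs = {Pos e m | e m. e \<in> in_edges xs \<and> m \<in> pos_atoms (ty e) \<union> neg_atoms (ty e)}"

fun cross :: "(edge \<times> edge) list \<Rightarrow> pos \<Rightarrow> pos" where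
  "cross xs (Pos e m) = (case map_of (arcs xs) e of Some e' \<Rightarrow> Pos e' m | None \<Rightarrow> Pos e m)"
| "cross xs (Lock e i) = Lock e i"

inductive step :: "net \<Rightarrow> state \<Rightarrow> state \<Rightarrow> bool" for R :: net where
  step_move:
    "active R T l \<Longrightarrow> move l p q \<Longrightarrow> T t = Some p \<Longrightarrow> step R T (T(t \<mapsto> q))"
| step_sync:
    "active R T (Sync xs) \<Longrightarrow> in_pos xs \<subseteq> ran T \<Longrightarrow>
     step R T (\<lambda>t. map_option (cross xs) (T t))"
| step_one:
    "active R T (One e) \<Longrightarrow> T (Pos e []) = None \<Longrightarrow> step R T (T(Pos e [] \<mapsto> Pos e []))"

definition normal_state_of :: "net \<Rightarrow> state \<Rightarrow> bool" where
  "normal_state_of R T \<longleftrightarrow> (step R)\<^sup>*\<^sup>* (initial R) T \<and> (\<nexists>T'. step R T T')"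

datatype result = Deadlock | Result "pos \<rightharpoonup> pos"

text \<open>The normal state of a net exists and is unique.\<close>

definition interp :: "net \<Rightarrow> result" where
  "interp R = (let T = THE T. normal_state_of R T in
     if final R T then Result (T |` {p \<in> INIT R. T p \<notin> Some ` BOTBOX R}) else Deadlock)"

end

(* A machine position has at most one predecessor and at most one successor under the transitions,
   and a token starts where there is no predecessor. So tokens never cycle, runs terminate, and the
   normal state can be read off the least fixpoint of the reachable positions: each token ends at the
   last reachable position of its path. It is final iff every final position is reachable and every
   reachable position outside FIN and BOTBOX has a reachable successor; the result is then the path
   relation from INIT to FIN.

   On this description every reduction step is harmless. Up to the edge names that it changes,
   a step replaces some transitions by others having the same quotient once the transitions of
   unguarded links at depth 0 are contracted; opening a box in addition erases the isolated path from
   the one link to the lock. *)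

theory Submission
  imports Defs
begin

text \<open>The obstacle is timing. A sync makes tokens wait for one another, moving it changes the
  order of their moves, and deadlocks must correspond as well as results. Reachability of positions
  forgets this order. It is faithful to occupancy for two reasons. Guards are locks, which tokens
  never leave, so a guard that was ever reached is still occupied. A sync moves all its tokens
  together, so if one input has been passed and is empty again, all its outputs have been delivered.
  Transitions can be contracted only if they fire whenever their source is reached. At depth 0 this
  holds for every link that moves one token at a time; for a sync it holds when all its premisses
  are conclusions of unguarded ones. Hence the rules that move a sync contract the link next to it
  until both nets show the same sync arcs, and only the rule that erases a sync contracts the sync
  itself. Circles may exist among the transitions, but no token gets onto one: the only predecessor
  of a position on a circle lies on it too.\<close>

section \<open>Token machines on an abstract set of positions\<close>

text \<open>A rule is a guard, namely positions that have to be occupied, together with the arcs along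
  which its tokens move simultaneously. A birth is a guard and the position of a new token.\<close>

type_synonym 'p rule = "'p set \<times> ('p \<times> 'p) set"
type_synonym 'p birth = "'p set \<times> 'p"

text \<open>The last case asks for every source in \<open>A\<close> before it yields any target: one
  input that is never reached blocks all outputs of a sync, which is how deadlocks become visible
  here.\<close>

inductive_set reach :: "'p set \<Rightarrow> 'p birth set \<Rightarrow> 'p rule set \<Rightarrow> 'p set"
  for I :: "'p set" and B :: "'p birth set" and Ru :: "'p rule set" where
  reach_init: "p \<in> I \<Longrightarrow> p \<in> reach I B Ru"
| reach_birth: "(G, p) \<in> B \<Longrightarrow> (\<And>g. g \<in> G \<Longrightarrow> g \<in> reach I B Ru) \<Longrightarrow> p \<in> reach I B Ru"
| reach_rule: "(G, A) \<in> Ru \<Longrightarrow> (\<And>g. g \<in> G \<Longrightarrow> g \<in> reach I B Ru) \<Longrightarrow>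
    (\<And>p q. (p, q) \<in> A \<Longrightarrow> p \<in> reach I B Ru) \<Longrightarrow> (p, q) \<in> A \<Longrightarrow> q \<in> reach I B Ru"

definition moves :: "'p rule set \<Rightarrow> ('p \<times> 'p) set" where
  "moves Ru = (\<Union>r\<in>Ru. snd r)"

lemma movesI: "(G, A) \<in> Ru \<Longrightarrow> (p, q) \<in> A \<Longrightarrow> (p, q) \<in> moves Ru"
  unfolding moves_def by force

lemma movesE:
  assumes "(p, q) \<in> moves Ru"
  obtains G A where "(G, A) \<in> Ru" "(p, q) \<in> A"
  using assms unfolding moves_def by force

lemma moves_Un: "moves (Ru \<union> Ru') = moves Ru \<union> moves Ru'"
  by (auto simp: moves_def)

definition good :: "'p set \<Rightarrow> 'p birth set \<Rightarrow> 'p rule set \<Rightarrow> 'p set \<Rightarrow> 'p set \<Rightarrow> bool" where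
  "good I B Ru Fi Bb \<longleftrightarrow> Fi \<subseteq> reach I B Ru \<and>
     (\<forall>p \<in> reach I B Ru. p \<in> Fi \<union> Bb \<or> (\<exists>q \<in> reach I B Ru. (p, q) \<in> moves Ru))"

definition behaviour ::
  "'p set \<Rightarrow> 'p birth set \<Rightarrow> 'p rule set \<Rightarrow> 'p set \<Rightarrow> 'p set \<Rightarrow> bool \<times> ('p \<times> 'p) set" where
  "behaviour I B Ru Fi Bb = (good I B Ru Fi Bb, {(t, p). t \<in> I \<and> p \<in> Fi \<and> (t, p) \<in> (moves Ru)\<^sup>*})"

text \<open>Total on purpose: tokens outside the rule stay where they are, so one map updates the
  whole state.\<close>

definition advance :: "('p \<times> 'p) set \<Rightarrow> 'p \<Rightarrow> 'p" where
  "advance A p = (if \<exists>q. (p, q) \<in> A then THE q. (p, q) \<in> A else p)"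

inductive mstep :: "'p birth set \<Rightarrow> 'p rule set \<Rightarrow> ('p \<rightharpoonup> 'p) \<Rightarrow> ('p \<rightharpoonup> 'p) \<Rightarrow> bool"
  for B :: "'p birth set" and Ru :: "'p rule set" where
  mstep_rule: "(G, A) \<in> Ru \<Longrightarrow> G \<subseteq> ran T \<Longrightarrow> fst ` A \<subseteq> ran T \<Longrightarrow>
    mstep B Ru T (\<lambda>t. map_option (advance A) (T t))"
| mstep_birth: "(G, p) \<in> B \<Longrightarrow> G \<subseteq> ran T \<Longrightarrow> T p = None \<Longrightarrow> mstep B Ru T (T(p \<mapsto> p))"

text \<open>By \<open>rule_unique\<close> the moves form disjoint paths and cycles, and an arc
  determines the rule it belongs to. The two assumptions on guards model locks: no token leaves a
  guard, so one that was ever visited is still occupied.\<close>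

locale token_machine =
  fixes I :: "'p set" and B :: "'p birth set" and Ru :: "'p rule set"
  assumes finite_init: "finite I" and finite_births: "finite (snd ` B)"
    and finite_moves: "finite (moves Ru)"
    and rule_unique: "(G, A) \<in> Ru \<Longrightarrow> (G', A') \<in> Ru \<Longrightarrow> (p, q) \<in> A \<Longrightarrow> (p', q') \<in> A' \<Longrightarrow>
      p = p' \<or> q = q' \<Longrightarrow> p = p' \<and> q = q' \<and> G = G' \<and> A = A'"
    and no_move_to_source: "(p, q) \<in> moves Ru \<Longrightarrow> q \<notin> I \<union> snd ` B"
    and rule_nonempty: "(G, A) \<in> Ru \<Longrightarrow> A \<noteq> {}"
    and rule_guard_stuck: "(G, A) \<in> Ru \<Longrightarrow> g \<in> G \<Longrightarrow> (g, q) \<notin> moves Ru"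
    and birth_guard_stuck: "(G, p) \<in> B \<Longrightarrow> g \<in> G \<Longrightarrow> (g, q) \<notin> moves Ru"
begin

abbreviation "sources \<equiv> I \<union> snd ` B"
abbreviation "mv \<equiv> moves Ru"
abbreviation "rch \<equiv> reach I B Ru"

section \<open>Paths of positions and their sources\<close>

lemma move_succ_unique: "(p, q) \<in> mv \<Longrightarrow> (p, q') \<in> mv \<Longrightarrow> q = q'"
  by (auto elim!: movesE dest: rule_unique)

lemma move_pred_unique: "(p, q) \<in> mv \<Longrightarrow> (p', q) \<in> mv \<Longrightarrow> p = p'"
  by (auto elim!: movesE dest: rule_unique)

lemma path_to_source: "(p, t) \<in> mv\<^sup>* \<Longrightarrow> t \<in> sources \<Longrightarrow> p = t"
  by (metis no_move_to_source rtranclE)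

lemma path_step_back: "(x, q) \<in> mv\<^sup>* \<Longrightarrow> (p, q) \<in> mv \<Longrightarrow> x = q \<or> (x, p) \<in> mv\<^sup>*"
  by (metis move_pred_unique rtranclE)

lemma path_step_forth: "(p, x) \<in> mv\<^sup>* \<Longrightarrow> (p, q) \<in> mv \<Longrightarrow> x = p \<or> (q, x) \<in> mv\<^sup>*"
  by (metis converse_rtranclE move_succ_unique)

text \<open>Walking backwards from \<open>x\<close> is deterministic.\<close>

lemma paths_to_comparable:
  assumes "(p, x) \<in> mv\<^sup>*" "(q, x) \<in> mv\<^sup>*"
  shows "(p, q) \<in> mv\<^sup>* \<or> (q, p) \<in> mv\<^sup>*"
  using assms
proof (induction rule: converse_rtrancl_induct)
  case (step y z)
  then show ?case by (metis path_step_back converse_rtrancl_into_rtrancl r_into_rtrancl)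
qed auto

lemma source_unique:
  assumes "t \<in> sources" "t' \<in> sources" "(t, p) \<in> mv\<^sup>*" "(t', p) \<in> mv\<^sup>*"
  shows "t = t'"
  using paths_to_comparable[OF assms(3,4)] path_to_source[OF _ assms(1)] path_to_source[OF _ assms(2)]
  by metis

text \<open>A cycle through \<open>p\<close> could be pulled back along the path from
  \<open>t\<close>, one move at a time, until it passed through the source \<open>t\<close>, which
  has no incoming move.\<close>

lemma acyclic_from_source:
  assumes "(t, p) \<in> mv\<^sup>*" "t \<in> sources" "(p, q) \<in> mv"
  shows "(q, p) \<notin> mv\<^sup>*"
  using assms
proof (induction arbitrary: q rule: rtrancl_induct)
  case base
  then show ?case using path_to_source no_move_to_source by blast
next
  case (step y z)
  show ?case
  proof
    assume "(q, z) \<in> mv\<^sup>*"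
    from path_step_back[OF this step.hyps(2)] have "q = z \<or> (q, y) \<in> mv\<^sup>*" .
    then have "(z, y) \<in> mv\<^sup>*"
      using path_step_back[OF _ step.hyps(2)] step.prems(2) step.hyps(2) move_pred_unique
      by (metis converse_rtrancl_into_rtrancl rtrancl.rtrancl_refl)
    then show False using step.IH[OF step.prems(1) step.hyps(2)] by blast
  qed
qed

lemma rch_subset: "rch \<subseteq> sources \<union> Range mv"
proof
  fix p assume "p \<in> rch"
  then show "p \<in> sources \<union> Range mv"
    by cases (auto dest: movesI intro: rev_image_eqI)
qed

lemma finite_rch: "finite rch"
  using rch_subset by (rule finite_subset) (simp add: finite_init finite_births finite_moves finite_Range)

text \<open>On the finite set \<open>X\<close> the successor map is injective, hence a permutation,
  so every element of \<open>X\<close> has its predecessor in \<open>X\<close>. Induction on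
  reachability then excludes every reachable position from \<open>X\<close>: a source has no
  predecessor, and the predecessor of any other position was excluded before. This is what rules out
  an endless chain of contracted moves.\<close>

lemma no_closed_set:
  assumes "X \<subseteq> rch" "\<And>p. p \<in> X \<Longrightarrow> \<exists>q \<in> X. (p, q) \<in> mv"
  shows "X = {}"
proof -
  obtain s where s: "\<And>p. p \<in> X \<Longrightarrow> s p \<in> X \<and> (p, s p) \<in> mv" using assms(2) by metis
  have fin: "finite X" using assms(1) finite_rch finite_subset by blast
  have "inj_on s X" by (rule inj_onI) (metis s move_pred_unique)
  then have surj: "s ` X = X" using fin s by (simp add: endo_inj_surj image_subset_iff)
  have "p \<notin> X" if "p \<in> rch" for p
    using that
  proof induction
    case (reach_init p)
    then show ?case using surj s no_move_to_source by (metis UnI1 imageE)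
  next
    case (reach_birth G p)
    then show ?case using surj s no_move_to_source by (metis UnI2 imageE image_eqI snd_conv)
  next
    case (reach_rule G A p q)
    then show ?case using surj s by (metis imageE move_pred_unique movesI)
  qed
  then show ?thesis using assms(1) by blast
qed

section \<open>Trails of tokens and the invariant of states\<close>

lemma advance_eq: "(G, A) \<in> Ru \<Longrightarrow> (p, q) \<in> A \<Longrightarrow> advance A p = q"
  unfolding advance_def by (auto dest: rule_unique intro!: the_equality)

lemma advance_other: "(\<And>q. (p, q) \<notin> A) \<Longrightarrow> advance A p = p"
  unfolding advance_def by auto

text \<open>Occupied positions come and go, but trails only grow; a run is compared with
  \<open>reach\<close> through them.\<close>

definition visited :: "('p \<rightharpoonup> 'p) \<Rightarrow> 'p set" where
  "visited T = {q. \<exists>t p. T t = Some p \<and> (t, q) \<in> mv\<^sup>* \<and> (q, p) \<in> mv\<^sup>*}"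

lemma visitedI: "T t = Some p \<Longrightarrow> (t, q) \<in> mv\<^sup>* \<Longrightarrow> (q, p) \<in> mv\<^sup>* \<Longrightarrow> q \<in> visited T"
  unfolding visited_def by blast

lemma visitedE:
  assumes "q \<in> visited T"
  obtains t p where "T t = Some p" "(t, q) \<in> mv\<^sup>*" "(q, p) \<in> mv\<^sup>*"
  using assms unfolding visited_def by blast

text \<open>The last clause is atomicity: once one target of a rule lies on a trail, the rule has
  fired and all its targets do.\<close>

definition valid :: "('p \<rightharpoonup> 'p) \<Rightarrow> bool" where
  "valid T \<longleftrightarrow> I \<subseteq> dom T \<and> dom T \<subseteq> sources \<and> (\<forall>t p. T t = Some p \<longrightarrow> (t, p) \<in> mv\<^sup>*) \<and>
     visited T \<subseteq> rch \<and>
     (\<forall>G A. (G, A) \<in> Ru \<longrightarrow> snd ` A \<inter> visited T \<noteq> {} \<longrightarrow> snd ` A \<subseteq> visited T)"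

lemma valid_path: "valid T \<Longrightarrow> T t = Some p \<Longrightarrow> t \<in> sources \<and> (t, p) \<in> mv\<^sup>*"
  unfolding valid_def by auto

lemma valid_visited: "valid T \<Longrightarrow> visited T \<subseteq> rch"
  unfolding valid_def by simp

lemma valid_rule:
  assumes "valid T" "(G, A) \<in> Ru" "(p, q) \<in> A" "q \<in> visited T"
  shows "snd ` A \<subseteq> visited T"
proof -
  have "q \<in> snd ` A \<inter> visited T" using assms(3,4) by force
  then have "snd ` A \<inter> visited T \<noteq> {}" by blast
  then show ?thesis using assms(1,2) unfolding valid_def by simp
qed

lemma valid_inj:
  assumes "valid T" "T t = Some p" "T t' = Some p"
  shows "t = t'"
  by (rule source_unique[of _ _ p]) (use assms in \<open>auto simp: valid_def\<close>)

lemma ran_visited: "valid T \<Longrightarrow> ran T \<subseteq> visited T"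
  unfolding visited_def valid_def ran_def by fast

definition start :: "'p \<rightharpoonup> 'p" where "start p = (if p \<in> I then Some p else None)"

lemma valid_start: "valid start"
proof -
  have "visited start = I"
  proof (intro equalityI subsetI)
    fix q assume "q \<in> visited start"
    then obtain t p where "start t = Some p" "(t, q) \<in> mv\<^sup>*" "(q, p) \<in> mv\<^sup>*" by (rule visitedE)
    then show "q \<in> I" using path_to_source[of q p] by (auto simp: start_def split: if_splits)
  next
    fix q assume "q \<in> I"
    then show "q \<in> visited start" by (intro visitedI[of _ q q]) (auto simp: start_def)
  qed
  moreover have "snd ` A \<inter> I = {}" if "(G, A) \<in> Ru" for G A
    using that no_move_to_source movesI by fastforce
  ultimately show ?thesis
    unfolding valid_def by (auto simp: start_def dom_def split: if_splits intro: reach.intros)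
qed

lemma visited_rule:
  assumes "(G, A) \<in> Ru" "fst ` A \<subseteq> ran T" "valid T"
  shows "visited (\<lambda>t. map_option (advance A) (T t)) = visited T \<union> snd ` A" (is "visited ?T' = _")
proof (intro equalityI subsetI)
  fix x assume "x \<in> visited ?T'"
  then obtain t p where tp: "T t = Some p" "(t, x) \<in> mv\<^sup>*" "(x, advance A p) \<in> mv\<^sup>*"
    unfolding visited_def by auto
  show "x \<in> visited T \<union> snd ` A"
  proof (cases "\<exists>q. (p, q) \<in> A")
    case True
    then obtain q where q: "(p, q) \<in> A" by blast
    then have "advance A p = q" using assms advance_eq by blast
    then have "x = q \<or> (x, p) \<in> mv\<^sup>*" using tp path_step_back movesI assms(1) q by metis
    then show ?thesis using tp q unfolding visited_def by force
  next
    case False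
    then show ?thesis using tp advance_other unfolding visited_def by (metis (mono_tags, lifting) UnI1 mem_Collect_eq)
  qed
next
  fix x assume "x \<in> visited T \<union> snd ` A"
  then show "x \<in> visited ?T'"
  proof
    assume "x \<in> visited T"
    then obtain t p where tp: "T t = Some p" "(t, x) \<in> mv\<^sup>*" "(x, p) \<in> mv\<^sup>*"
      unfolding visited_def by auto
    have "(p, advance A p) \<in> mv\<^sup>*"
      using assms(1) advance_eq advance_other movesI by (metis r_into_rtrancl rtrancl.rtrancl_refl)
    then have "(x, advance A p) \<in> mv\<^sup>*" using tp by auto
    then show ?thesis using tp unfolding visited_def by auto
  next
    assume "x \<in> snd ` A"
    then obtain p where p: "(p, x) \<in> A" by auto
    then obtain t where t: "T t = Some p" using assms(2) unfolding ran_def by force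
    then have "(t, x) \<in> mv\<^sup>*"
      using p assms(1,3) unfolding valid_def by (metis movesI rtrancl.rtrancl_into_rtrancl)
    moreover have "advance A p = x" using assms(1) p advance_eq by blast
    ultimately show ?thesis using t unfolding visited_def by auto
  qed
qed

lemma visited_birth:
  assumes "(G, p) \<in> B" "T p = None"
  shows "visited (T(p \<mapsto> p)) = insert p (visited T)"
proof -
  have "p \<in> sources" using assms by force
  then have eq: "q = p" if "(q, p) \<in> mv\<^sup>*" for q using that path_to_source by blast
  show ?thesis
  proof (intro equalityI subsetI)
    fix q assume "q \<in> visited (T(p \<mapsto> p))"
    then show "q \<in> insert p (visited T)"
      by (elim visitedE) (auto split: if_splits dest: eq intro: visitedI)
  next
    fix q assume "q \<in> insert p (visited T)"
    then show "q \<in> visited (T(p \<mapsto> p))"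
    proof
      assume "q = p"
      then show ?thesis by (intro visitedI[of _ p p]) auto
    next
      assume "q \<in> visited T"
      then obtain t p' where "T t = Some p'" "(t, q) \<in> mv\<^sup>*" "(q, p') \<in> mv\<^sup>*" by (rule visitedE)
      then show ?thesis using assms(2) by (intro visitedI[of _ t p']) auto
    qed
  qed
qed

lemma valid_mstep:
  assumes "mstep B Ru T T'" "valid T"
  shows "valid T'"
  using assms(1)
proof cases
  case (mstep_rule G A)
  have vis: "visited T' = visited T \<union> snd ` A"
    using visited_rule mstep_rule assms(2) by blast
  have "ran T \<subseteq> rch" using ran_visited[OF assms(2)] valid_visited[OF assms(2)] by blast
  then have "G \<subseteq> rch" "fst ` A \<subseteq> rch" using mstep_rule(3,4) by blast+
  then have "q \<in> rch" if "(p, q) \<in> A" for p q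
    using that by (intro reach_rule[OF mstep_rule(2), where p = p and q = q]) force+
  then have "snd ` A \<subseteq> rch" by auto
  moreover have "(t, advance A p) \<in> mv\<^sup>*" if "T t = Some p" for t p
  proof (cases "\<exists>q. (p, q) \<in> A")
    case True
    then obtain q where "(p, q) \<in> A" by blast
    moreover have "(t, p) \<in> mv\<^sup>*" using that assms(2) unfolding valid_def by blast
    ultimately show ?thesis using advance_eq[OF mstep_rule(2)] movesI[OF mstep_rule(2)]
      by (metis rtrancl.rtrancl_into_rtrancl)
  next
    case False
    then show ?thesis using that assms(2) advance_other[where A = A and p = p] unfolding valid_def by simp
  qed
  \<comment> \<open>Rules with a common target are equal, so a rule touched by the new part of the
    trails is the one just fired.\<close>
  moreover have "snd ` A' \<subseteq> visited T'" if "(G', A') \<in> Ru" "snd ` A' \<inter> visited T' \<noteq> {}" for G' A'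
  proof (cases "snd ` A' \<inter> snd ` A = {}")
    case True
    then have "snd ` A' \<inter> visited T \<noteq> {}" using that(2) vis by blast
    moreover have "snd ` A' \<inter> visited T \<noteq> {} \<longrightarrow> snd ` A' \<subseteq> visited T"
      using assms(2) that(1) unfolding valid_def by simp
    ultimately show ?thesis using vis by blast
  next
    case False
    then obtain x p p' where "(p, x) \<in> A'" "(p', x) \<in> A" by force
    then have "A' = A" using rule_unique[OF that(1) mstep_rule(2)] by blast
    then show ?thesis using vis by simp
  qed
  ultimately show ?thesis
    using assms(2) vis unfolding valid_def mstep_rule(1) by (auto simp: dom_def)
next
  case (mstep_birth G p)
  have vis: "visited T' = insert p (visited T)"
    using visited_birth mstep_birth by blast
  have src: "p \<in> sources" using mstep_birth by force
  have "G \<subseteq> rch"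
    using mstep_birth(3) ran_visited[OF assms(2)] valid_visited[OF assms(2)] by blast
  then have p_rch: "p \<in> rch" by (intro reach_birth[OF mstep_birth(2)]) blast
  have not_src: "p \<notin> snd ` A" if "(G, A) \<in> Ru" for G A
  proof
    assume "p \<in> snd ` A"
    then obtain q where "(q, p) \<in> A" by auto
    then show False using no_move_to_source[OF movesI[OF that]] src by blast
  qed
  have all: "snd ` A \<subseteq> visited T'" if "(G, A) \<in> Ru" "snd ` A \<inter> visited T' \<noteq> {}" for G A
  proof -
    have "snd ` A \<inter> visited T \<noteq> {}" using that(2) not_src[OF that(1)] unfolding vis by simp
    moreover have "snd ` A \<inter> visited T \<noteq> {} \<longrightarrow> snd ` A \<subseteq> visited T"
      using assms(2) that(1) unfolding valid_def by simp
    ultimately show ?thesis using vis by blast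
  qed
  have dom: "I \<subseteq> dom T" "dom T \<subseteq> sources" using assms(2) by (simp_all add: valid_def)
  have path: "(t, q) \<in> mv\<^sup>*" if "T' t = Some q" for t q
    using that valid_path[OF assms(2)] unfolding mstep_birth(1) by (auto split: if_splits)
  have dom': "dom T' = insert p (dom T)" unfolding mstep_birth(1) by auto
  show ?thesis unfolding valid_def
  proof (intro conjI allI impI)
    show "I \<subseteq> dom T'" "dom T' \<subseteq> sources" unfolding dom' using dom src by auto
    show "visited T' \<subseteq> rch" unfolding vis using p_rch valid_visited[OF assms(2)] by simp
  qed (fact path all)+
qed

text \<open>A token that has passed \<open>q\<close> came through \<open>p\<close>, so it has the
  source of the token now at \<open>p\<close> and is that token. Its path would lead from
  \<open>q\<close> back to \<open>p\<close>.\<close>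

lemma current_succ_not_visited:
  assumes "valid T" "T t = Some p" "(p, q) \<in> mv"
  shows "q \<notin> visited T"
proof
  assume "q \<in> visited T"
  then obtain t' p' where t': "T t' = Some p'" "(t', q) \<in> mv\<^sup>*" "(q, p') \<in> mv\<^sup>*"
    unfolding visited_def by auto
  have src: "t \<in> sources" "t' \<in> sources" "(t, p) \<in> mv\<^sup>*"
    using assms t' unfolding valid_def by auto
  have "t' \<noteq> q" using src no_move_to_source assms(3) by blast
  then have "(t', p) \<in> mv\<^sup>*" using path_step_back t' assms(3) by metis
  then have "t = t'" using source_unique src by blast
  then have "p' = p" using t'(1) assms(2) by simp
  then show False using t'(3) acyclic_from_source[OF src(3,1) assms(3)] by simp
qed

text \<open>Strict growth inside the finite set \<open>rch\<close> bounds the length of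
  runs.\<close>

lemma visited_mstep:
  assumes "mstep B Ru T T'" "valid T"
  shows "visited T \<subset> visited T'"
  using assms(1)
proof cases
  case (mstep_rule G A)
  obtain p q where pq: "(p, q) \<in> A" using rule_nonempty[OF mstep_rule(2)] by auto
  then obtain t where "T t = Some p" using mstep_rule unfolding ran_def by force
  then have "q \<notin> visited T" using current_succ_not_visited assms(2) pq mstep_rule movesI by metis
  moreover have "q \<in> snd ` A" using pq by force
  moreover have "visited T' = visited T \<union> snd ` A"
    using visited_rule[OF mstep_rule(2,4) assms(2)] mstep_rule(1) by simp
  ultimately show ?thesis by blast
next
  case (mstep_birth G p)
  have "p \<notin> visited T"
    using mstep_birth path_to_source unfolding visited_def by force
  then show ?thesis using visited_birth mstep_birth by auto
qed

section \<open>Normal states\<close>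

definition terminal :: "'p \<Rightarrow> bool" where
  "terminal p \<longleftrightarrow> p \<in> rch \<and> (\<forall>q \<in> rch. (p, q) \<notin> mv)"

lemma normal_visited:
  assumes "valid T" "\<nexists>T'. mstep B Ru T T'"
  shows "visited T = rch"
proof
  show "visited T \<subseteq> rch" using assms(1) by (simp add: valid_def)
  \<comment> \<open>A token that has come to such a \<open>g\<close> cannot have left it.\<close>
  have stuck: "g \<in> ran T" if "g \<in> visited T" "\<And>q. (g, q) \<notin> mv" for g
  proof -
    from that(1) obtain t p where "T t = Some p" "(t, g) \<in> mv\<^sup>*" "(g, p) \<in> mv\<^sup>*" by (rule visitedE)
    then show ?thesis using that(2) by (metis converse_rtranclE ranI)
  qed
  show "rch \<subseteq> visited T"
  proof
    fix p assume "p \<in> rch"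
    then show "p \<in> visited T"
    proof induction
      case (reach_init p)
      moreover have "I \<subseteq> dom T" using assms(1) by (simp add: valid_def)
      ultimately obtain q where "T p = Some q" by blast
      then show ?case using valid_path[OF assms(1)] visitedI[of T p q p] by blast
    next
      case (reach_birth G p)
      have "G \<subseteq> ran T"
        using stuck[OF reach_birth.IH birth_guard_stuck[OF reach_birth.hyps(1)]] by (intro subsetI)
      then obtain q where "T p = Some q"
        using assms(2) mstep_birth[OF reach_birth.hyps(1)] by (metis not_None_eq)
      then show ?case using valid_path[OF assms(1)] visitedI[of T p q p] by blast
    next
      case (reach_rule G A p q)
      have "G \<subseteq> ran T"
        using stuck[OF reach_rule.IH(1) rule_guard_stuck[OF reach_rule.hyps(1)]] by (intro subsetI)
      \<comment> \<open>The guards are occupied but the rule cannot fire, so some input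
        \<open>p'\<close> is empty although it was visited. Its token has gone on to
        \<open>q'\<close>, and by atomicity the whole rule has fired.\<close>
      then have "\<not> fst ` A \<subseteq> ran T" using assms(2) mstep_rule[OF reach_rule.hyps(1)] by metis
      then obtain p' where "p' \<in> fst ` A" "p' \<notin> ran T" by blast
      then obtain q' where p': "(p', q') \<in> A" "p' \<notin> ran T" by auto
      then obtain t p'' where t: "T t = Some p''" "(t, p') \<in> mv\<^sup>*" "(p', p'') \<in> mv\<^sup>*"
        using reach_rule.IH(2)[OF p'(1)] by (elim visitedE)
      have "p'' \<noteq> p'" using p' t by (auto simp: ran_def)
      moreover have mv: "(p', q') \<in> mv" using movesI[OF reach_rule.hyps(1) p'(1)] .
      ultimately have "(q', p'') \<in> mv\<^sup>*" using path_step_forth[OF t(3)] by blast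
      then have "q' \<in> visited T"
        using visitedI[of T t p'' q', OF t(1) rtrancl.rtrancl_into_rtrancl[OF t(2) mv]] by blast
      then have "snd ` A \<subseteq> visited T"
        using valid_rule[OF assms(1) reach_rule.hyps(1) p'(1)] by blast
      moreover have "q \<in> snd ` A" using reach_rule.hyps by force
      ultimately show ?case by blast
    qed
  qed
qed

text \<open>The right-hand side does not mention the run that produced \<open>T\<close>, so normal
  states are unique without any confluence argument.\<close>

lemma normal_iff:
  assumes "valid T" "\<nexists>T'. mstep B Ru T T'"
  shows "T t = Some p \<longleftrightarrow> t \<in> sources \<and> (t, p) \<in> mv\<^sup>* \<and> terminal p"
proof
  note vis = normal_visited[OF assms]
  assume Tt: "T t = Some p"
  then have "p \<in> rch" using vis ran_visited assms(1) unfolding ran_def by blast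
  then have "terminal p" unfolding terminal_def using current_succ_not_visited[OF assms(1) Tt] vis by blast
  then show "t \<in> sources \<and> (t, p) \<in> mv\<^sup>* \<and> terminal p" using Tt assms(1) unfolding valid_def by auto
next
  note vis = normal_visited[OF assms]
  assume a: "t \<in> sources \<and> (t, p) \<in> mv\<^sup>* \<and> terminal p"
  then have "p \<in> visited T" using vis unfolding terminal_def by blast
  then obtain t' p' where t': "T t' = Some p'" "(t', p) \<in> mv\<^sup>*" "(p, p') \<in> mv\<^sup>*"
    unfolding visited_def by auto
  have "t' \<in> sources" using t' assms(1) unfolding valid_def by auto
  then have "t' = t" using source_unique a t' by blast
  moreover have "p' = p"
  proof (rule ccontr)
    assume "p' \<noteq> p"
    then obtain y where y: "(p, y) \<in> mv" "(y, p') \<in> mv\<^sup>*" using t' by (metis converse_rtranclE)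
    then have "y \<in> visited T" using t' unfolding visited_def
      by (metis (mono_tags, lifting) mem_Collect_eq rtrancl.rtrancl_into_rtrancl)
    then show False using a y vis unfolding terminal_def by blast
  qed
  ultimately show "T t = Some p" using t' by simp
qed

lemma normal_ran:
  assumes "valid T" "\<nexists>T'. mstep B Ru T T'"
  shows "ran T = {p. terminal p}"
proof (intro equalityI subsetI)
  fix p assume "p \<in> ran T"
  then show "p \<in> {p. terminal p}" using normal_iff[OF assms] unfolding ran_def by auto
next
  fix p assume "p \<in> {p. terminal p}"
  then have p: "terminal p" by auto
  then have "p \<in> visited T" using normal_visited[OF assms] unfolding terminal_def by auto
  then obtain t where "t \<in> sources" "(t, p) \<in> mv\<^sup>*"
    using valid_path[OF assms(1)] by (elim visitedE) blast
  then have "T t = Some p" using normal_iff[OF assms] p by blast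
  then show "p \<in> ran T" by (auto simp: ran_def)
qed

lemma valid_steps: "(mstep B Ru)\<^sup>*\<^sup>* start T \<Longrightarrow> valid T"
  by (induction rule: rtranclp_induct) (auto intro: valid_start valid_mstep)

lemma normal_exists: "\<exists>T. (mstep B Ru)\<^sup>*\<^sup>* start T \<and> (\<nexists>T'. mstep B Ru T T')"
proof -
  have "\<exists>T'. (mstep B Ru)\<^sup>*\<^sup>* T T' \<and> (\<nexists>T''. mstep B Ru T' T'')" if "valid T" for T
    using that
  proof (induction "card (rch - visited T)" arbitrary: T rule: less_induct)
    case less
    show ?case
    proof (cases "\<exists>T'. mstep B Ru T T'")
      case True
      then obtain T' where T': "mstep B Ru T T'" by blast
      then have v: "valid T'" "visited T \<subset> visited T'"
        using less.prems valid_mstep visited_mstep by blast+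
      then have "visited T' \<subseteq> rch" by (simp add: valid_def)
      then have "rch - visited T' \<subset> rch - visited T" using v(2) by blast
      then have "card (rch - visited T') < card (rch - visited T)"
        using finite_rch by (meson finite_Diff psubset_card_mono)
      then show ?thesis using less.hyps[OF _ v(1)] T' by (meson converse_rtranclp_into_rtranclp)
    qed auto
  qed
  then show ?thesis using valid_start by blast
qed

end

section \<open>Contracting and erasing rules\<close>

definition push_births :: "('p \<Rightarrow> 'p) \<Rightarrow> 'p birth set \<Rightarrow> 'p birth set" where
  "push_births \<phi> B = (\<lambda>(G, p). (\<phi> ` G, \<phi> p)) ` B"

definition push_rules :: "('p \<Rightarrow> 'p) \<Rightarrow> 'p rule set \<Rightarrow> 'p rule set" where
  "push_rules \<phi> H = (\<lambda>(G, A). (\<phi> ` G, map_prod \<phi> \<phi> ` A)) ` H"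

lemma push_births_iff: "(G', x) \<in> push_births \<phi> B \<longleftrightarrow> (\<exists>G p. (G, p) \<in> B \<and> G' = \<phi> ` G \<and> x = \<phi> p)"
  unfolding push_births_def by force

lemma push_rules_iff:
  "(G', A') \<in> push_rules \<phi> H \<longleftrightarrow> (\<exists>G A. (G, A) \<in> H \<and> G' = \<phi> ` G \<and> A' = map_prod \<phi> \<phi> ` A)"
  unfolding push_rules_def by force

lemma moves_push: "(x, y) \<in> moves (push_rules \<phi> H) \<longleftrightarrow> (\<exists>p q. (p, q) \<in> moves H \<and> x = \<phi> p \<and> y = \<phi> q)"
proof
  assume "(x, y) \<in> moves (push_rules \<phi> H)"
  then obtain G' A' where "(G', A') \<in> push_rules \<phi> H" "(x, y) \<in> A'" by (rule movesE)
  then obtain G A where "(G, A) \<in> H" "(x, y) \<in> map_prod \<phi> \<phi> ` A" by (auto simp: push_rules_iff)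
  then show "\<exists>p q. (p, q) \<in> moves H \<and> x = \<phi> p \<and> y = \<phi> q" by (auto dest: movesI)
next
  assume "\<exists>p q. (p, q) \<in> moves H \<and> x = \<phi> p \<and> y = \<phi> q"
  then obtain p q G A where *: "(G, A) \<in> H" "(p, q) \<in> A" "x = \<phi> p" "y = \<phi> q" by (auto elim: movesE)
  then have "(\<phi> ` G, map_prod \<phi> \<phi> ` A) \<in> push_rules \<phi> H" by (auto simp: push_rules_iff)
  moreover have "(x, y) \<in> map_prod \<phi> \<phi> ` A" using * by (force simp: map_prod_def)
  ultimately show "(x, y) \<in> moves (push_rules \<phi> H)" by (rule movesI)
qed

text \<open>The rules \<open>K\<close> are contracted and the rules \<open>H\<close> are kept. Every fibre of \<open>\<phi>\<close> is
  a chain of arcs of \<open>K\<close>, and \<open>H\<close> can enter it only at its first and leave it only at its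
  last position.\<close>

locale contraction = token_machine I B "K \<union> H"
  for I :: "'p set" and B :: "'p birth set" and K H :: "'p rule set" +
  fixes \<phi> :: "'p \<Rightarrow> 'p" and P Fi Bb :: "'p set"
  assumes K_H_disjoint: "K \<inter> H = {}"
    and K_id: "(p, q) \<in> moves K \<Longrightarrow> \<phi> p = \<phi> q"
    and K_fires: "(p, q) \<in> moves K \<Longrightarrow> p \<in> reach I B (K \<union> H) \<Longrightarrow> q \<in> reach I B (K \<union> H)"
    and phi_init: "p \<in> I \<Longrightarrow> \<phi> p = p"
    and phi_fin: "p \<in> Fi \<Longrightarrow> \<phi> p = p"
    and init_carrier: "I \<subseteq> P" and fin_carrier: "Fi \<subseteq> P" and bb_carrier: "Bb \<subseteq> P"
    and birth_carrier: "(G, p) \<in> B \<Longrightarrow> G \<subseteq> P \<and> p \<in> P"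
    and guard_carrier: "(G, A) \<in> H \<Longrightarrow> G \<subseteq> P"
    and move_carrier: "moves (K \<union> H) \<subseteq> P \<times> P"
    and fin_stuck: "p \<in> Fi \<union> Bb \<Longrightarrow> (p, q) \<notin> moves (K \<union> H)"
    and fibre: "p \<in> P \<Longrightarrow> p' \<in> P \<Longrightarrow> \<phi> p = \<phi> p' \<Longrightarrow> (p, p') \<in> (moves K)\<^sup>* \<or> (p', p) \<in> (moves K)\<^sup>*"
begin

abbreviation "rch' \<equiv> reach I (push_births \<phi> B) (push_rules \<phi> H)"

lemma K_mv: "(p, q) \<in> moves K \<Longrightarrow> (p, q) \<in> mv" and H_mv: "(p, q) \<in> moves H \<Longrightarrow> (p, q) \<in> mv"
  by (simp_all add: moves_Un)

text \<open>This confines \<open>H\<close> to the ends of a fibre: a shared source or target would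
  identify a rule of \<open>K\<close> with a rule of \<open>H\<close>.\<close>

lemma K_H_moves_disjoint:
  assumes "(p, q) \<in> moves K" "(p', q') \<in> moves H"
  shows "p \<noteq> p' \<and> q \<noteq> q'"
proof -
  obtain G A where K: "(G, A) \<in> K" "(p, q) \<in> A" using assms(1) by (rule movesE)
  obtain G' A' where H: "(G', A') \<in> H" "(p', q') \<in> A'" using assms(2) by (rule movesE)
  have "\<not> (p = p' \<or> q = q')"
  proof
    assume *: "p = p' \<or> q = q'"
    have "G = G' \<and> A = A'" using rule_unique[OF UnI1[OF K(1)] UnI2[OF H(1)] K(2) H(2) *] by (elim conjE) simp
    then show False using K(1) H(1) K_H_disjoint by auto
  qed
  then show ?thesis by simp
qed

lemma K_path_rch: "(p, q) \<in> (moves K)\<^sup>* \<Longrightarrow> p \<in> rch \<Longrightarrow> q \<in> rch"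
  by (induction rule: rtrancl_induct) (auto intro: K_fires)

lemma K_path_mv: "(p, q) \<in> (moves K)\<^sup>* \<Longrightarrow> (p, q) \<in> mv\<^sup>*"
  by (induction rule: rtrancl_induct) (auto dest: K_mv)

lemma fibre_from_first:
  assumes "p \<in> P" "q \<in> P" "\<phi> p = \<phi> q" "\<And>p'. (p', q) \<notin> moves K"
  shows "(q, p) \<in> (moves K)\<^sup>*"
  using fibre[OF assms(1-3)] assms(4) by (metis rtranclE rtrancl.rtrancl_refl)

lemma rch_carrier: "rch \<subseteq> P"
proof
  fix p assume "p \<in> rch"
  then have "p \<in> sources \<union> Range mv" using rch_subset by blast
  then show "p \<in> P" using init_carrier birth_carrier move_carrier by auto
qed

lemma reach_push:
  assumes "p \<in> rch"
  shows "\<phi> p \<in> rch'"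
  using assms
proof induction
  case (reach_init p)
  then show ?case using phi_init reach.reach_init by fastforce
next
  case (reach_birth G p)
  have "(\<phi> ` G, \<phi> p) \<in> push_births \<phi> B" using reach_birth.hyps(1) by (auto simp: push_births_iff)
  then show ?case by (rule reach.reach_birth) (use reach_birth.IH in auto)
next
  case (reach_rule G A p q)
  show ?case
  proof (cases "(G, A) \<in> K")
    case True
    then show ?thesis using K_id[OF movesI[OF True reach_rule.hyps(4)]] reach_rule by metis
  next
    case False
    then have "(\<phi> ` G, map_prod \<phi> \<phi> ` A) \<in> push_rules \<phi> H"
      using reach_rule.hyps(1) by (auto simp: push_rules_iff)
    then show ?thesis
      by (rule reach.reach_rule[where p = "\<phi> p"]) (use reach_rule in \<open>auto simp: rev_image_eqI\<close>)
  qed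
qed

text \<open>The second conjunct strengthens the induction. For guards and for the sources of a rule
  only the images are known to be reachable, so whole fibres have to be reachable in order to fire
  the rule upstairs.\<close>

lemma reach_lift:
  assumes "x \<in> rch'"
  shows "(\<exists>p \<in> rch. \<phi> p = x) \<and> (\<forall>p \<in> P. \<phi> p = x \<longrightarrow> p \<in> rch)"
proof -
  \<comment> \<open>Without an incoming contracted arc, \<open>q\<close> is the first position of
    its fibre, and by \<open>K_fires\<close> the contracted rules run from it through all the
    others.\<close>
  have first: "(\<exists>p \<in> rch. \<phi> p = \<phi> q) \<and> (\<forall>p \<in> P. \<phi> p = \<phi> q \<longrightarrow> p \<in> rch)"
    if "q \<in> rch" "\<And>p. (p, q) \<notin> moves K" for q
    using that rch_carrier fibre_from_first[of _ q] K_path_rch by blast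
  show ?thesis
    using assms
  proof induction
    case (reach_init x)
    have "x \<in> rch" using reach_init by (rule reach.reach_init)
    moreover have "(p, x) \<notin> moves K" for p
      using no_move_to_source[of p x] K_mv[of p x] reach_init by auto
    ultimately show ?case using first[of x] phi_init[OF reach_init] by simp
  next
    case (reach_birth G' x)
    then obtain G p where G: "(G, p) \<in> B" "G' = \<phi> ` G" "x = \<phi> p" by (auto simp: push_births_iff)
    have "p \<in> rch"
    proof (rule reach.reach_birth[OF G(1)])
      fix g assume "g \<in> G"
      then have "g \<in> P" "\<phi> g \<in> G'" using birth_carrier[OF G(1)] G(2) by auto
      then show "g \<in> rch" using reach_birth.IH[of "\<phi> g"] by simp
    qed
    moreover have "(p', p) \<notin> moves K" for p'
      using no_move_to_source[of p' p] K_mv[of p' p] G(1) by force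
    ultimately show ?case using first[of p] G(3) by simp
  next
    case (reach_rule G' A' x y)
    then obtain G A where G: "(G, A) \<in> H" "G' = \<phi> ` G" "A' = map_prod \<phi> \<phi> ` A" by (auto simp: push_rules_iff)
    then obtain p q where pq: "(p, q) \<in> A" "x = \<phi> p" "y = \<phi> q" using reach_rule.hyps by auto
    have "q \<in> rch"
    proof (rule reach.reach_rule[OF _ _ _ pq(1)])
      show "(G, A) \<in> K \<union> H" using G by simp
      fix g assume "g \<in> G"
      then have "g \<in> P" "\<phi> g \<in> G'" using guard_carrier[OF G(1)] G(2) by auto
      then show "g \<in> rch" using reach_rule.IH(1)[of "\<phi> g"] by simp
    next
      fix p' q' assume p': "(p', q') \<in> A"
      then have "p' \<in> P" using move_carrier H_mv[OF movesI[OF G(1)]] by blast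
      moreover have "(\<phi> p', \<phi> q') \<in> A'" using p' G(3) by (force simp: map_prod_def)
      ultimately show "p' \<in> rch" using reach_rule.IH(2)[of "\<phi> p'" "\<phi> q'"] by simp
    qed
    moreover have "(p', q) \<notin> moves K" for p'
      using K_H_moves_disjoint[of p' q p q] movesI[OF G(1) pq(1)] by auto
    ultimately show ?case using first[of q] pq(3) by simp
  qed
qed

text \<open>A final position or a lock has no outgoing arc, so it is the last of its fibre; every
  other member still has a contracted arc to follow.\<close>

lemma push_stuck:
  assumes "p \<in> P" "\<phi> p \<in> Fi \<union> \<phi> ` Bb"
  shows "p \<in> Fi \<union> Bb \<or> (\<exists>q. (p, q) \<in> moves K)"
proof -
  obtain b where b: "b \<in> Fi \<union> Bb" "\<phi> p = \<phi> b"
    using assms(2) phi_fin by (metis UnCI UnE imageE)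
  then have "(p, b) \<in> (moves K)\<^sup>* \<or> (b, p) \<in> (moves K)\<^sup>*"
    using fibre[OF assms(1), of b] fin_carrier bb_carrier by blast
  then show ?thesis
  proof
    assume "(p, b) \<in> (moves K)\<^sup>*"
    then show ?thesis using b(1) by (metis converse_rtranclE)
  next
    assume "(b, p) \<in> (moves K)\<^sup>*"
    then have "b = p" using fin_stuck[OF b(1)] K_mv by (metis converse_rtranclE)
    then show ?thesis using b(1) by simp
  qed
qed

lemma good_push: "good I B (K \<union> H) Fi Bb \<longleftrightarrow> good I (push_births \<phi> B) (push_rules \<phi> H) Fi (\<phi> ` Bb)"
proof
  assume g: "good I B (K \<union> H) Fi Bb"
  show "good I (push_births \<phi> B) (push_rules \<phi> H) Fi (\<phi> ` Bb)"
    unfolding good_def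
  proof (intro conjI ballI subsetI)
    fix p assume "p \<in> Fi"
    then show "p \<in> rch'" using g reach_push[of p] phi_fin unfolding good_def by auto
  next
    fix x assume x: "x \<in> rch'"
    show "x \<in> Fi \<union> \<phi> ` Bb \<or> (\<exists>q\<in>rch'. (x, q) \<in> moves (push_rules \<phi> H))"
    proof (rule ccontr)
      assume *: "\<not> ?thesis"
      \<comment> \<open>The reachable part of the fibre of \<open>x\<close>. If no kept arc leads on
        from \<open>x\<close>, each element of \<open>X\<close> can only move by a contracted arc,
        which stays in \<open>X\<close>; but no such closed set is inhabited.\<close>
      define X where "X = {p \<in> rch. \<phi> p = x}"
      have "\<exists>q \<in> X. (p, q) \<in> mv" if p: "p \<in> X" for p
      proof -
        have "p \<notin> Fi \<union> Bb" using p * phi_fin[of p] unfolding X_def by auto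
        then obtain q where q: "q \<in> rch" "(p, q) \<in> mv" using g p unfolding good_def X_def by auto
        have "(p, q) \<notin> moves H"
          using * reach_push[OF q(1)] p unfolding X_def by (auto simp: moves_push)
        then have "(p, q) \<in> moves K" using q(2) by (simp add: moves_Un)
        then have "\<phi> q = x" using K_id[of p q] p unfolding X_def by simp
        then show ?thesis using q unfolding X_def by auto
      qed
      then have "X = {}" by (intro no_closed_set) (auto simp: X_def)
      then show False using reach_lift[OF x] unfolding X_def by blast
    qed
  qed
next
  assume g: "good I (push_births \<phi> B) (push_rules \<phi> H) Fi (\<phi> ` Bb)"
  show "good I B (K \<union> H) Fi Bb"
    unfolding good_def
  proof (intro conjI ballI subsetI)
    fix p assume p: "p \<in> Fi"
    then have "p \<in> rch'" using g unfolding good_def by auto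
    then show "p \<in> rch" using reach_lift[of p] phi_fin[OF p] fin_carrier p by auto
  next
    fix p assume p: "p \<in> rch"
    then have pP: "p \<in> P" using rch_carrier by auto
    show "p \<in> Fi \<union> Bb \<or> (\<exists>q\<in>rch. (p, q) \<in> mv)"
    proof (cases "\<exists>q. (p, q) \<in> moves K")
      case True
      then obtain q where "(p, q) \<in> moves K" by blast
      then show ?thesis using K_fires[OF _ p, of q] K_mv[of p q] by blast
    next
      case noK: False
      show ?thesis
      proof (cases "\<phi> p \<in> Fi \<union> \<phi> ` Bb")
        case True
        then show ?thesis using push_stuck[OF pP True] noK by simp
      next
        case False
        then obtain y where y: "y \<in> rch'" "(\<phi> p, y) \<in> moves (push_rules \<phi> H)"
          using g reach_push[OF p] unfolding good_def by auto
        then obtain p' q' where p': "(p', q') \<in> moves H" "\<phi> p = \<phi> p'" "y = \<phi> q'"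
          by (auto simp: moves_push)
        then have P': "p' \<in> P" "q' \<in> P" using H_mv move_carrier by blast+
        have noK': "(p', q) \<notin> moves K" for q using K_H_moves_disjoint[OF _ p'(1)] by blast
        \<comment> \<open>Neither has an outgoing contracted arc, so both are the last position of
          the same fibre.\<close>
        have "p = p'" using fibre[OF pP P'(1) p'(2)] noK noK' by (metis converse_rtranclE)
        moreover have "q' \<in> rch" using reach_lift[OF y(1)] P' p'(3) by auto
        ultimately show ?thesis using H_mv[OF p'(1)] by blast
      qed
    qed
  qed
qed

lemma path_push: "(t, p) \<in> mv\<^sup>* \<Longrightarrow> (\<phi> t, \<phi> p) \<in> (moves (push_rules \<phi> H))\<^sup>*"
proof (induction rule: rtrancl_induct)
  case (step y z)
  consider "(y, z) \<in> moves K" | "(y, z) \<in> moves H" using step.hyps(2) by (auto simp: moves_Un)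
  then show ?case
  proof cases
    case 1
    then show ?thesis using K_id step.IH by metis
  next
    case 2
    then have "(\<phi> y, \<phi> z) \<in> moves (push_rules \<phi> H)" by (auto simp: moves_push)
    then show ?thesis using step.IH by (rule rtrancl.rtrancl_into_rtrancl[rotated])
  qed
qed simp

text \<open>All preimages are treated at once because the kept arc used next starts at an
  unspecified one of them.\<close>

lemma path_lift:
  assumes "(t, x) \<in> (moves (push_rules \<phi> H))\<^sup>*" "t \<in> I"
  shows "\<forall>p \<in> P. \<phi> p = x \<longrightarrow> (t, p) \<in> mv\<^sup>*"
  using assms(1)
proof (induction rule: rtrancl_induct)
  case base
  have "(p', t) \<notin> moves K" for p' using no_move_to_source[of p' t] K_mv[of p' t] assms(2) by auto
  moreover have "t \<in> P" using assms(2) init_carrier by auto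
  ultimately have "(t, p) \<in> (moves K)\<^sup>*" if "p \<in> P" "\<phi> p = t" for p
    using fibre_from_first[OF that(1), of t] that(2) phi_init[OF assms(2)] by simp
  then show ?case using K_path_mv by simp
next
  case (step x y)
  obtain p q where pq: "(p, q) \<in> moves H" "x = \<phi> p" "y = \<phi> q" using step.hyps(2) by (auto simp: moves_push)
  have P: "p \<in> P" "q \<in> P" using H_mv[OF pq(1)] move_carrier by auto
  have "(t, p) \<in> mv\<^sup>*" using step.IH P pq by auto
  then have tq: "(t, q) \<in> mv\<^sup>*" using H_mv[OF pq(1)] by simp
  have noK: "(p', q) \<notin> moves K" for p' using K_H_moves_disjoint[OF _ pq(1)] by blast
  show ?case
  proof (intro ballI impI)
    fix p' assume "p' \<in> P" "\<phi> p' = y"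
    then have "(q, p') \<in> (moves K)\<^sup>*" using fibre_from_first[OF _ P(2), of p'] noK pq(3) by auto
    then show "(t, p') \<in> mv\<^sup>*" using tq K_path_mv by (meson rtrancl_trans)
  qed
qed

theorem behaviour_push:
  "behaviour I B (K \<union> H) Fi Bb = behaviour I (push_births \<phi> B) (push_rules \<phi> H) Fi (\<phi> ` Bb)"
proof -
  have "(t, p) \<in> mv\<^sup>* \<longleftrightarrow> (t, p) \<in> (moves (push_rules \<phi> H))\<^sup>*" if "t \<in> I" "p \<in> Fi" for t p
    using path_push[of t p] path_lift[of t p] phi_init[OF that(1)] phi_fin[OF that(2)] that fin_carrier by auto
  then have "{(t, p). t \<in> I \<and> p \<in> Fi \<and> (t, p) \<in> mv\<^sup>*} =
      {(t, p). t \<in> I \<and> p \<in> Fi \<and> (t, p) \<in> (moves (push_rules \<phi> H))\<^sup>*}" by blast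
  then show ?thesis unfolding behaviour_def good_push by simp
qed

end

theorem behaviour_erase:
  fixes D :: "'p set" and H :: "'p rule set"
  assumes D: "D \<subseteq> reach I B (K \<union> H)" "D \<inter> I = {}" "D \<inter> Fi = {}"
    and K: "moves K \<subseteq> D \<times> D" and H: "moves H \<inter> (D \<times> UNIV \<union> UNIV \<times> D) = {}"
    and progress: "\<And>d. d \<in> D \<Longrightarrow> d \<in> Bb \<or> (\<exists>q \<in> D. (d, q) \<in> moves K)"
    and B': "B' = {(G - D, p) | G p. (G, p) \<in> B \<and> p \<notin> D}"
  shows "behaviour I B (K \<union> H) Fi Bb =
    behaviour I B' ((\<lambda>(G, A). (G - D, A)) ` H) Fi (Bb - D)"
    (is "_ = behaviour I B' ?H Fi _")
proof -
  have H'_iff: "(G', A) \<in> ?H \<longleftrightarrow> (\<exists>G. (G, A) \<in> H \<and> G' = G - D)" for G' A by force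
  have mv': "moves ?H = moves H" unfolding moves_def by force
  have fwd: "p \<in> D \<or> p \<in> reach I B' ?H" if "p \<in> reach I B (K \<union> H)" for p
    using that
  proof induction
    case (reach_init p)
    then show ?case using reach.reach_init by metis
  next
    case (reach_birth G p)
    show ?case
    proof (cases "p \<in> D")
      case False
      then have "(G - D, p) \<in> B'" using reach_birth.hyps(1) B' by auto
      then have "p \<in> reach I B' ?H" by (rule reach.reach_birth) (use reach_birth.IH in auto)
      then show ?thesis ..
    qed simp
  next
    case (reach_rule G A p q)
    show ?case
    proof (cases "(G, A) \<in> K")
      case True
      then show ?thesis using movesI[OF True reach_rule.hyps(4)] K by auto
    next
      case False
      then have GA: "(G, A) \<in> H" using reach_rule.hyps(1) by simp
      then have "(G - D, A) \<in> ?H" by (auto simp: H'_iff)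
      moreover have "p' \<in> reach I B' ?H" if "(p', q') \<in> A" for p' q'
        using reach_rule.IH(2)[OF that] movesI[OF GA that] H by auto
      ultimately have "q \<in> reach I B' ?H"
        using reach_rule.IH(1) reach_rule.hyps(4) by (intro reach.reach_rule[of "G - D" A _ _ _ p q]) auto
      then show ?thesis ..
    qed
  qed
  have bwd: "p \<in> reach I B (K \<union> H) \<and> p \<notin> D" if "p \<in> reach I B' ?H" for p
    using that
  proof induction
    case (reach_init p)
    then show ?case using D(2) reach.reach_init by auto
  next
    case (reach_birth G' p)
    then obtain G where G: "(G, p) \<in> B" "p \<notin> D" "G' = G - D" using B' by auto
    have "p \<in> reach I B (K \<union> H)"
      by (rule reach.reach_birth[OF G(1)]) (use reach_birth.IH G(3) D(1) in blast)
    then show ?case using G by simp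
  next
    case (reach_rule G' A p q)
    then obtain G where G: "(G, A) \<in> H" "G' = G - D" by (auto simp: H'_iff)
    have "q \<in> reach I B (K \<union> H)"
    proof (rule reach.reach_rule[OF _ _ _ reach_rule.hyps(4)])
      show "(G, A) \<in> K \<union> H" using G by simp
      show "g \<in> reach I B (K \<union> H)" if "g \<in> G" for g
        using that reach_rule.IH(1)[of g] G(2) D(1) by blast
    qed (use reach_rule.IH(2) in blast)
    moreover have "q \<notin> D" using movesI[OF G(1) reach_rule.hyps(4)] H by blast
    ultimately show ?case by simp
  qed
  have rch: "p \<in> reach I B' ?H \<longleftrightarrow> p \<in> reach I B (K \<union> H) \<and> p \<notin> D" for p
    using fwd bwd by blast
  have mvD: "(p, q) \<in> moves (K \<union> H) \<longleftrightarrow> (p, q) \<in> moves H" if "p \<notin> D" for p q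
    using that K by (auto simp: moves_Un)
  have good: "good I B (K \<union> H) Fi Bb \<longleftrightarrow> good I B' ?H Fi (Bb - D)"
  proof -
    have "Fi \<subseteq> reach I B (K \<union> H) \<longleftrightarrow> Fi \<subseteq> reach I B' ?H" using rch D(3) by blast
    moreover have "(\<forall>p \<in> reach I B (K \<union> H). p \<in> Fi \<union> Bb \<or> (\<exists>q \<in> reach I B (K \<union> H). (p, q) \<in> moves (K \<union> H)))
      \<longleftrightarrow> (\<forall>p \<in> reach I B' ?H. p \<in> Fi \<union> (Bb - D) \<or> (\<exists>q \<in> reach I B' ?H. (p, q) \<in> moves H))" (is "?l \<longleftrightarrow> ?r")
    proof
      assume l: ?l
      show ?r
      proof
        fix p assume "p \<in> reach I B' ?H"
        then have p: "p \<in> reach I B (K \<union> H)" "p \<notin> D" using rch by auto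
        then consider "p \<in> Fi \<union> Bb" | q where "q \<in> reach I B (K \<union> H)" "(p, q) \<in> moves (K \<union> H)" using l by blast
        then show "p \<in> Fi \<union> (Bb - D) \<or> (\<exists>q \<in> reach I B' ?H. (p, q) \<in> moves H)"
        proof cases
          case 1
          then show ?thesis using p by simp
        next
          case 2
          then have "(p, q) \<in> moves H" using mvD[OF p(2)] by simp
          moreover from this have "q \<in> reach I B' ?H" using 2 rch[of q] H by blast
          ultimately show ?thesis by blast
        qed
      qed
    next
      assume r: ?r
      show ?l
      proof
        fix p assume p: "p \<in> reach I B (K \<union> H)"
        show "p \<in> Fi \<union> Bb \<or> (\<exists>q \<in> reach I B (K \<union> H). (p, q) \<in> moves (K \<union> H))"
        proof (cases "p \<in> D")
          case True
          then show ?thesis using progress[OF True] D(1) by (auto simp: moves_Un)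
        next
          case False
          then have "p \<in> reach I B' ?H" using p rch by simp
          then have "p \<in> Fi \<union> (Bb - D) \<or> (\<exists>q \<in> reach I B' ?H. (p, q) \<in> moves H)" using r by blast
          then show ?thesis using rch by (auto simp: moves_Un)
        qed
      qed
    qed
    ultimately show ?thesis unfolding good_def mv' by simp
  qed
  have "(t, p) \<in> (moves (K \<union> H))\<^sup>* \<longleftrightarrow> (t, p) \<in> (moves H)\<^sup>*" if t: "t \<in> I" for t p
  proof
    assume "(t, p) \<in> (moves (K \<union> H))\<^sup>*"
    then have "(t, p) \<in> (moves H)\<^sup>* \<and> p \<notin> D"
    proof (induction rule: rtrancl_induct)
      case base
      then show ?case using t D(2) by auto
    next
      case (step y z)
      then have yz: "(y, z) \<in> moves H" using mvD by blast
      moreover have "z \<notin> D" using yz H by blast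
      ultimately show ?case using step.IH by auto
    qed
    then show "(t, p) \<in> (moves H)\<^sup>*" ..
  next
    assume "(t, p) \<in> (moves H)\<^sup>*"
    then show "(t, p) \<in> (moves (K \<union> H))\<^sup>*"
      by (rule subsetD[OF rtrancl_mono, rotated]) (auto simp: moves_Un)
  qed
  then show ?thesis unfolding behaviour_def good mv' by auto
qed

section \<open>Flattening the boxes\<close>

text \<open>A link at any depth is paired with the set of locks of the boxes around it. A box is reduced to
  its bot link, written \<open>Bot a {#}\<close>.\<close>

primrec flat :: "'e link \<Rightarrow> ('e set \<times> 'e link) multiset" where
  "flat (Ax a b) = {#({}, Ax a b)#}"
| "flat (Cut a b) = {#({}, Cut a b)#}"
| "flat (Tens a b c) = {#({}, Tens a b c)#}"
| "flat (Par a b c) = {#({}, Par a b c)#}"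
| "flat (One a) = {#({}, One a)#}"
| "flat (Bot a C) = add_mset ({}, Bot a {#})
     (image_mset (\<lambda>(G, l). (insert a G, l)) (sum_mset (image_mset flat C)))"
| "flat (Sync xs) = {#({}, Sync xs)#}"

definition flatten :: "'e link multiset \<Rightarrow> ('e set \<times> 'e link) multiset" where
  "flatten R = sum_mset (image_mset flat R)"

lemma flatten_simps [simp]:
  "flatten {#} = {#}" "flatten (add_mset l R) = flat l + flatten R" "flatten (R + S) = flatten R + flatten S"
  by (simp_all add: flatten_def)

lemma flat_Bot: "flat (Bot a C) = add_mset ({}, Bot a {#}) (image_mset (\<lambda>(G, l). (insert a G, l)) (flatten C))"
  by (simp add: flatten_def)

section \<open>Balance of premisses and conclusions\<close>

abbreviation prems_of :: "'e link multiset \<Rightarrow> 'e multiset" where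
  "prems_of R \<equiv> sum_mset (image_mset prems R)"

abbreviation concls_of :: "'e link multiset \<Rightarrow> 'e multiset" where
  "concls_of R \<equiv> sum_mset (image_mset concls R)"

definition fprems :: "('e set \<times> 'e link) multiset \<Rightarrow> 'e multiset" where
  "fprems F = sum_mset (image_mset (\<lambda>x. prems (snd x)) F)"

text \<open>A flattened bot link has an empty box, so its lock is its only conclusion here. The
  other conclusions of the box are counted at the links inside that produce them.\<close>

definition fconcls :: "('e set \<times> 'e link) multiset \<Rightarrow> 'e multiset" where
  "fconcls F = sum_mset (image_mset (\<lambda>x. concls (snd x)) F)"

lemma fprems_simps [simp]:
  "fprems {#} = {#}" "fprems (add_mset x F) = prems (snd x) + fprems F" "fprems (F + F') = fprems F + fprems F'"
  by (simp_all add: fprems_def)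

lemma fconcls_simps [simp]:
  "fconcls {#} = {#}" "fconcls (add_mset x F) = concls (snd x) + fconcls F" "fconcls (F + F') = fconcls F + fconcls F'"
  by (simp_all add: fconcls_def)

lemma fprems_guard [simp]: "fprems (image_mset (\<lambda>(G, l). (h G, l)) F) = fprems F"
  by (induction F) auto

lemma fconcls_guard [simp]: "fconcls (image_mset (\<lambda>(G, l). (h G, l)) F) = fconcls F"
  by (induction F) auto

lemma prems_le_fprems: "x \<in># F \<Longrightarrow> prems (snd x) \<subseteq># fprems F"
  by (metis fprems_simps(2) mset_add mset_subset_eq_add_left)

lemma concls_le_fconcls: "x \<in># F \<Longrightarrow> concls (snd x) \<subseteq># fconcls F"
  by (metis fconcls_simps(2) mset_add mset_subset_eq_add_left)

lemma link_edges_flat: "link_edges l = fconcls (flat l)"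
proof (induction l)
  case (Bot a C)
  have "sum_mset (image_mset link_edges C) = sum_mset (image_mset (\<lambda>x. fconcls (flat x)) C)"
    using Bot by (metis (no_types, lifting) image_mset_cong)
  also have "\<dots> = fconcls (flatten C)" by (induction C) auto
  finally show ?case by (simp add: flat_Bot del: flat.simps)
qed auto

lemma edges_flatten: "edges R = fconcls (flatten R)"
  by (induction R) (auto simp: edges_def link_edges_flat)

text \<open>Recursion on links replaces the quantifier over \<open>levels\<close>, so that
  preservation under renaming can be proved by induction on a link. The image in the box case is the
  form that primitive recursion through a multiset requires; \<open>wf_link_Bot\<close> restates it
  for use.\<close>

primrec wf_link :: "edge link \<Rightarrow> bool" where
  "wf_link (Ax a b) = typed (Ax a b)"
| "wf_link (Cut a b) = typed (Cut a b)"
| "wf_link (Tens a b c) = typed (Tens a b c)"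
| "wf_link (Par a b c) = typed (Par a b c)"
| "wf_link (One a) = typed (One a)"
| "wf_link (Bot a C) = (ty a = BotF \<and> prems_of C \<subseteq># concls_of C \<and> (\<forall>b \<in># image_mset wf_link C. b))"
| "wf_link (Sync xs) = typed (Sync xs)"

lemma wf_link_Bot: "wf_link (Bot a C) \<longleftrightarrow> ty a = BotF \<and> prems_of C \<subseteq># concls_of C \<and> (\<forall>l \<in># C. wf_link l)"
  by auto

declare wf_link.simps(6) [simp del] wf_link_Bot [simp]

definition wf_net :: "net \<Rightarrow> bool" where
  "wf_net R \<longleftrightarrow> (\<forall>l \<in># R. wf_link l) \<and> prems_of R \<subseteq># concls_of R \<and> (\<forall>e. count (edges R) e \<le> 1)"

lemma smll_structure_wf_net:
  assumes "smll_structure R"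
  shows "wf_net R"
proof -
  have lev: "(\<forall>l \<in># L. typed l) \<and> prems_of L \<subseteq># concls_of L" if "L \<in> levels R" for L
    using assms that unfolding smll_structure_def by blast
  have "wf_link l" if "L \<in> levels R" "l \<in># L" for l L
    using that
  proof (induction l arbitrary: L)
    case (Bot a C)
    have C: "C \<in> levels R" using Bot.prems by (rule levels.intros(2))
    then have "\<forall>l \<in># C. wf_link l" using Bot.IH by blast
    moreover have "typed (Bot a C)" using lev Bot.prems by blast
    ultimately show ?case using lev[OF C] by simp
  qed (use lev in \<open>force+\<close>)
  then show ?thesis using assms lev[of R] levels.intros(1)[of R]
    unfolding wf_net_def smll_structure_def by blast
qed

lemma conservation_sum:
  assumes "\<forall>l \<in># C. fprems (flat l) + concls l = prems l + fconcls (flat l)"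
  shows "fprems (flatten C) + concls_of C = prems_of C + fconcls (flatten C)"
  using assms
proof (induction C)
  case (add x C)
  have "fprems (flatten (add_mset x C)) + concls_of (add_mset x C)
      = (fprems (flat x) + concls x) + (fprems (flatten C) + concls_of C)"
    by (simp add: ac_simps)
  also have "\<dots> = (prems x + fconcls (flat x)) + (prems_of C + fconcls (flatten C))"
    using add by simp
  also have "\<dots> = prems_of (add_mset x C) + fconcls (flatten (add_mset x C))"
    by (simp add: ac_simps)
  finally show ?case .
qed simp

text \<open>At every depth each edge is a premiss exactly once or a conclusion of the net. For a single
  link this must be stated without subtraction, as the premisses at depth 0 come from outside.\<close>

lemma flat_conservation: "wf_link l \<Longrightarrow> fprems (flat l) + concls l = prems l + fconcls (flat l)"
proof (induction l)
  case (Bot a C)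
  have "\<forall>l \<in># C. fprems (flat l) + concls l = prems l + fconcls (flat l)" using Bot by simp
  then have "fprems (flatten C) + concls_of C = prems_of C + fconcls (flatten C)"
    by (rule conservation_sum)
  moreover have "prems_of C \<subseteq># concls_of C" using Bot.prems by simp
  ultimately have "fprems (flatten C) + (concls_of C - prems_of C) = fconcls (flatten C)"
    by (metis add_diff_cancel_left' multiset_diff_union_assoc)
  then show ?case by (simp add: flat_Bot del: flat.simps)
qed auto

lemma flatten_conservation:
  assumes "\<forall>l \<in># R. wf_link l" "prems_of R \<subseteq># concls_of R"
  shows "fprems (flatten R) + net_concls R = fconcls (flatten R)"
proof -
  have "\<forall>l \<in># R. fprems (flat l) + concls l = prems l + fconcls (flat l)" using assms(1) flat_conservation by auto
  then have "fprems (flatten R) + concls_of R = prems_of R + fconcls (flatten R)"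
    by (rule conservation_sum)
  then show ?thesis unfolding net_concls_def using assms(2)
    by (metis add_diff_cancel_left' multiset_diff_union_assoc)
qed

lemma flat_typed: "wf_link x \<Longrightarrow> (G, l) \<in># flat x \<Longrightarrow> typed l"
proof (induction x arbitrary: G l)
  case (Bot a C)
  then show ?case by (auto simp: split_beta)
qed auto

lemma flat_Bot_empty: "(G, Bot e C) \<in># flat x \<Longrightarrow> C = {#}"
proof (induction x arbitrary: G)
  case (Bot a D)
  then show ?case by (auto simp: split_beta)
qed auto

text \<open>Guards name boxes of the same flattening, hence every lock position in a guard is a
  position of the machine.\<close>

lemma flat_guard: "(G, l) \<in># flat x \<Longrightarrow> g \<in> G \<Longrightarrow> \<exists>G'. (G', Bot g {#}) \<in># flat x"
proof (induction x arbitrary: G l)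
  case (Bot a D)
  then obtain y G' where y: "y \<in># D" "(G', l) \<in># flat y" "G = insert a G'"
    by (auto simp: split_beta)
  show ?case
  proof (cases "g = a")
    case False
    then obtain G'' where "(G'', Bot g {#}) \<in># flat y" using Bot.IH[OF y(1,2)] Bot.prems(2) y(3) by auto
    then have "(insert a G'', Bot g {#}) \<in># flat (Bot a D)" using y(1) by force
    then show ?thesis by blast
  qed auto
qed auto

lemma mem_flatten: "x \<in># flatten R \<longleftrightarrow> (\<exists>l \<in># R. x \<in># flat l)"
  by (auto simp: flatten_def)

text \<open>The balance equation and the bound on counts make the net linear: every edge has one
  producer and one destination, which is either a premiss of one link or the conclusion
  \<open>K\<close>. Uniqueness of moves rests on this.\<close>

definition flat_net :: "(edge set \<times> edge link) multiset \<Rightarrow> edge multiset \<Rightarrow> bool" where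
  "flat_net F K \<longleftrightarrow> (\<forall>(G, l) \<in># F. typed l \<and> (\<forall>g \<in> G. \<exists>G'. (G', Bot g {#}) \<in># F) \<and>
       (\<forall>e C. l = Bot e C \<longrightarrow> C = {#})) \<and>
     fprems F + K = fconcls F \<and> (\<forall>e. count (fconcls F) e \<le> 1)"

lemma flat_net_flatten:
  assumes "wf_net R"
  shows "flat_net (flatten R) (net_concls R)"
proof -
  have "typed l \<and> (\<forall>g \<in> G. \<exists>G'. (G', Bot g {#}) \<in># flatten R) \<and> (\<forall>e C. l = Bot e C \<longrightarrow> C = {#})"
    if "(G, l) \<in># flatten R" for G l
  proof -
    obtain x where x: "x \<in># R" "(G, l) \<in># flat x" using \<open>(G, l) \<in># flatten R\<close> by (auto simp: mem_flatten)
    have "wf_link x" using assms x(1) unfolding wf_net_def by blast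
    then show ?thesis using flat_typed[OF _ x(2)] flat_guard[OF x(2)] flat_Bot_empty[of G _ _ x] x
      unfolding mem_flatten by blast
  qed
  moreover have "fprems (flatten R) + net_concls R = fconcls (flatten R)"
    using flatten_conservation assms unfolding wf_net_def by blast
  moreover have "count (fconcls (flatten R)) e \<le> 1" for e
    using assms unfolding wf_net_def edges_flatten by blast
  ultimately show ?thesis unfolding flat_net_def by blast
qed

lemma flat_map_link: "flat (map_link r l) = image_mset (\<lambda>(G, l). (r ` G, map_link r l)) (flat l)"
proof (induction l)
  case (Bot a C)
  have "flatten (image_mset (map_link r) C) = image_mset (\<lambda>(G, l). (r ` G, map_link r l)) (flatten C)"
    using Bot by (induction C) auto
  then show ?case by (simp add: flat_Bot multiset.map_comp comp_def split_beta del: flat.simps)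
qed auto

lemma flatten_map_link:
  "flatten (image_mset (map_link r) R) = image_mset (\<lambda>(G, l). (r ` G, map_link r l)) (flatten R)"
  by (induction R) (auto simp: flat_map_link)

section \<open>The machine of a flat net\<close>

abbreviation atoms :: "fm \<Rightarrow> addr set" where
  "atoms A \<equiv> pos_atoms A \<union> neg_atoms A"

lemma pos_neg_disjoint: "m \<in> pos_atoms A \<Longrightarrow> m \<notin> neg_atoms A"
  by (induction A arbitrary: m) auto

lemma pos_atoms_dual [simp]: "pos_atoms (dual A) = neg_atoms A"
  and neg_atoms_dual [simp]: "neg_atoms (dual A) = pos_atoms A"
  by (induction A) auto

lemma positive_neg_atoms: "positive A \<Longrightarrow> neg_atoms A = {}"
  by (induction A) auto

lemma negative_pos_atoms: "negative A \<Longrightarrow> pos_atoms A = {}"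
  by (induction A) auto

lemma finite_atoms: "finite (pos_atoms A)" "finite (neg_atoms A)"
  by (induction A) auto

lemma atoms_nonempty: "atoms A \<noteq> {}"
  by (induction A) auto

lemma negative_not_positive: "negative A \<Longrightarrow> \<not> positive A"
  by (cases A) auto

definition sync_arcs :: "(edge \<times> edge) list \<Rightarrow> (pos \<times> pos) set" where
  "sync_arcs xs = {(Pos e m, Pos e' m) | e e' m. (e, e') \<in> set (arcs xs) \<and> m \<in> atoms (ty e)}"

definition link_rules :: "edge link \<Rightarrow> (pos \<times> pos) set set" where
  "link_rules l = {{(p, q)} | p q. move l p q} \<union> {A. \<exists>xs. l = Sync xs \<and> A = sync_arcs xs}"

definition guard :: "edge set \<Rightarrow> pos set" where
  "guard G = (\<lambda>e. Lock e 0) ` G"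

definition net_rules :: "(edge set \<times> edge link) multiset \<Rightarrow> pos rule set" where
  "net_rules F = {(guard G, A) | G l A. (G, l) \<in># F \<and> A \<in> link_rules l}"

definition net_births :: "(edge set \<times> edge link) multiset \<Rightarrow> pos birth set" where
  "net_births F = {(guard G, Pos e []) | G e. (G, One e) \<in># F}"

definition net_init :: "edge multiset \<Rightarrow> pos set" where
  "net_init K = {Pos e m | e m. e \<in># K \<and> m \<in> neg_atoms (ty e)}"

definition net_fin :: "edge multiset \<Rightarrow> pos set" where
  "net_fin K = {Pos e m | e m. e \<in># K \<and> m \<in> pos_atoms (ty e)}"

text \<open>Indices other than 0 are left out because a token arrives at a lock only as
  \<open>Lock e 0\<close>; thus this set consists of the elements of \<open>BOTBOX\<close> that can
  be occupied.\<close>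

definition net_bb :: "(edge set \<times> edge link) multiset \<Rightarrow> pos set" where
  "net_bb F = {Lock e 0 | G e. (G, Bot e {#}) \<in># F}"

definition carrier :: "(edge set \<times> edge link) multiset \<Rightarrow> pos set" where
  "carrier F = {Pos e m | e m. e \<in># fconcls F \<and> m \<in> atoms (ty e)} \<union> net_bb F"

abbreviation flat_behaviour :: "(edge set \<times> edge link) multiset \<Rightarrow> edge multiset \<Rightarrow> bool \<times> (pos \<times> pos) set" where
  "flat_behaviour F K \<equiv> behaviour (net_init K) (net_births F) (net_rules F) (net_fin K) (net_bb F)"

lemma net_rules_Un: "net_rules (F + F') = net_rules F \<union> net_rules F'"
  unfolding net_rules_def by auto

lemma net_births_Un: "net_births (F + F') = net_births F \<union> net_births F'"
  unfolding net_births_def by auto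

lemma net_bb_Un: "net_bb (F + F') = net_bb F \<union> net_bb F'"
  unfolding net_bb_def by auto

text \<open>Tokens go down on positive atoms and up on negative ones, so the polarity of the atom
  tells at which end of its edge the link lies that takes the token next. \<open>enters\<close> is
  the counterpart for the link that delivered it. As edges are linear, there is at most one link of
  each kind.\<close>

definition leaves :: "edge link \<Rightarrow> pos \<Rightarrow> bool" where
  "leaves l p \<longleftrightarrow> (\<exists>e m. p = Pos e m \<and>
     (m \<in> pos_atoms (ty e) \<and> e \<in># prems l \<or> m \<in> neg_atoms (ty e) \<and> e \<in># concls l))"

definition enters :: "edge link \<Rightarrow> pos \<Rightarrow> bool" where
  "enters l q \<longleftrightarrow> (\<exists>e m. q = Pos e m \<and>
     (m \<in> pos_atoms (ty e) \<and> e \<in># concls l \<or> m \<in> neg_atoms (ty e) \<and> e \<in># prems l)) \<or>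
     (\<exists>e C. q = Lock e 0 \<and> l = Bot e C)"

lemma arcs_cases:
  assumes "(e, e') \<in> set (arcs xs)"
  obtains "(e, e') \<in> set xs" "positive (ty e)" | "(e', e) \<in> set xs" "\<not> positive (ty e')"
  using assms unfolding arcs_def by (auto split: if_splits)

lemma arcs_ty:
  assumes "typed (Sync xs)" "(e, e') \<in> set (arcs xs)"
  shows "ty e' = ty e"
  using assms(2) by (rule arcs_cases) (use assms(1) in auto)

lemma mem_mset_map: "(p, c) \<in> set xs \<Longrightarrow> p \<in># mset (map fst xs)" "(p, c) \<in> set xs \<Longrightarrow> c \<in># mset (map snd xs)"
  by force+

text \<open>For a sync this uses that its formulas are hereditarily polarised: all atoms of the edge
  have the same sign, so the direction that \<open>arcs\<close> chooses for the edge is right at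
  every address.\<close>

lemma link_rule_ends:
  assumes "A \<in> link_rules l" "typed l" "(p, q) \<in> A"
  shows "leaves l p \<and> enters l q"
proof -
  consider "move l p q" | xs where "l = Sync xs" "A = sync_arcs xs"
    using assms unfolding link_rules_def by auto
  then show ?thesis
  proof cases
    case 1
    then show ?thesis using assms(2)
      by cases (auto simp: leaves_def enters_def)
  next
    case 2
    then obtain e e' m where e: "p = Pos e m" "q = Pos e' m" "(e, e') \<in> set (arcs xs)" "m \<in> atoms (ty e)"
      using assms(3) unfolding sync_arcs_def by auto
    have ty: "ty e' = ty e" using arcs_ty e(3) assms(2) 2(1) by blast
    from e(3) show ?thesis
    proof (cases rule: arcs_cases)
      case 1
      then have "m \<in> pos_atoms (ty e)" using positive_neg_atoms e(4) by auto
      then show ?thesis using 1 e ty 2(1) mem_mset_map[of e e' xs] unfolding leaves_def enters_def by auto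
    next
      case neg: 2
      then have "negative (ty e')" using assms(2) 2(1) ty by auto
      then have "m \<in> neg_atoms (ty e)" using negative_pos_atoms e(4) ty by auto
      then show ?thesis using neg e ty 2(1) mem_mset_map[of e' e xs] unfolding leaves_def enters_def by auto
    qed
  qed
qed

lemma count_le_one_distinct: "(\<forall>e. count (mset ys) e \<le> 1) \<Longrightarrow> distinct ys"
  by (induction ys) (auto, metis One_nat_def Suc_le_mono count_eq_zero_iff le_zero_eq set_mset_mset, metis Suc_leD)

lemma move_unique:
  assumes "move l p q" "move l p' q'" "typed l"
    and "\<forall>e. count (prems l) e \<le> 1" "\<forall>e. count (concls l) e \<le> 1"
    and "p = p' \<or> q = q'"
  shows "p = p' \<and> q = q'"
proof -
  have two: "a \<noteq> b" if "count {#a, b#} a \<le> 1" for a b :: edge using that by auto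
  show ?thesis
  proof (cases l)
    case (Ax a b)
    then have "a \<noteq> b" using assms(5) two by (metis concls.simps(1))
    then show ?thesis using assms Ax pos_neg_disjoint by (auto elim!: move.cases)
  next
    case (Cut a b)
    then have "a \<noteq> b" using assms(4) two by (metis prems.simps(1))
    then show ?thesis using assms Cut pos_neg_disjoint by (auto elim!: move.cases)
  next
    case (Tens a b c)
    then have "a \<noteq> b" using assms(4) two by (metis prems.simps(2))
    \<comment> \<open>The formula of \<open>c\<close> is strictly larger than those of
      \<open>a\<close> and \<open>b\<close>.\<close>
    moreover have "a \<noteq> c" "b \<noteq> c" using assms(3) Tens by auto
    ultimately show ?thesis using assms(1,2,3,6) Tens pos_neg_disjoint by (auto elim!: move.cases)
  next
    case (Par a b c)
    then have "a \<noteq> b" using assms(4) two by (metis prems.simps(3))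
    moreover have "a \<noteq> c" "b \<noteq> c" using assms(3) Par by auto
    ultimately show ?thesis using assms(1,2,3,6) Par pos_neg_disjoint by (auto elim!: move.cases)
  qed (use assms in \<open>auto elim!: move.cases\<close>)
qed

lemma arcs_unique:
  assumes "typed (Sync xs)" "distinct (map fst xs)" "distinct (map snd xs)"
    and "(e, e') \<in> set (arcs xs)" "(d, d') \<in> set (arcs xs)" "e = d \<or> e' = d'"
  shows "e = d \<and> e' = d'"
proof -
  have ty: "ty e' = ty e" "ty d' = ty d" using arcs_ty assms by blast+
  have fst_eq: "y = y'" if "(x, y) \<in> set xs" "(x, y') \<in> set xs" for x y y'
    using that assms(2) by (meson eq_key_imp_eq_value)
  have snd_eq: "x = x'" if "(x, y) \<in> set xs" "(x', y) \<in> set xs" for x x' y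
    using that assms(3) by (metis distinct_map inj_onD prod.inject snd_conv)
  from assms(4) show ?thesis
  proof (cases rule: arcs_cases)
    case 1
    from assms(5) show ?thesis
      by (cases rule: arcs_cases) (use 1 ty assms(6) fst_eq snd_eq in metis)+
  next
    case 2
    from assms(5) show ?thesis
      by (cases rule: arcs_cases) (use 2 ty assms(6) fst_eq snd_eq in metis)+
  qed
qed

lemma link_rules_unique:
  assumes "A \<in> link_rules l" "A' \<in> link_rules l" "typed l"
    and "\<forall>e. count (prems l) e \<le> 1" "\<forall>e. count (concls l) e \<le> 1"
    and "(p, q) \<in> A" "(p', q') \<in> A'" "p = p' \<or> q = q'"
  shows "p = p' \<and> q = q' \<and> A = A'"
proof (cases "\<exists>xs. l = Sync xs")
  case True
  then obtain xs where l: "l = Sync xs" by blast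
  then have A: "A = sync_arcs xs" "A' = sync_arcs xs"
    using assms(1,2) unfolding link_rules_def by (auto elim: move.cases)
  have "distinct (map fst xs)" "distinct (map snd xs)"
    using assms(4,5) l by (intro count_le_one_distinct; simp)+
  then show ?thesis using arcs_unique[of xs] assms(3,6-8) unfolding A l sync_arcs_def by blast
next
  case False
  then have "A = {(p, q)}" "move l p q" "A' = {(p', q')}" "move l p' q'"
    using assms(1,2,6,7) unfolding link_rules_def by auto
  then show ?thesis using move_unique[of l p q p' q'] assms(3-5,8) by simp
qed

lemma link_rules_nonempty:
  assumes "A \<in> link_rules l" "typed l"
  shows "A \<noteq> {}"
proof (cases "\<exists>xs. l = Sync xs")
  case True
  then obtain xs where l: "l = Sync xs" by blast
  then have A: "A = sync_arcs xs" using assms(1) unfolding link_rules_def by (auto elim: move.cases)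
  have "arcs xs \<noteq> []" using assms(2) l by (simp add: arcs_def)
  then obtain e e' where "(e, e') \<in> set (arcs xs)" by (metis list.set_intros(1) neq_Nil_conv surj_pair)
  moreover obtain m where "m \<in> atoms (ty e)" using atoms_nonempty[of "ty e"] by blast
  ultimately have "(Pos e m, Pos e' m) \<in> A" unfolding A sync_arcs_def by blast
  then show ?thesis by blast
qed (use assms(1) in \<open>auto simp: link_rules_def\<close>)

section \<open>Flat nets are token machines\<close>

locale flat_net_locale =
  fixes F :: "(edge set \<times> edge link) multiset" and K :: "edge multiset"
  assumes flat_net: "flat_net F K"
begin

lemma mem_typed: "(G, l) \<in># F \<Longrightarrow> typed l"
  using flat_net unfolding flat_net_def by blast

lemma mem_guard: "(G, l) \<in># F \<Longrightarrow> g \<in> G \<Longrightarrow> \<exists>G'. (G', Bot g {#}) \<in># F"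
  using flat_net unfolding flat_net_def by blast

lemma mem_Bot: "(G, Bot e C) \<in># F \<Longrightarrow> C = {#}"
  using flat_net unfolding flat_net_def by blast

lemma balance: "fprems F + K = fconcls F"
  using flat_net unfolding flat_net_def by blast

lemma count_concls: "count (fconcls F) e \<le> 1"
  using flat_net unfolding flat_net_def by blast

lemma count_prems: "count (fprems F) e + count K e \<le> 1"
  using count_concls[of e] balance by (metis count_union)

text \<open>Splitting \<open>F\<close> separates two occurrences even when they are equal, which
  membership in \<open>F\<close> cannot do.\<close>

lemma prem_unique:
  assumes "F = F1 + F2" "x \<in># F1" "y \<in># F2" "e \<in># prems (snd x)"
  shows "e \<notin># prems (snd y)"
proof
  assume "e \<in># prems (snd y)"
  then have "e \<in># fprems F1" "e \<in># fprems F2"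
    using prems_le_fprems[OF assms(2)] prems_le_fprems[OF assms(3)] assms(4) by (auto dest: mset_subset_eqD)
  then have "count (fprems F1) e \<ge> 1" "count (fprems F2) e \<ge> 1" by auto
  then show False using count_prems[of e] unfolding assms(1) fprems_simps count_union by linarith
qed

lemma concl_unique:
  assumes "F = F1 + F2" "x \<in># F1" "y \<in># F2" "e \<in># concls (snd x)"
  shows "e \<notin># concls (snd y)"
proof
  assume "e \<in># concls (snd y)"
  then have "e \<in># fconcls F1" "e \<in># fconcls F2"
    using concls_le_fconcls[OF assms(2)] concls_le_fconcls[OF assms(3)] assms(4) by (auto dest: mset_subset_eqD)
  then have "count (fconcls F1) e \<ge> 1" "count (fconcls F2) e \<ge> 1" by auto
  then show False using count_concls[of e] unfolding assms(1) fconcls_simps count_union by linarith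
qed

lemma leaves_unique:
  assumes "F = F1 + F2" "(G, l) \<in># F1" "(G', l') \<in># F2" "leaves l p"
  shows "\<not> leaves l' p"
  using prem_unique[OF assms(1-3)] concl_unique[OF assms(1-3)] assms(4) pos_neg_disjoint
  unfolding leaves_def by auto

lemma enters_unique:
  assumes "F = F1 + F2" "(G, l) \<in># F1" "(G', l') \<in># F2" "enters l p"
  shows "\<not> enters l' p"
proof -
  have "e \<in># prems l \<Longrightarrow> e \<notin># prems l'" "e \<in># concls l \<Longrightarrow> e \<notin># concls l'" for e
    using prem_unique[OF assms(1-3)] concl_unique[OF assms(1-3)] by auto
  moreover have "e \<in># concls (Bot e C)" for e :: edge and C by simp
  ultimately show ?thesis using assms(4) pos_neg_disjoint unfolding enters_def
    by (metis pos.distinct(1) pos.inject)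
qed

lemma two_occurrences:
  assumes "x \<in># F" "y \<in># F" "x \<noteq> y"
  obtains F1 F2 where "F = F1 + F2" "x \<in># F1" "y \<in># F2"
proof -
  have "F = {#x#} + (F - {#x#})" using assms(1) by simp
  moreover have "y \<in># F - {#x#}" using assms by (metis in_diff_count insert_noteq_member insert_DiffM)
  ultimately show ?thesis using that by (metis union_single_eq_member add_mset_add_single empty_neutral(1))
qed

lemma leaves_same: "(G, l) \<in># F \<Longrightarrow> (G', l') \<in># F \<Longrightarrow> leaves l p \<Longrightarrow> leaves l' p \<Longrightarrow> (G, l) = (G', l')"
  using leaves_unique two_occurrences by metis

lemma enters_same: "(G, l) \<in># F \<Longrightarrow> (G', l') \<in># F \<Longrightarrow> enters l p \<Longrightarrow> enters l' p \<Longrightarrow> (G, l) = (G', l')"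
  using enters_unique two_occurrences by metis

lemma mem_count_prems: "(G, l) \<in># F \<Longrightarrow> count (prems l) e \<le> 1"
  using mset_subset_eq_count[OF prems_le_fprems[of "(G, l)" F], of e] count_prems[of e] by simp

lemma mem_count_concls: "(G, l) \<in># F \<Longrightarrow> count (concls l) e \<le> 1"
  using mset_subset_eq_count[OF concls_le_fconcls[of "(G, l)" F], of e] count_concls[of e] by simp

lemma rule_ends:
  assumes "(p, q) \<in> moves (net_rules F)"
  obtains G l where "(G, l) \<in># F" "leaves l p" "enters l q"
proof -
  obtain Gp A where "(Gp, A) \<in> net_rules F" "(p, q) \<in> A" using assms by (rule movesE)
  then obtain G l where "(G, l) \<in># F" "A \<in> link_rules l" unfolding net_rules_def by auto
  then show ?thesis using that link_rule_ends[of A l p q] mem_typed \<open>(p, q) \<in> A\<close> by blast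
qed

lemma leaves_carrier: "(G, l) \<in># F \<Longrightarrow> leaves l p \<Longrightarrow> p \<in> carrier F"
proof -
  assume a: "(G, l) \<in># F" "leaves l p"
  have "e \<in># fconcls F" if "e \<in># prems l" for e
    using that prems_le_fprems[OF a(1)] balance by (metis mset_subset_eqD snd_conv union_iff)
  moreover have "e \<in># fconcls F" if "e \<in># concls l" for e
    using that concls_le_fconcls[OF a(1)] by (metis mset_subset_eqD snd_conv)
  ultimately show ?thesis using a(2) unfolding leaves_def carrier_def by blast
qed

lemma enters_carrier: "(G, l) \<in># F \<Longrightarrow> enters l p \<Longrightarrow> p \<in> carrier F"
proof -
  assume a: "(G, l) \<in># F" "enters l p"
  have "e \<in># fconcls F" if "e \<in># prems l" for e
    using that prems_le_fprems[OF a(1)] balance by (metis mset_subset_eqD snd_conv union_iff)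
  moreover have "e \<in># fconcls F" if "e \<in># concls l" for e
    using that concls_le_fconcls[OF a(1)] by (metis mset_subset_eqD snd_conv)
  moreover have "Lock e 0 \<in> net_bb F" if "l = Bot e C" for e C
    using a(1) that mem_Bot[of G e C] unfolding net_bb_def by blast
  ultimately show ?thesis using a(2) unfolding enters_def carrier_def by blast
qed

lemma moves_carrier: "moves (net_rules F) \<subseteq> carrier F \<times> carrier F"
proof (clarify)
  fix p q assume "(p, q) \<in> moves (net_rules F)"
  then obtain G l where "(G, l) \<in># F" "leaves l p" "enters l q" by (rule rule_ends)
  then show "p \<in> carrier F \<and> q \<in> carrier F" using leaves_carrier enters_carrier by blast
qed

lemma guard_carrier: "(G, l) \<in># F \<Longrightarrow> guard G \<subseteq> carrier F"
  using mem_guard unfolding guard_def carrier_def net_bb_def by blast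

lemma birth_carrier:
  assumes "(Gp, p) \<in> net_births F"
  shows "Gp \<subseteq> carrier F \<and> p \<in> carrier F"
proof -
  obtain G e where G: "Gp = guard G" "p = Pos e []" "(G, One e) \<in># F" using assms unfolding net_births_def by auto
  have "[] \<in> pos_atoms (ty e)" using mem_typed[OF G(3)] by simp
  then have "enters (One e) p" unfolding enters_def G by auto
  then show ?thesis using guard_carrier G enters_carrier by blast
qed

lemma conclusion_carrier: "net_init K \<subseteq> carrier F" "net_fin K \<subseteq> carrier F"
proof -
  have "e \<in># fconcls F" if "e \<in># K" for e using that balance by (metis union_iff)
  then show "net_init K \<subseteq> carrier F" "net_fin K \<subseteq> carrier F"
    unfolding net_init_def net_fin_def carrier_def by blast+
qed

lemma finite_carrier: "finite (carrier F)"
proof -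
  have "e \<in># fconcls F" if "(G, Bot e {#}) \<in># F" for G e
    using concls_le_fconcls[OF that] by (auto dest: mset_subset_eqD)
  then have "net_bb F \<subseteq> (\<lambda>e. Lock e 0) ` set_mset (fconcls F)"
    unfolding net_bb_def by auto
  then have "finite (net_bb F)" by (rule finite_subset) simp
  moreover have "{Pos e m | e m. e \<in># fconcls F \<and> m \<in> atoms (ty e)} = (\<Union>e \<in> set_mset (fconcls F). Pos e ` atoms (ty e))"
    by auto
  ultimately show ?thesis unfolding carrier_def by (simp add: finite_atoms)
qed

lemma not_prem_conclusion: "e \<in># K \<Longrightarrow> (G, l) \<in># F \<Longrightarrow> e \<notin># prems l"
proof
  assume a: "e \<in># K" "(G, l) \<in># F" "e \<in># prems l"
  then have "e \<in># fprems F" using prems_le_fprems[OF a(2)] by (metis mset_subset_eqD snd_conv)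
  then have "count (fprems F) e \<ge> 1" "count K e \<ge> 1" using a(1) by auto
  then show False using count_prems[of e] by linarith
qed

lemma fin_no_move:
  assumes "p \<in> net_fin K"
  shows "(p, q) \<notin> moves (net_rules F)"
proof
  assume "(p, q) \<in> moves (net_rules F)"
  then obtain G l where l: "(G, l) \<in># F" "leaves l p" by (rule rule_ends)
  obtain e m where "p = Pos e m" "e \<in># K" "m \<in> pos_atoms (ty e)" using assms unfolding net_fin_def by auto
  then show False using l(2) not_prem_conclusion[OF _ l(1), of e] pos_neg_disjoint unfolding leaves_def by auto
qed

lemma lock_no_move: "(Lock e i, q) \<notin> moves (net_rules F)"
proof
  assume "(Lock e i, q) \<in> moves (net_rules F)"
  then obtain G l where "leaves l (Lock e i)" by (rule rule_ends)
  then show False by (simp add: leaves_def)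
qed

lemma bb_no_move: "p \<in> net_bb F \<Longrightarrow> (p, q) \<notin> moves (net_rules F)"
  using lock_no_move unfolding net_bb_def by blast

lemma no_move_to_init:
  assumes "(p, q) \<in> moves (net_rules F)"
  shows "q \<notin> net_init K"
proof
  assume q: "q \<in> net_init K"
  from assms obtain G l where l: "(G, l) \<in># F" "leaves l p" "enters l q" by (rule rule_ends)
  obtain e m where "q = Pos e m" "e \<in># K" "m \<in> neg_atoms (ty e)" using q unfolding net_init_def by auto
  then show False using l(3) not_prem_conclusion[OF _ l(1), of e] pos_neg_disjoint unfolding enters_def by auto
qed

text \<open>The position is entered only through the link that concludes its edge. That is the one
  link, which has no rules.\<close>

lemma no_move_to_birth:
  assumes "(p, q) \<in> moves (net_rules F)"
  shows "q \<notin> snd ` net_births F"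
proof
  assume "q \<in> snd ` net_births F"
  then obtain G e where G: "q = Pos e []" "(G, One e) \<in># F" unfolding net_births_def by auto
  have "enters (One e) q" using mem_typed[OF G(2)] unfolding enters_def G by auto
  moreover obtain G' l where l: "(G', l) \<in># F" "leaves l p" "enters l q" using assms by (rule rule_ends)
  ultimately have "l = One e" using enters_same[OF G(2)] by blast
  obtain Gp A where A: "(Gp, A) \<in> net_rules F" "(p, q) \<in> A" using assms by (rule movesE)
  then obtain G'' l' where l': "(G'', l') \<in># F" "A \<in> link_rules l'" unfolding net_rules_def by auto
  then have "enters l' q" using link_rule_ends[of A l' p q] mem_typed A(2) by blast
  then have "l' = One e" using enters_same[OF G(2) l'(1) \<open>enters (One e) q\<close>] by blast
  then show False using l'(2) unfolding link_rules_def by (auto elim: move.cases)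
qed

lemma rule_unique:
  assumes "(Gp, A) \<in> net_rules F" "(Gp', A') \<in> net_rules F" "(p, q) \<in> A" "(p', q') \<in> A'" "p = p' \<or> q = q'"
  shows "p = p' \<and> q = q' \<and> Gp = Gp' \<and> A = A'"
proof -
  obtain G l where l: "(G, l) \<in># F" "A \<in> link_rules l" "Gp = guard G" using assms(1) unfolding net_rules_def by auto
  obtain G' l' where l': "(G', l') \<in># F" "A' \<in> link_rules l'" "Gp' = guard G'" using assms(2) unfolding net_rules_def by auto
  have "leaves l p" "enters l q" "leaves l' p'" "enters l' q'"
    using link_rule_ends l l' mem_typed assms(3,4) by blast+
  then have eq: "(G, l) = (G', l')" using leaves_same[OF l(1) l'(1)] enters_same[OF l(1) l'(1)] assms(5) by blast
  then have "p = p' \<and> q = q' \<and> A = A'"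
    using link_rules_unique[of A l A' p q p' q'] l l' assms(3-5) mem_typed mem_count_prems mem_count_concls by auto
  then show ?thesis using eq l l' by simp
qed

text \<open>Rules form a set, so two parts of the net might share one. Its arcs are nonempty, and
  the source of an arc would then be left through two links.\<close>

lemma rule_disjoint:
  assumes "F = F1 + F2"
  shows "net_rules F1 \<inter> net_rules F2 = {}"
proof (rule ccontr)
  assume "net_rules F1 \<inter> net_rules F2 \<noteq> {}"
  then obtain Gp A where A: "(Gp, A) \<in> net_rules F1" "(Gp, A) \<in> net_rules F2" by auto
  obtain G l where l: "(G, l) \<in># F1" "A \<in> link_rules l" using A(1) unfolding net_rules_def by auto
  obtain G' l' where l': "(G', l') \<in># F2" "A \<in> link_rules l'" using A(2) unfolding net_rules_def by auto
  have ty: "typed l" "typed l'" using l l' mem_typed assms by (metis union_iff)+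
  then obtain p q where "(p, q) \<in> A" using link_rules_nonempty l(2) by fastforce
  then show False using leaves_unique[OF assms l(1) l'(1)] link_rule_ends l(2) l'(2) ty by blast
qed

sublocale token_machine "net_init K" "net_births F" "net_rules F"
proof
  show "finite (net_init K)" using conclusion_carrier finite_carrier finite_subset by blast
  have "snd ` net_births F \<subseteq> carrier F" using birth_carrier by auto
  then show "finite (snd ` net_births F)" using finite_carrier finite_subset by blast
  show "finite (moves (net_rules F))" using moves_carrier finite_carrier finite_subset by blast
next
  fix p q assume "(p, q) \<in> moves (net_rules F)"
  then show "q \<notin> net_init K \<union> snd ` net_births F" using no_move_to_init no_move_to_birth by blast
next
  fix G A assume "(G, A) \<in> net_rules F"
  then show "A \<noteq> {}" using link_rules_nonempty mem_typed unfolding net_rules_def by blast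
next
  fix G A g q assume "(G, A) \<in> net_rules F" "g \<in> G"
  then show "(g, q) \<notin> moves (net_rules F)" using lock_no_move unfolding net_rules_def guard_def by auto
next
  fix G p g q assume "(G, p) \<in> net_births F" "g \<in> G"
  then show "(g, q) \<notin> moves (net_rules F)" using lock_no_move unfolding net_births_def guard_def by auto
qed (fact rule_unique)

end

section \<open>The interpretation is determined by the behaviour\<close>

definition strip :: "'e link \<Rightarrow> 'e link" where
  "strip l = (case l of Bot e C \<Rightarrow> Bot e {#} | _ \<Rightarrow> l)"

lemma strip_simps [simp]:
  "strip (Ax a b) = Ax a b" "strip (Cut a b) = Cut a b" "strip (Tens a b c) = Tens a b c"
  "strip (Par a b c) = Par a b c" "strip (One a) = One a" "strip (Bot a C) = Bot a {#}"
  "strip (Sync xs) = Sync xs"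
  by (simp_all add: strip_def)

lemma strip_in_flat: "({}, strip l) \<in># flat l"
  by (cases l) auto

lemma strip_Sync: "strip l = Sync xs \<longleftrightarrow> l = Sync xs" and strip_One: "strip l = One e \<longleftrightarrow> l = One e"
  by (cases l; simp)+

lemma strip_Bot: "strip l = Bot e {#} \<longleftrightarrow> (\<exists>C. l = Bot e C)"
  by (cases l) auto

lemma move_strip: "move (strip l) p q \<longleftrightarrow> move l p q"
proof (cases l)
  case (Bot e C)
  then show ?thesis by (auto elim!: move.cases intro: move.intros)
qed auto

text \<open>Stated for all of \<open>flat l\<close>, not for \<open>l\<close> alone, so that the
  induction can step from a bot link into its box.\<close>

lemma active_in_flat:
  assumes "active R T l"
  shows "\<exists>G. guard G \<subseteq> ran T \<and> (\<forall>(G', l') \<in># flat l. (G \<union> G', l') \<in># flatten R)"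
  using assms
proof induction
  case (1 l)
  then have "\<forall>(G', l') \<in># flat l. ({} \<union> G', l') \<in># flatten R" by (auto simp: mem_flatten)
  moreover have "guard {} \<subseteq> ran T" by (simp add: guard_def)
  ultimately show ?case by blast
next
  case (2 e C l)
  then obtain G where G: "guard G \<subseteq> ran T" "\<forall>(G', l') \<in># flat (Bot e C). (G \<union> G', l') \<in># flatten R" by blast
  have "guard (insert e G) \<subseteq> ran T" using G(1) 2 by (simp add: guard_def)
  moreover have "(insert e G \<union> G', l') \<in># flatten R" if "(G', l') \<in># flat l" for G' l'
  proof -
    have "(G', l') \<in># flatten C" using that 2 by (auto simp: mem_flatten)
    then have "(insert e G', l') \<in># flat (Bot e C)" by (force simp: flat_Bot simp del: flat.simps)
    then show ?thesis using G(2) by fastforce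
  qed
  ultimately show ?case by blast
qed

lemma active_flat:
  assumes "active R T l"
  obtains G where "guard G \<subseteq> ran T" "(G, strip l) \<in># flatten R"
  using active_in_flat[OF assms] strip_in_flat[of l] by fastforce

lemma flat_active_link:
  "(G, l') \<in># flat l \<Longrightarrow> active R T l \<Longrightarrow> guard G \<subseteq> ran T \<Longrightarrow> \<exists>l''. strip l'' = l' \<and> active R T l''"
proof (induction l arbitrary: G l')
  case (Bot e C)
  from Bot.prems(1) consider "l' = Bot e {#}" | y G' where "y \<in># C" "(G', l') \<in># flat y" "G = insert e G'"
    by (auto simp: split_beta)
  then show ?case
  proof cases
    case 1
    then show ?thesis using Bot.prems(2) by (metis strip_simps(6))
  next
    case 2
    then have "Lock e 0 \<in> ran T" "guard G' \<subseteq> ran T" using Bot.prems(3) by (auto simp: guard_def)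
    then show ?thesis using Bot.IH[OF 2(1,2)] active.intros(2)[OF Bot.prems(2) _ 2(1)] by blast
  qed
next
  case (Ax a b) then show ?case by (metis Pair_inject flat.simps(1) multi_member_this strip_simps(1) set_mset_single singletonD)
next
  case (Cut a b) then show ?case by (metis Pair_inject flat.simps(2) multi_member_this strip_simps(2) set_mset_single singletonD)
next
  case (Tens a b c) then show ?case by (metis Pair_inject flat.simps(3) multi_member_this strip_simps(3) set_mset_single singletonD)
next
  case (Par a b c) then show ?case by (metis Pair_inject flat.simps(4) multi_member_this strip_simps(4) set_mset_single singletonD)
next
  case (One a) then show ?case by (metis Pair_inject flat.simps(5) multi_member_this strip_simps(5) set_mset_single singletonD)
next
  case (Sync xs) then show ?case by (metis Pair_inject flat.simps(7) multi_member_this strip_simps(7) set_mset_single singletonD)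
qed

lemma flat_active:
  assumes "(G, l') \<in># flatten R" "guard G \<subseteq> ran T"
  obtains l where "strip l = l'" "active R T l"
proof -
  obtain x where "x \<in># R" "(G, l') \<in># flat x" using assms(1) by (auto simp: mem_flatten)
  then show ?thesis using flat_active_link[of G l' x R T] active.intros(1) assms(2) that by blast
qed

lemma active_level: "active R T l \<Longrightarrow> \<exists>L \<in> levels R. l \<in># L"
  by (induction rule: active.induct) (auto intro: levels.intros)

lemma flatten_level:
  fixes R :: net
  assumes "(G, l') \<in># flatten R"
  shows "\<exists>l. strip l = l' \<and> (\<exists>L \<in> levels R. l \<in># L)"
proof -
  \<comment> \<open>The state \<open>Some\<close> occupies every position, in particular every lock,
    so all links at all depths are active in it.\<close>
  have "ran Some = (UNIV :: pos set)" by (auto simp: ran_def)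
  then obtain l where "strip l = l'" "active R Some l" using flat_active[OF assms, of Some] by auto
  then show ?thesis using active_level by blast
qed

text \<open>The interpretation depends on the net only through its \<open>behaviour\<close>;
  comparing behaviours is therefore enough.\<close>

definition result_of :: "bool \<times> (pos \<times> pos) set \<Rightarrow> result" where
  "result_of b = (if fst b then Result (\<lambda>t. if \<exists>p. (t, p) \<in> snd b then Some (THE p. (t, p) \<in> snd b) else None)
     else Deadlock)"

lemma map_eq_relation:
  assumes S: "\<And>t p. T t = Some p \<longleftrightarrow> (t, p) \<in> S"
  shows "T = (\<lambda>t. if \<exists>p. (t, p) \<in> S then Some (THE p. (t, p) \<in> S) else None)"
proof
  fix t
  show "T t = (if \<exists>p. (t, p) \<in> S then Some (THE p. (t, p) \<in> S) else None)"
  proof (cases "T t")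
    case (Some p)
    then have p: "(t, p) \<in> S" using S by simp
    moreover have "p' = p" if "(t, p') \<in> S" for p' using S[of t p'] that Some by simp
    ultimately have "(THE p. (t, p) \<in> S) = p" by (rule the_equality)
    then show ?thesis using Some p by auto
  qed (auto simp: S[symmetric])
qed

section \<open>Runs of a net as runs of its flattening\<close>

locale wf_net_locale =
  fixes R :: net
  assumes wf_net: "wf_net R"
begin

sublocale flat_net_locale "flatten R" "net_concls R"
  by unfold_locales (rule flat_net_flatten[OF wf_net])

abbreviation "births \<equiv> net_births (flatten R)"
abbreviation "rules \<equiv> net_rules (flatten R)"

lemma INIT_eq: "INIT R = net_init (net_concls R)" and FIN_eq: "FIN R = net_fin (net_concls R)"
  by (simp_all add: INIT_def net_init_def FIN_def net_fin_def)

lemma rch_carrier: "rch \<subseteq> carrier (flatten R)"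
proof
  fix p assume "p \<in> rch"
  then have "p \<in> sources \<union> Range mv" using rch_subset by blast
  then show "p \<in> carrier (flatten R)" using conclusion_carrier birth_carrier moves_carrier by auto
qed

lemma valid_carrier: "valid T \<Longrightarrow> T t = Some p \<Longrightarrow> p \<in> carrier (flatten R)"
  using ran_visited valid_visited rch_carrier by (metis ranI subsetD)

text \<open>No other token is at \<open>p\<close>, so advancing all tokens at \<open>p\<close> moves
  just the one of \<open>t\<close>.\<close>

lemma update_eq_advance:
  assumes "valid T" "T t = Some p"
  shows "T(t \<mapsto> q) = (\<lambda>s. map_option (advance {(p, q)}) (T s))"
proof
  fix s
  show "(T(t \<mapsto> q)) s = map_option (advance {(p, q)}) (T s)"
  proof (cases "s = t")
    case True
    then show ?thesis using assms(2) by (simp add: advance_def)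
  next
    case False
    then have "T s \<noteq> Some p" using valid_inj[OF assms(1) _ assms(2)] by blast
    then show ?thesis using False by (cases "T s") (auto simp: advance_def)
  qed
qed

text \<open>\<open>cross\<close> acts on every address of an in-edge, \<open>sync_arcs\<close> only
  on atom occurrences. They agree because the tokens of a valid state lie in the carrier.\<close>

lemma cross_eq_advance:
  assumes "valid T" "(G, Sync xs) \<in># flatten R"
  shows "(\<lambda>t. map_option (cross xs) (T t)) = (\<lambda>t. map_option (advance (sync_arcs xs)) (T t))"
proof
  fix t
  have rule: "(guard G, sync_arcs xs) \<in> rules"
    using assms(2) unfolding net_rules_def link_rules_def by blast
  have "cross xs p = advance (sync_arcs xs) p" if "T t = Some p" for p
  proof (cases p)
    case (Pos e m)
    have m: "m \<in> atoms (ty e)"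
      using valid_carrier[OF assms(1) that] unfolding Pos carrier_def net_bb_def by auto
    show ?thesis
    proof (cases "map_of (arcs xs) e")
      case None
      then have "e \<notin> fst ` set (arcs xs)" by (simp add: map_of_eq_None_iff)
      then have "(p, q) \<notin> sync_arcs xs" for q unfolding Pos sync_arcs_def by force
      then show ?thesis using advance_other[where p = p and A = "sync_arcs xs"] None unfolding Pos by simp
    next
      case (Some e')
      then have "(e, e') \<in> set (arcs xs)" by (rule map_of_SomeD)
      then have "(Pos e m, Pos e' m) \<in> sync_arcs xs" using m unfolding sync_arcs_def by blast
      then show ?thesis using advance_eq[OF rule] Some unfolding Pos by simp
    qed
  next
    case (Lock e i)
    then have "(p, q) \<notin> sync_arcs xs" for q unfolding sync_arcs_def by auto
    then show ?thesis using advance_other[where p = p and A = "sync_arcs xs"] Lock by simp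
  qed
  then show "map_option (cross xs) (T t) = map_option (advance (sync_arcs xs)) (T t)" by (cases "T t") auto
qed

lemma in_pos_eq: "in_pos xs = fst ` sync_arcs xs"
  unfolding in_pos_def in_edges_def sync_arcs_def by force

lemma step_mstep:
  assumes "step R T T'" "valid T"
  shows "mstep births rules T T'"
  using assms(1)
proof cases
  case (step_move l p q t)
  obtain G where G: "guard G \<subseteq> ran T" "(G, strip l) \<in># flatten R" using step_move(2) by (rule active_flat)
  have "{(p, q)} \<in> link_rules (strip l)" using step_move(3) unfolding link_rules_def move_strip by blast
  then have "(guard G, {(p, q)}) \<in> rules" using G(2) unfolding net_rules_def by blast
  moreover have "fst ` {(p, q)} \<subseteq> ran T" using step_move(4) by (auto intro: ranI)
  ultimately show ?thesis
    unfolding step_move(1) update_eq_advance[OF assms(2) step_move(4)] using G(1) by (intro mstep_rule)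
next
  case (step_sync xs)
  obtain G where G: "guard G \<subseteq> ran T" "(G, strip (Sync xs)) \<in># flatten R" using step_sync(2) by (rule active_flat)
  then have GS: "(G, Sync xs) \<in># flatten R" by simp
  then have "(guard G, sync_arcs xs) \<in> rules" unfolding net_rules_def link_rules_def by blast
  then show ?thesis
    unfolding step_sync(1) cross_eq_advance[OF assms(2) GS] using G(1) step_sync(3)
    by (intro mstep_rule) (auto simp: in_pos_eq)
next
  case (step_one e)
  obtain G where G: "guard G \<subseteq> ran T" "(G, strip (One e)) \<in># flatten R" using step_one(2) by (rule active_flat)
  then have "(guard G, Pos e []) \<in> births" unfolding net_births_def strip_simps by blast
  then show ?thesis unfolding step_one(1) using G(1) step_one(3) by (intro mstep_birth)
qed

lemma mstep_step:
  assumes "mstep births rules T T'" "valid T"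
  shows "step R T T'"
  using assms(1)
proof cases
  case (mstep_rule Gp A)
  then obtain G l' where G: "(G, l') \<in># flatten R" "A \<in> link_rules l'" "Gp = guard G"
    unfolding net_rules_def by auto
  obtain l where l: "strip l = l'" "active R T l" using G(1) mstep_rule(3) unfolding G(3) by (rule flat_active)
  from G(2) consider p q where "A = {(p, q)}" "move l' p q" | xs where "l' = Sync xs" "A = sync_arcs xs"
    unfolding link_rules_def by auto
  then show ?thesis
  proof cases
    case 1
    then have "p \<in> ran T" using mstep_rule(4) by simp
    then obtain t where t: "T t = Some p" by (auto simp: ran_def)
    have "move l p q" using 1(2) l(1) move_strip by blast
    then have "step R T (T(t \<mapsto> q))" using l(2) t by (intro step_move)
    then show ?thesis unfolding mstep_rule(1) 1(1) update_eq_advance[OF assms(2) t] .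
  next
    case 2
    then have "l = Sync xs" using l(1) strip_Sync by blast
    then have xs: "active R T (Sync xs)" "(G, Sync xs) \<in># flatten R" using l(2) G(1) 2 by auto
    show ?thesis unfolding mstep_rule(1) 2(2) cross_eq_advance[OF assms(2) xs(2), symmetric]
      using xs(1) mstep_rule(4) 2(2) by (intro step_sync) (simp_all add: in_pos_eq)
  qed
next
  case (mstep_birth Gp p)
  then obtain G e where G: "(G, One e) \<in># flatten R" "p = Pos e []" "Gp = guard G"
    unfolding net_births_def by auto
  obtain l where l: "strip l = One e" "active R T l" using G(1) mstep_birth(3) unfolding G(3) by (rule flat_active)
  then have "active R T (One e)" by (simp add: strip_One)
  then show ?thesis using mstep_birth(4) unfolding mstep_birth(1) G(2) by (intro step_one)
qed

lemma initial_eq: "initial R = start"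
  by (rule ext) (simp add: initial_def start_def INIT_eq)

lemma steps_iff: "(step R)\<^sup>*\<^sup>* (initial R) T \<longleftrightarrow> (mstep births rules)\<^sup>*\<^sup>* start T"
proof
  assume "(step R)\<^sup>*\<^sup>* (initial R) T"
  then show "(mstep births rules)\<^sup>*\<^sup>* start T"
  proof (induction rule: rtranclp_induct)
    case (step T T')
    then show ?case using step_mstep[OF step.hyps(2) valid_steps[OF step.IH]] by simp
  qed (simp add: initial_eq)
next
  assume "(mstep births rules)\<^sup>*\<^sup>* start T"
  then show "(step R)\<^sup>*\<^sup>* (initial R) T"
  proof (induction rule: rtranclp_induct)
    case (step T T')
    then show ?case using mstep_step[OF step.hyps(2) valid_steps[OF step.hyps(1)]] by simp
  qed (simp add: initial_eq)
qed

lemma normal_state_iff: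
  "normal_state_of R T \<longleftrightarrow> (mstep births rules)\<^sup>*\<^sup>* start T \<and> (\<nexists>T'. mstep births rules T T')"
  unfolding normal_state_of_def steps_iff using step_mstep mstep_step valid_steps by blast

lemma normal_state_unique:
  assumes "normal_state_of R T" "normal_state_of R T'"
  shows "T = T'"
proof
  fix t
  have "T t = Some p \<longleftrightarrow> T' t = Some p" for p
    using assms normal_iff valid_steps unfolding normal_state_iff by metis
  then show "T t = T' t" by (metis not_None_eq)
qed

lemma net_bb_BOTBOX: "net_bb (flatten R) \<subseteq> BOTBOX R"
proof
  fix p assume "p \<in> net_bb (flatten R)"
  then obtain G e where e: "p = Lock e 0" "(G, Bot e {#}) \<in># flatten R" unfolding net_bb_def by blast
  then obtain l L where "strip l = Bot e {#}" "L \<in> levels R" "l \<in># L" using flatten_level[OF e(2)] by blast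
  then have "e \<in> locks R" unfolding locks_def strip_Bot by blast
  then show "p \<in> BOTBOX R" unfolding BOTBOX_def e by blast
qed

lemma carrier_BOTBOX: "p \<in> carrier (flatten R) \<Longrightarrow> p \<in> BOTBOX R \<Longrightarrow> p \<in> net_bb (flatten R)"
  unfolding carrier_def BOTBOX_def by auto

lemma carrier_POS: "carrier (flatten R) \<subseteq> POS R"
  using net_bb_BOTBOX unfolding carrier_def POS_def BOTBOX_def edges_flatten by blast

lemma births_ONES: "snd ` births \<subseteq> ONES R"
proof
  fix p assume "p \<in> snd ` births"
  then obtain G e where e: "p = Pos e []" "(G, One e) \<in># flatten R" unfolding net_births_def by auto
  then obtain l L where "strip l = One e" "L \<in> levels R" "l \<in># L" using flatten_level[OF e(2)] by blast
  then show "p \<in> ONES R" unfolding ONES_def strip_One e by blast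
qed

theorem interp_behaviour: "interp R = result_of (flat_behaviour (flatten R) (net_concls R))"
proof -
  obtain T where T: "(mstep births rules)\<^sup>*\<^sup>* start T" "\<nexists>T'. mstep births rules T T'"
    using normal_exists by blast
  then have "normal_state_of R T" unfolding normal_state_iff by blast
  then have the: "(THE T. normal_state_of R T) = T" using normal_state_unique by (intro the_equality)
  have valid: "valid T" using T(1) by (rule valid_steps)
  note T_iff = normal_iff[OF valid T(2)] and ran_T = normal_ran[OF valid T(2)]
  have ran_carrier: "ran T \<subseteq> carrier (flatten R)"
    using ran_T rch_carrier unfolding terminal_def by blast
  have dom: "dom T = INIT R \<union> (dom T - INIT R)" "dom T - INIT R \<subseteq> ONES R"
  proof -
    have "INIT R \<subseteq> dom T" "dom T \<subseteq> INIT R \<union> snd ` births"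
      using valid unfolding valid_def INIT_eq by simp_all
    then show "dom T = INIT R \<union> (dom T - INIT R)" "dom T - INIT R \<subseteq> ONES R"
      using births_ONES by blast+
  qed
  have state: "is_state R T"
    unfolding is_state_def using dom ran_carrier carrier_POS by blast
  let ?g = "good (net_init (net_concls R)) births rules (net_fin (net_concls R)) (net_bb (flatten R))"
  have fin_terminal: "p \<in> FIN R \<Longrightarrow> p \<in> rch \<Longrightarrow> terminal p" for p
    unfolding terminal_def FIN_eq using fin_no_move by blast
  \<comment> \<open>The witness for the existential in \<open>final\<close> can always be taken to
    be the set of occupied locks.\<close>
  have "final R T \<longleftrightarrow> FIN R \<subseteq> ran T \<and> ran T \<subseteq> FIN R \<union> BOTBOX R"
  proof
    assume "FIN R \<subseteq> ran T \<and> ran T \<subseteq> FIN R \<union> BOTBOX R"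
    then have "ran T = FIN R \<union> (ran T \<inter> BOTBOX R)" by blast
    then show "final R T" unfolding final_def
      using state by (intro conjI exI[of _ "ran T \<inter> BOTBOX R"]) simp_all
  qed (auto simp: final_def)
  also have "\<dots> \<longleftrightarrow> ?g"
  proof
    assume a: "FIN R \<subseteq> ran T \<and> ran T \<subseteq> FIN R \<union> BOTBOX R"
    show ?g unfolding good_def
    proof (intro conjI ballI)
      show "net_fin (net_concls R) \<subseteq> rch" using a ran_T unfolding FIN_eq terminal_def by blast
      fix p assume p: "p \<in> rch"
      show "p \<in> net_fin (net_concls R) \<union> net_bb (flatten R) \<or> (\<exists>q\<in>rch. (p, q) \<in> mv)"
      proof (rule ccontr)
        assume n: "\<not> ?thesis"
        then have "p \<in> ran T" using p ran_T unfolding terminal_def by blast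
        then show False using n a carrier_BOTBOX ran_carrier unfolding FIN_eq by blast
      qed
    qed
  next
    assume g: ?g
    have "FIN R \<subseteq> ran T" using g fin_terminal ran_T unfolding good_def FIN_eq by blast
    moreover have "ran T \<subseteq> FIN R \<union> BOTBOX R"
      using g ran_T net_bb_BOTBOX unfolding good_def FIN_eq terminal_def by blast
    ultimately show "FIN R \<subseteq> ran T \<and> ran T \<subseteq> FIN R \<union> BOTBOX R" ..
  qed
  finally have final_good: "final R T \<longleftrightarrow> ?g" .
  show ?thesis
  proof (cases ?g)
    case False
    then show ?thesis using final_good unfolding interp_def the Let_def result_of_def behaviour_def by simp
  next
    case True
    let ?S = "{(t, p). t \<in> net_init (net_concls R) \<and> p \<in> net_fin (net_concls R) \<and> (t, p) \<in> mv\<^sup>*}"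
    let ?T = "T |` {p \<in> INIT R. T p \<notin> Some ` BOTBOX R}"
    have a: "FIN R \<subseteq> ran T" "ran T \<subseteq> FIN R \<union> BOTBOX R"
      using True final_good unfolding final_def by auto
    have FB: "FIN R \<inter> BOTBOX R = {}" unfolding FIN_def BOTBOX_def by auto
    have S: "?T t = Some p \<longleftrightarrow> (t, p) \<in> ?S" for t p
    proof
      assume "?T t = Some p"
      then have t: "t \<in> INIT R" "T t = Some p" "p \<notin> BOTBOX R" by (auto simp: restrict_map_def split: if_splits)
      then have "p \<in> FIN R" using a(2) by (auto simp: ran_def)
      then show "(t, p) \<in> ?S" using t T_iff unfolding INIT_eq FIN_eq by blast
    next
      assume "(t, p) \<in> ?S"
      then have t: "t \<in> INIT R" "p \<in> FIN R" "(t, p) \<in> mv\<^sup>*" unfolding INIT_eq FIN_eq by auto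
      then have "terminal p" using a(1) ran_T by blast
      then have "T t = Some p" using T_iff t unfolding INIT_eq by blast
      moreover have "p \<notin> BOTBOX R" using t(2) FB by blast
      then have "Some p \<notin> Some ` BOTBOX R" by blast
      ultimately show "?T t = Some p" using t(1) unfolding restrict_map_def by simp
    qed
    have "?T = (\<lambda>t. if \<exists>p. (t, p) \<in> ?S then Some (THE p. (t, p) \<in> ?S) else None)"
      using S by (rule map_eq_relation)
    then show ?thesis using True final_good
      unfolding interp_def the Let_def result_of_def behaviour_def fst_conv snd_conv by (simp only: if_True)
  qed
qed

end

section \<open>Contraction in flat nets\<close>

lemma net_rules_single: "net_rules {#(G, l)#} = Pair (guard G) ` link_rules l"
  unfolding net_rules_def by auto

lemma net_births_single: "net_births {#(G, l)#} = (case l of One e \<Rightarrow> {(guard G, Pos e [])} | _ \<Rightarrow> {})"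
  unfolding net_births_def by (cases l) auto

lemma net_bb_single: "net_bb {#(G, l)#} = (case l of Bot e C \<Rightarrow> if C = {#} then {Lock e 0} else {} | _ \<Rightarrow> {})"
  unfolding net_bb_def by (cases l) auto

lemma guard_empty [simp]: "guard {} = {}"
  by (simp add: guard_def)

lemma link_rules_Sync: "link_rules (Sync xs) = {sync_arcs xs}"
  unfolding link_rules_def by (auto elim: move.cases)

lemma link_rules_move: "(\<And>xs. l \<noteq> Sync xs) \<Longrightarrow> link_rules l = {{(p, q)} | p q. move l p q}"
  unfolding link_rules_def by auto

lemma moves_net_rules:
  "(p, q) \<in> moves (net_rules F) \<longleftrightarrow> (\<exists>G l A. (G, l) \<in># F \<and> A \<in> link_rules l \<and> (p, q) \<in> A)"
proof
  assume "(p, q) \<in> moves (net_rules F)"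
  then obtain Gp A where "(Gp, A) \<in> net_rules F" "(p, q) \<in> A" by (rule movesE)
  then show "\<exists>G l A. (G, l) \<in># F \<and> A \<in> link_rules l \<and> (p, q) \<in> A" unfolding net_rules_def by blast
next
  assume "\<exists>G l A. (G, l) \<in># F \<and> A \<in> link_rules l \<and> (p, q) \<in> A"
  then obtain G l A where *: "(G, l) \<in># F" "A \<in> link_rules l" "(p, q) \<in> A" by blast
  then have "(guard G, A) \<in> net_rules F" unfolding net_rules_def by blast
  then show "(p, q) \<in> moves (net_rules F)" using *(3) by (rule movesI)
qed

lemma move_in_moves: "(G, l) \<in># F \<Longrightarrow> move l p q \<Longrightarrow> (p, q) \<in> moves (net_rules F)"
  unfolding moves_net_rules link_rules_def by blast

text \<open>The relation is a disjoint union of paths and cycles, and both \<open>p\<close> and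
  \<open>q\<close> lie on the one through \<open>x\<close>. Thus the fibre condition of a
  contraction need only be checked against one representative.\<close>

lemma comparable_via:
  assumes "single_valued r" "single_valued (r\<inverse>)"
    and "(p, x) \<in> r\<^sup>* \<or> (x, p) \<in> r\<^sup>*" "(q, x) \<in> r\<^sup>* \<or> (x, q) \<in> r\<^sup>*"
  shows "(p, q) \<in> r\<^sup>* \<or> (q, p) \<in> r\<^sup>*"
  using assms(3)
proof
  assume px: "(p, x) \<in> r\<^sup>*"
  from assms(4) show ?thesis
  proof
    assume "(q, x) \<in> r\<^sup>*"
    then have "(x, q) \<in> (r\<inverse>)\<^sup>*" "(x, p) \<in> (r\<inverse>)\<^sup>*" using px by (simp_all add: rtrancl_converse)
    then have "(q, p) \<in> (r\<inverse>)\<^sup>* \<or> (p, q) \<in> (r\<inverse>)\<^sup>*" using single_valued_confluent[OF assms(2)] by blast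
    then show ?thesis by (simp add: rtrancl_converse)
  next
    assume "(x, q) \<in> r\<^sup>*"
    then show ?thesis using px by (meson rtrancl_trans)
  qed
next
  assume xp: "(x, p) \<in> r\<^sup>*"
  from assms(4) show ?thesis
  proof
    assume "(q, x) \<in> r\<^sup>*"
    then show ?thesis using xp by (meson rtrancl_trans)
  next
    assume "(x, q) \<in> r\<^sup>*"
    then show ?thesis using single_valued_confluent[OF assms(1) xp] by blast
  qed
qed

lemma image_fixed: "(\<And>x. x \<in> S \<Longrightarrow> f x = x) \<Longrightarrow> f ` S = S"
  by (metis image_cong image_ident)

lemma push_rules_fixed:
  assumes "\<And>G l. (G, l) \<in># F \<Longrightarrow> typed l"
    and "\<And>e. \<phi> (Lock e 0) = Lock e 0"
    and "\<And>e m. e \<in># fprems F \<or> e \<in># fconcls F \<Longrightarrow> \<phi> (Pos e m) = Pos e m"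
  shows "push_rules \<phi> (net_rules F) = net_rules F"
proof -
  have id: "(\<phi> ` Gp, map_prod \<phi> \<phi> ` A) = (Gp, A)" if "(Gp, A) \<in> net_rules F" for Gp A
  proof -
    obtain G l where l: "(G, l) \<in># F" "A \<in> link_rules l" "Gp = guard G" using \<open>(Gp, A) \<in> net_rules F\<close>
      unfolding net_rules_def by auto
    have e: "\<phi> (Pos e m) = Pos e m" if "e \<in># prems l \<or> e \<in># concls l" for e m
      using assms(3)[of e m] that prems_le_fprems[OF l(1)] concls_le_fconcls[OF l(1)]
      by (metis mset_subset_eqD snd_conv)
    have "map_prod \<phi> \<phi> x = x" if "x \<in> A" for x
    proof -
      obtain p q where x: "x = (p, q)" by fastforce
      then have "leaves l p" "enters l q" using link_rule_ends[OF l(2) assms(1)[OF l(1)]] \<open>x \<in> A\<close> by blast+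
      then have "\<phi> p = p" "\<phi> q = q" using e assms(2) unfolding leaves_def enters_def by blast+
      then show ?thesis using x by simp
    qed
    then have "map_prod \<phi> \<phi> ` A = A" by force
    moreover have "\<phi> ` Gp = Gp" unfolding l(3) guard_def image_image assms(2) by simp
    ultimately show ?thesis by simp
  qed
  have "(\<lambda>(G, A). (\<phi> ` G, map_prod \<phi> \<phi> ` A)) x = x" if "x \<in> net_rules F" for x
    using id[of "fst x" "snd x"] that by (cases x) simp
  then show ?thesis unfolding push_rules_def by (rule image_fixed)
qed

lemma push_births_fixed:
  assumes "\<And>e. \<phi> (Lock e 0) = Lock e 0"
    and "\<And>e m. e \<in># fconcls F \<Longrightarrow> \<phi> (Pos e m) = Pos e m"
  shows "push_births \<phi> (net_births F) = net_births F"
proof -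
  have "(\<lambda>(G, p). (\<phi> ` G, \<phi> p)) x = x" if "x \<in> net_births F" for x
  proof -
    obtain G e where x: "x = (guard G, Pos e [])" "(G, One e) \<in># F" using \<open>x \<in> net_births F\<close>
      unfolding net_births_def by blast
    have "e \<in># fconcls F" using concls_le_fconcls[OF x(2)] by (auto dest: mset_subset_eqD)
    moreover have "\<phi> ` guard G = guard G" unfolding guard_def image_image assms(1) by simp
    ultimately show ?thesis using assms(2) x(1) by simp
  qed
  then show ?thesis unfolding push_births_def by (rule image_fixed)
qed

lemma image_bb_fixed: "(\<And>e. \<phi> (Lock e 0) = Lock e 0) \<Longrightarrow> \<phi> ` net_bb F = net_bb F"
  unfolding net_bb_def by force

lemma push_rules_Un: "push_rules \<phi> (H \<union> H') = push_rules \<phi> H \<union> push_rules \<phi> H'"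
  and push_births_Un: "push_births \<phi> (B \<union> B') = push_births \<phi> B \<union> push_births \<phi> B'"
  unfolding push_rules_def push_births_def by auto

text \<open>Links that move one token at a time and neither create tokens nor unlock boxes.
  Unguarded, they fire whenever their source is reached.\<close>

definition wire :: "edge link \<Rightarrow> bool" where
  "wire l \<longleftrightarrow> (case l of Ax _ _ \<Rightarrow> True | Cut _ _ \<Rightarrow> True | Tens _ _ _ \<Rightarrow> True | Par _ _ _ \<Rightarrow> True | _ \<Rightarrow> False)"

lemma wire_simps [simp]: "wire (Ax a b)" "wire (Cut a b)" "wire (Tens a b c)" "wire (Par a b c)"
  "\<not> wire (One a)" "\<not> wire (Bot a C)" "\<not> wire (Sync xs)"
  by (simp_all add: wire_def)

section \<open>Contracting a part of a flat net\<close>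

context flat_net_locale
begin

text \<open>Both ends of the edge are already used up inside \<open>F1\<close>, so by linearity none
  is left for \<open>F2\<close> or for the conclusions.\<close>

lemma internal_edge:
  assumes "F = F1 + F2" "e \<in># fprems F1" "e \<in># fconcls F1"
  shows "e \<notin># fprems F2" "e \<notin># fconcls F2" "e \<notin># K"
proof -
  have c: "count (fprems F1) e \<ge> 1" "count (fconcls F1) e \<ge> 1" using assms(2,3) by auto
  have "count (fprems F1) e + count (fprems F2) e + count K e \<le> 1"
    using count_prems[of e] unfolding assms(1) fprems_simps count_union .
  moreover have "count (fconcls F1) e + count (fconcls F2) e \<le> 1"
    using count_concls[of e] unfolding assms(1) fconcls_simps count_union .
  ultimately have "count (fprems F2) e = 0" "count (fconcls F2) e = 0" "count K e = 0" using c by linarith+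
  then show "e \<notin># fprems F2" "e \<notin># fconcls F2" "e \<notin># K" by (simp_all add: not_in_iff)
qed

lemma sub_moves: "F = F1 + F2 \<Longrightarrow> moves (net_rules F1) \<subseteq> mv"
  by (simp add: net_rules_Un moves_Un)

lemma sub_moves_single_valued:
  assumes "F = F1 + F2"
  shows "single_valued (moves (net_rules F1))" "single_valued ((moves (net_rules F1))\<inverse>)"
  using sub_moves[OF assms] move_succ_unique move_pred_unique unfolding single_valued_def by blast+

lemma wire_fires:
  assumes "F = F1 + F2" "\<And>G l. (G, l) \<in># F1 \<Longrightarrow> G = {} \<and> wire l"
    and "(p, q) \<in> moves (net_rules F1)" "p \<in> rch"
  shows "q \<in> rch"
proof -
  obtain G l A where l: "(G, l) \<in># F1" "A \<in> link_rules l" "(p, q) \<in> A"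
    using assms(3) unfolding moves_net_rules by blast
  then have G: "G = {}" "wire l" using assms(2) by blast+
  then have "A = {(p, q)}" using l(2,3) unfolding link_rules_def by auto
  moreover have "(guard G, A) \<in> net_rules F" using l assms(1) unfolding net_rules_def by auto
  ultimately show ?thesis using assms(4) G(1) by (intro reach_rule[of "{}" A _ _ _ p q]) auto
qed

text \<open>The general form, needed directly when \<open>\<phi>\<close> renames edges outside the
  redex or when a sync is contracted.\<close>

lemma contract:
  assumes F: "F = F1 + F2"
    and id: "\<And>p q. (p, q) \<in> moves (net_rules F1) \<Longrightarrow> \<phi> p = \<phi> q"
    and fires: "\<And>p q. (p, q) \<in> moves (net_rules F1) \<Longrightarrow> p \<in> rch \<Longrightarrow> q \<in> rch"
    and concl: "\<And>e m. e \<in># K \<Longrightarrow> \<phi> (Pos e m) = Pos e m"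
    and fib: "\<And>p p'. p \<in> carrier F \<Longrightarrow> p' \<in> carrier F \<Longrightarrow> \<phi> p = \<phi> p' \<Longrightarrow>
      (p, p') \<in> (moves (net_rules F1))\<^sup>* \<or> (p', p) \<in> (moves (net_rules F1))\<^sup>*"
  shows "flat_behaviour F K = behaviour (net_init K) (push_births \<phi> (net_births F))
    (push_rules \<phi> (net_rules F2)) (net_fin K) (\<phi> ` net_bb F)"
proof -
  have eq: "net_rules F1 \<union> net_rules F2 = net_rules F" using F by (simp add: net_rules_Un)
  have "contraction (net_init K) (net_births F) (net_rules F1) (net_rules F2) \<phi> (carrier F) (net_fin K) (net_bb F)"
  proof (intro contraction.intro contraction_axioms.intro; (unfold eq)?)
    show "token_machine (net_init K) (net_births F) (net_rules F)" by unfold_locales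
    show "net_rules F1 \<inter> net_rules F2 = {}" using rule_disjoint[OF F] .
    show "\<phi> p = p" if "p \<in> net_init K" for p using that concl unfolding net_init_def by blast
    show "\<phi> p = p" if "p \<in> net_fin K" for p using that concl unfolding net_fin_def by blast
    show "net_bb F \<subseteq> carrier F" unfolding carrier_def by blast
    show "G \<subseteq> carrier F" if "(G, A) \<in> net_rules F2" for G A
      using that guard_carrier F unfolding net_rules_def by fastforce
    show "(p, q) \<notin> mv" if "p \<in> net_fin K \<union> net_bb F" for p q
      using that fin_no_move bb_no_move by blast
  qed (use id fires fib conclusion_carrier birth_carrier moves_carrier in blast)+
  then show ?thesis using contraction.behaviour_push eq by metis
qed

text \<open>For maps that touch only edges inside the redex: \<open>moved\<close> makes
  \<open>\<phi>\<close> fix the context \<open>FG\<close> and the conclusions, and by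
  \<open>pointed\<close> each fibre is held together by the common image of its members.\<close>

lemma contract_local:
  assumes F: "F = FK + FH + FG"
    and FK: "\<And>G l. (G, l) \<in># FK \<Longrightarrow> G = {} \<and> wire l"
    and FH: "\<And>G l. (G, l) \<in># FH \<Longrightarrow> wire l \<or> (\<exists>xs. l = Sync xs)"
    and lock: "\<And>e. \<phi> (Lock e 0) = Lock e 0"
    and moved: "\<And>e m. \<phi> (Pos e m) \<noteq> Pos e m \<Longrightarrow> e \<in># fprems (FK + FH) \<and> e \<in># fconcls (FK + FH)"
    and id: "\<And>G l p q. (G, l) \<in># FK \<Longrightarrow> move l p q \<Longrightarrow> \<phi> p = \<phi> q"
    and pointed: "\<And>e m. m \<in> atoms (ty e) \<Longrightarrow> (Pos e m, \<phi> (Pos e m)) \<in> (moves (net_rules FK))\<^sup>* \<or>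
      (\<phi> (Pos e m), Pos e m) \<in> (moves (net_rules FK))\<^sup>*"
  shows "flat_behaviour F K = behaviour (net_init K) (net_births FG)
    (push_rules \<phi> (net_rules FH) \<union> net_rules FG) (net_fin K) (net_bb FG)"
proof -
  have F': "F = FK + (FH + FG)" using F by simp
  have nowire: "wire l \<or> (\<exists>xs. l = Sync xs)" if "(G, l) \<in># FK + FH" for G l using that FK FH by auto
  have births: "net_births F = net_births FG"
    unfolding F net_births_Un using nowire unfolding net_births_def by fastforce
  have bb: "net_bb F = net_bb FG"
    unfolding F net_bb_Un using nowire unfolding net_bb_def by fastforce
  have fixed: "\<phi> (Pos e m) = Pos e m" if "e \<in># fprems FG \<or> e \<in># fconcls FG \<or> e \<in># K" for e m
    using moved[of e m] internal_edge[OF F, of e] that by blast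
  have typed: "typed l" if "(G, l) \<in># FG" for G l using that mem_typed[of G l] F by simp
  have "flat_behaviour F K = behaviour (net_init K) (push_births \<phi> (net_births F))
    (push_rules \<phi> (net_rules (FH + FG))) (net_fin K) (\<phi> ` net_bb F)"
  proof (rule contract[OF F'])
    show "\<phi> p = \<phi> q" if "(p, q) \<in> moves (net_rules FK)" for p q
    proof -
      from that obtain G l A where l: "(G, l) \<in># FK" "A \<in> link_rules l" "(p, q) \<in> A"
        unfolding moves_net_rules by blast
      then have "move l p q" using FK[OF l(1)] unfolding link_rules_def by auto
      then show ?thesis using id[OF l(1)] by blast
    qed
    show "q \<in> rch" if "(p, q) \<in> moves (net_rules FK)" "p \<in> rch" for p q
      using wire_fires[OF F' FK that] .
    show "\<phi> (Pos e m) = Pos e m" if "e \<in># K" for e m using fixed that by blast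
    fix p p' assume p: "p \<in> carrier F" "p' \<in> carrier F" "\<phi> p = \<phi> p'"
    have point: "(x, \<phi> x) \<in> (moves (net_rules FK))\<^sup>* \<or> (\<phi> x, x) \<in> (moves (net_rules FK))\<^sup>*"
      if "x \<in> carrier F" for x
    proof -
      from that consider e m where "x = Pos e m" "m \<in> atoms (ty e)" | e where "x = Lock e 0"
        unfolding carrier_def net_bb_def by blast
      then show ?thesis by cases (use pointed lock in auto)
    qed
    show "(p, p') \<in> (moves (net_rules FK))\<^sup>* \<or> (p', p) \<in> (moves (net_rules FK))\<^sup>*"
      using comparable_via[OF sub_moves_single_valued[OF F'] point[OF p(1)]] point[OF p(2)] p(3) by simp
  qed
  also have "push_births \<phi> (net_births F) = net_births FG"
    unfolding births using lock fixed by (intro push_births_fixed) auto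
  also have "push_rules \<phi> (net_rules (FH + FG)) = push_rules \<phi> (net_rules FH) \<union> net_rules FG"
  proof -
    have "push_rules \<phi> (net_rules FG) = net_rules FG"
      by (rule push_rules_fixed) (use typed lock fixed in blast)+
    then show ?thesis unfolding net_rules_Un push_rules_Un by simp
  qed
  also have "\<phi> ` net_bb F = net_bb FG"
    unfolding bb using lock by (rule image_bb_fixed)
  finally show ?thesis .
qed

end

section \<open>Reduction steps on flat nets\<close>

lemma move_Ax:
  assumes "x \<in> {Ax e f, Ax f e}"
  shows "move x p q \<longleftrightarrow> (\<exists>m. p = Pos e m \<and> q = Pos f m \<and> m \<in> neg_atoms (ty e) \<or>
    p = Pos f m \<and> q = Pos e m \<and> m \<in> neg_atoms (ty f))"
  using assms by (auto elim!: move.cases intro: move.intros)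

lemma move_Cut:
  assumes "k \<in> {Cut e f, Cut f e}"
  shows "move k p q \<longleftrightarrow> (\<exists>m. p = Pos e m \<and> q = Pos f m \<and> m \<in> pos_atoms (ty e) \<or>
    p = Pos f m \<and> q = Pos e m \<and> m \<in> pos_atoms (ty f))"
  using assms by (auto elim!: move.cases intro: move.intros)

lemma move_binary:
  assumes "l \<in> {Tens a b c, Par a b c}"
  shows "move l p q \<longleftrightarrow> (\<exists>m. p = Pos a m \<and> q = Pos c (Lft # m) \<and> m \<in> pos_atoms (ty a) \<or>
    p = Pos b m \<and> q = Pos c (Rgt # m) \<and> m \<in> pos_atoms (ty b) \<or>
    p = Pos c (Lft # m) \<and> q = Pos a m \<and> m \<in> neg_atoms (ty a) \<or>
    p = Pos c (Rgt # m) \<and> q = Pos b m \<and> m \<in> neg_atoms (ty b))"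
  using assms by (auto elim!: move.cases intro: move.intros)

text \<open>Contracts a tensor or par link onto its premisses, where \<open>join_pos\<close>
  contracts it onto its conclusion. \<open>C\<close> is a set because a cut makes two compound edges
  share the same components. The empty address may be left alone: a compound formula has no atom
  there.\<close>

fun split_pos :: "edge set \<Rightarrow> edge \<Rightarrow> edge \<Rightarrow> pos \<Rightarrow> pos" where
  "split_pos C a b (Pos e (Lft # m)) = (if e \<in> C then Pos a m else Pos e (Lft # m))"
| "split_pos C a b (Pos e (Rgt # m)) = (if e \<in> C then Pos b m else Pos e (Rgt # m))"
| "split_pos C a b p = p"

fun join_pos :: "edge \<Rightarrow> edge \<Rightarrow> edge \<Rightarrow> pos \<Rightarrow> pos" where
  "join_pos a b c (Pos e m) = (if e = a then Pos c (Lft # m) else if e = b then Pos c (Rgt # m) else Pos e m)"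
| "join_pos a b c p = p"

fun rename_pos :: "edge \<Rightarrow> edge \<Rightarrow> pos \<Rightarrow> pos" where
  "rename_pos u v (Pos e m) = (if e = u then Pos v m else Pos e m)"
| "rename_pos u v p = p"

lemma split_pos_other [simp]: "e \<notin> C \<Longrightarrow> split_pos C a b (Pos e m) = Pos e m"
  by (cases "(C, a, b, Pos e m)" rule: split_pos.cases) auto

lemma split_pos_outside: "c \<notin> S \<Longrightarrow> e \<in> S \<Longrightarrow> split_pos {c} a b (Pos e m) = Pos e m"
  by (rule split_pos_other) auto

lemma join_pos_outside: "a \<notin> S \<Longrightarrow> b \<notin> S \<Longrightarrow> e \<in> S \<Longrightarrow> join_pos a b c (Pos e m) = Pos e m"
  by auto

lemma rename_pos_outside: "u \<notin> S \<Longrightarrow> e \<in> S \<Longrightarrow> rename_pos u v (Pos e m) = Pos e m"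
  by auto

text \<open>The share of one pair in \<open>sync_arcs\<close>. It lets the image of the arcs under a
  contraction be computed pair by pair, as only one pair changes in a reduction step.\<close>

definition pair_arcs :: "edge \<Rightarrow> edge \<Rightarrow> (pos \<times> pos) set" where
  "pair_arcs p c = (if positive (ty p) then (\<lambda>m. (Pos p m, Pos c m)) ` atoms (ty p)
     else (\<lambda>m. (Pos c m, Pos p m)) ` atoms (ty c))"

lemma sync_arcs_alt: "sync_arcs xs = (\<Union>x \<in> set xs. pair_arcs (fst x) (snd x))"
proof -
  have "sync_arcs xs = (\<Union>y \<in> set (arcs xs). (\<lambda>m. (Pos (fst y) m, Pos (snd y) m)) ` atoms (ty (fst y)))"
    unfolding sync_arcs_def by force
  also have "\<dots> = (\<Union>x \<in> set xs. pair_arcs (fst x) (snd x))"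
    unfolding arcs_def pair_arcs_def set_map by (simp add: split_beta)
  finally show ?thesis .
qed

lemma sync_arcs_Cons: "sync_arcs ((p, c) # xs) = pair_arcs p c \<union> sync_arcs xs"
  and sync_arcs_append: "sync_arcs (xs @ ys) = sync_arcs xs \<union> sync_arcs ys"
  unfolding sync_arcs_alt by auto

lemma sync_arcs_fixed:
  assumes "\<And>e m. e \<in> fst ` set xs \<union> snd ` set xs \<Longrightarrow> \<phi> (Pos e m) = Pos e m"
  shows "map_prod \<phi> \<phi> ` sync_arcs xs = sync_arcs xs"
proof (rule image_fixed)
  fix x assume "x \<in> sync_arcs xs"
  then obtain e e' m where x: "x = (Pos e m, Pos e' m)" "(e, e') \<in> set (arcs xs)" unfolding sync_arcs_def by blast
  have "e \<in> fst ` set xs \<union> snd ` set xs \<and> e' \<in> fst ` set xs \<union> snd ` set xs"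
    using x(2) by (rule arcs_cases) force+
  then show "map_prod \<phi> \<phi> x = x" using assms x(1) by simp
qed

text \<open>On the right the link \<open>x\<close> survives only in the image of the arcs of the
  sync, so two nets with the same context can be compared by these images alone.\<close>

lemma sync_contract:
  assumes "flat_net ({#({}, x), ({}, Sync xs)#} + FG) K" "wire x"
    and "\<And>e. \<phi> (Lock e 0) = Lock e 0"
    and "\<And>e m. \<phi> (Pos e m) \<noteq> Pos e m \<Longrightarrow> e \<in># prems x + mset (map fst xs) \<and> e \<in># concls x + mset (map snd xs)"
    and "\<And>p q. move x p q \<Longrightarrow> \<phi> p = \<phi> q"
    and pointed: "\<And>e m. m \<in> atoms (ty e) \<Longrightarrow> \<phi> (Pos e m) = Pos e m \<or>
      move x (Pos e m) (\<phi> (Pos e m)) \<or> move x (\<phi> (Pos e m)) (Pos e m)"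
  shows "flat_behaviour ({#({}, x), ({}, Sync xs)#} + FG) K = behaviour (net_init K) (net_births FG)
    (insert ({}, map_prod \<phi> \<phi> ` sync_arcs xs) (net_rules FG)) (net_fin K) (net_bb FG)"
proof -
  interpret flat_net_locale "{#({}, x), ({}, Sync xs)#} + FG" K using assms(1) by unfold_locales
  have "flat_behaviour ({#({}, x), ({}, Sync xs)#} + FG) K = behaviour (net_init K) (net_births FG)
    (push_rules \<phi> (net_rules {#({}, Sync xs)#}) \<union> net_rules FG) (net_fin K) (net_bb FG)"
  proof (rule contract_local[where FK = "{#({}, x)#}" and FH = "{#({}, Sync xs)#}"])
    fix e m assume "m \<in> atoms (ty e)"
    from pointed[OF this] show "(Pos e m, \<phi> (Pos e m)) \<in> (moves (net_rules {#({}, x)#}))\<^sup>* \<or>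
      (\<phi> (Pos e m), Pos e m) \<in> (moves (net_rules {#({}, x)#}))\<^sup>*"
    proof (elim disjE)
      assume "move x (Pos e m) (\<phi> (Pos e m))"
      then have "(Pos e m, \<phi> (Pos e m)) \<in> moves (net_rules {#({}, x)#})"
        by (intro move_in_moves[of "{}" x]) simp_all
      then show ?thesis by blast
    next
      assume "move x (\<phi> (Pos e m)) (Pos e m)"
      then have "(\<phi> (Pos e m), Pos e m) \<in> moves (net_rules {#({}, x)#})"
        by (intro move_in_moves[of "{}" x]) simp_all
      then show ?thesis by blast
    qed simp
  next
    fix e m assume "\<phi> (Pos e m) \<noteq> Pos e m"
    from assms(4)[OF this] show "e \<in># fprems ({#({}, x)#} + {#({}, Sync xs)#}) \<and> e \<in># fconcls ({#({}, x)#} + {#({}, Sync xs)#})"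
      by auto
  next
    fix G l assume "(G, l) \<in># {#({}, x)#}"
    then show "G = {} \<and> wire l" using assms(2) by simp
  next
    fix G l p q assume "(G, l) \<in># {#({}, x)#}" "move l p q"
    then show "\<phi> p = \<phi> q" using assms(5) by simp
  qed (use assms(3) in simp_all)
  also have "push_rules \<phi> (net_rules {#({}, Sync xs)#}) = {({}, map_prod \<phi> \<phi> ` sync_arcs xs)}"
    by (simp add: net_rules_single link_rules_Sync push_rules_def)
  finally show ?thesis by simp
qed

lemma flat_net_counts:
  assumes "flat_net F K"
  shows "count (fprems F) e \<le> 1" "count (fconcls F) e \<le> 1"
  using flat_net_locale.count_prems[of F K e] flat_net_locale.count_concls[of F K e] assms
  by (simp_all add: flat_net_locale_def)

lemma distinct_prems:
  assumes "flat_net F K" "fprems F = mset ys + M"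
  shows "distinct ys"
proof (rule count_le_one_distinct, intro allI)
  fix e show "count (mset ys) e \<le> 1" using flat_net_counts(1)[OF assms(1), of e] unfolding assms(2) by simp
qed

lemma distinct_concls:
  assumes "flat_net F K" "fconcls F = mset ys + M"
  shows "distinct ys"
proof (rule count_le_one_distinct, intro allI)
  fix e show "count (mset ys) e \<le> 1" using flat_net_counts(2)[OF assms(1), of e] unfolding assms(2) by simp
qed

text \<open>Both nets are brought to arcs between \<open>a\<close>, \<open>b\<close> and the two
  halves of \<open>d\<close>. Before the step the binary link lies above the sync and is contracted
  onto its premisses; after it the link lies below and is contracted onto its conclusion.\<close>

lemma binary_sync_behaviour:
  assumes F: "flat_net ({#({}, x), ({}, Sync (xs @ (c, d) # ys))#} + FG) K"
    and F': "flat_net ({#({}, x'), ({}, Sync (xs @ (a, a') # (b, b') # ys))#} + FG) K"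
    and x: "x = Tens a b c \<and> x' = Tens a' b' d \<or> x = Par a b c \<and> x' = Par a' b' d"
  shows "flat_behaviour ({#({}, x), ({}, Sync (xs @ (c, d) # ys))#} + FG) K =
    flat_behaviour ({#({}, x'), ({}, Sync (xs @ (a, a') # (b, b') # ys))#} + FG) K"
proof -
  let ?xs = "xs @ (c, d) # ys" and ?xs' = "xs @ (a, a') # (b, b') # ys"
  let ?\<phi> = "split_pos {c} a b" and ?\<phi>' = "join_pos a' b' d"
  have typed: "typed x" "typed x'" "typed (Sync ?xs)" "typed (Sync ?xs')"
    using F F' unfolding flat_net_def by auto
  have ends: "prems x = {#a, b#}" "concls x = {#c#}" "prems x' = {#a', b'#}" "concls x' = {#d#}"
    using x by auto
  have bin: "x \<in> {Tens a b c, Par a b c}" "x' \<in> {Tens a' b' d, Par a' b' d}" using x by auto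
  note mv = move_binary[OF bin(1)] and mv' = move_binary[OF bin(2)]
  have ne: "a \<noteq> c" "b \<noteq> c" "a' \<noteq> d" "b' \<noteq> d" using x typed(1,2) by auto
  have c_count: "c \<noteq> d" "c \<notin> fst ` set xs \<union> snd ` set xs" "c \<notin> fst ` set ys \<union> snd ` set ys"
    using flat_net_counts[OF F, of c] ends by (simp_all add: count_eq_zero_iff split: if_splits)
  have a_count: "a' \<noteq> b'" "a' \<noteq> a" "a' \<noteq> b" "a' \<notin> fst ` set xs \<union> snd ` set xs" "a' \<notin> fst ` set ys \<union> snd ` set ys"
    using flat_net_counts[OF F', of a'] ends by (simp_all add: count_eq_zero_iff split: if_splits)
  have b_count: "b' \<noteq> a" "b' \<noteq> b" "b' \<notin> fst ` set xs \<union> snd ` set xs" "b' \<notin> fst ` set ys \<union> snd ` set ys"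
    using flat_net_counts[OF F', of b'] ends by (simp_all add: count_eq_zero_iff split: if_splits)
  have atoms_c: "atoms (ty c) = Cons Lft ` atoms (ty a) \<union> Cons Rgt ` atoms (ty b)"
    using x typed(1) by auto
  have ty: "ty d = ty c" "ty a' = ty a" "ty b' = ty b" using typed(3,4) by auto
  have "positive (ty c) \<or> negative (ty c)" using typed(3) by auto
  then have pos: "positive (ty c) = positive (ty a)" "positive (ty c) = positive (ty b)"
    using x typed(1) negative_not_positive by auto
  have 1: "flat_behaviour ({#({}, x), ({}, Sync ?xs)#} + FG) K = behaviour (net_init K) (net_births FG)
    (insert ({}, map_prod ?\<phi> ?\<phi> ` sync_arcs ?xs) (net_rules FG)) (net_fin K) (net_bb FG)"
  proof (rule sync_contract[OF F])
    show "wire x" using x by auto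
    fix e m assume "?\<phi> (Pos e m) \<noteq> Pos e m"
    then have "e \<in> {c}" using split_pos_other[of e "{c}" a b m] by argo
    then have "e = c" by simp
    then show "e \<in># prems x + mset (map fst ?xs) \<and> e \<in># concls x + mset (map snd ?xs)" using ends by simp
  next
    fix p q assume "move x p q"
    then show "?\<phi> p = ?\<phi> q" using ne unfolding mv by auto
  next
    fix e m assume m: "m \<in> atoms (ty e)"
    show "?\<phi> (Pos e m) = Pos e m \<or> move x (Pos e m) (?\<phi> (Pos e m)) \<or> move x (?\<phi> (Pos e m)) (Pos e m)"
    proof (cases "e = c")
      case True
      then show ?thesis using m atoms_c unfolding mv by auto
    qed simp
  qed simp
  have 2: "flat_behaviour ({#({}, x'), ({}, Sync ?xs')#} + FG) K = behaviour (net_init K) (net_births FG)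
    (insert ({}, map_prod ?\<phi>' ?\<phi>' ` sync_arcs ?xs') (net_rules FG)) (net_fin K) (net_bb FG)"
  proof (rule sync_contract[OF F'])
    show "wire x'" using x by auto
    fix e m assume "?\<phi>' (Pos e m) \<noteq> Pos e m"
    then have "e = a' \<or> e = b'" by (auto split: if_splits)
    then show "e \<in># prems x' + mset (map fst ?xs') \<and> e \<in># concls x' + mset (map snd ?xs')" using ends by auto
  next
    fix p q assume "move x' p q"
    then show "?\<phi>' p = ?\<phi>' q" using ne a_count unfolding mv' by auto
  next
    fix e m assume m: "m \<in> atoms (ty e)"
    then show "?\<phi>' (Pos e m) = Pos e m \<or> move x' (Pos e m) (?\<phi>' (Pos e m)) \<or> move x' (?\<phi>' (Pos e m)) (Pos e m)"
      unfolding mv' by auto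
  qed simp
  have xs: "map_prod ?\<phi> ?\<phi> ` sync_arcs xs = sync_arcs xs" "map_prod ?\<phi>' ?\<phi>' ` sync_arcs xs = sync_arcs xs"
    by (rule sync_arcs_fixed, erule split_pos_outside[OF c_count(2)])
      (rule sync_arcs_fixed, erule join_pos_outside[OF a_count(4) b_count(3)])
  have ys: "map_prod ?\<phi> ?\<phi> ` sync_arcs ys = sync_arcs ys" "map_prod ?\<phi>' ?\<phi>' ` sync_arcs ys = sync_arcs ys"
    by (rule sync_arcs_fixed, erule split_pos_outside[OF c_count(3)])
      (rule sync_arcs_fixed, erule join_pos_outside[OF a_count(5) b_count(4)])
  have "map_prod ?\<phi> ?\<phi> ` pair_arcs c d = map_prod ?\<phi>' ?\<phi>' ` (pair_arcs a a' \<union> pair_arcs b b')"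
  proof (cases "positive (ty c)")
    case True
    have "map_prod ?\<phi> ?\<phi> ` pair_arcs c d =
        (\<lambda>m. (Pos a m, Pos d (Lft # m))) ` atoms (ty a) \<union> (\<lambda>m. (Pos b m, Pos d (Rgt # m))) ` atoms (ty b)"
      using True c_count(1) unfolding pair_arcs_def atoms_c by (simp add: image_Un image_image)
    also have "\<dots> = map_prod ?\<phi>' ?\<phi>' ` (pair_arcs a a' \<union> pair_arcs b b')"
      using True pos a_count(1-3) b_count(1,2) unfolding pair_arcs_def by (simp add: image_Un image_image)
    finally show ?thesis .
  next
    case False
    have "map_prod ?\<phi> ?\<phi> ` pair_arcs c d =
        (\<lambda>m. (Pos d (Lft # m), Pos a m)) ` atoms (ty a) \<union> (\<lambda>m. (Pos d (Rgt # m), Pos b m)) ` atoms (ty b)"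
      using False c_count(1) unfolding pair_arcs_def ty atoms_c by (simp add: image_Un image_image)
    also have "\<dots> = map_prod ?\<phi>' ?\<phi>' ` (pair_arcs a a' \<union> pair_arcs b b')"
      using False pos a_count(1-3) b_count(1,2) ty unfolding pair_arcs_def by (simp add: image_Un image_image)
    finally show ?thesis .
  qed
  then have "map_prod ?\<phi> ?\<phi> ` sync_arcs ?xs = map_prod ?\<phi>' ?\<phi>' ` sync_arcs ?xs'"
    unfolding sync_arcs_append sync_arcs_Cons image_Un xs ys by (simp add: Un_assoc)
  then show ?thesis unfolding 1 2 by simp
qed

text \<open>\<open>u\<close> is the edge between the sync and \<open>x\<close>, \<open>v\<close> the
  other edge of \<open>x\<close>, and \<open>M\<close>, \<open>N\<close> are the addresses at which
  tokens cross \<open>x\<close> from \<open>u\<close> to \<open>v\<close> and back.\<close>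

lemma sync_contract_rename:
  assumes F: "flat_net ({#({}, x), ({}, Sync (xs @ (p, c) # ys))#} + FG) K" and "wire x"
    and internal: "u \<in># prems x + {#p#} \<and> u \<in># concls x \<or> u \<in># prems x \<and> u \<in># concls x + {#c#}"
    and uv: "u \<noteq> v" "u \<in> {p, c}" "p \<noteq> c"
    and mv: "\<And>p q. move x p q \<longleftrightarrow> (\<exists>m. p = Pos u m \<and> q = Pos v m \<and> m \<in> M \<or> p = Pos v m \<and> q = Pos u m \<and> m \<in> N)"
    and MN: "M \<union> N = atoms (ty u)"
  shows "flat_behaviour ({#({}, x), ({}, Sync (xs @ (p, c) # ys))#} + FG) K = behaviour (net_init K) (net_births FG)
    (insert ({}, sync_arcs xs \<union> map_prod (rename_pos u v) (rename_pos u v) ` pair_arcs p c \<union> sync_arcs ys) (net_rules FG))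
    (net_fin K) (net_bb FG)"
proof -
  let ?\<phi> = "rename_pos u v"
  have u: "u \<notin> fst ` set xs \<union> snd ` set xs" "u \<notin> fst ` set ys \<union> snd ` set ys"
  proof -
    define M N where "M = mset (map fst xs) + mset (map fst ys)" and "N = mset (map snd xs) + mset (map snd ys)"
    have "fprems ({#({}, x), ({}, Sync (xs @ (p, c) # ys))#} + FG) = (prems x + {#p#}) + M + fprems FG"
      "fconcls ({#({}, x), ({}, Sync (xs @ (p, c) # ys))#} + FG) = (concls x + {#c#}) + N + fconcls FG"
      unfolding M_def N_def by simp_all
    then have "count (prems x + {#p#}) u + count M u + count (fprems FG) u \<le> 1"
      "count (concls x + {#c#}) u + count N u + count (fconcls FG) u \<le> 1"
      using flat_net_counts[OF F, of u] by (metis count_union)+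
    moreover have "count (prems x + {#p#}) u \<ge> 1" "count (concls x + {#c#}) u \<ge> 1" using internal by auto
    ultimately have "count M u = 0" "count N u = 0" by linarith+
    then show "u \<notin> fst ` set xs \<union> snd ` set xs" "u \<notin> fst ` set ys \<union> snd ` set ys"
      unfolding M_def N_def by (simp_all add: count_eq_zero_iff)
  qed
  have "flat_behaviour ({#({}, x), ({}, Sync (xs @ (p, c) # ys))#} + FG) K = behaviour (net_init K) (net_births FG)
    (insert ({}, map_prod ?\<phi> ?\<phi> ` sync_arcs (xs @ (p, c) # ys)) (net_rules FG)) (net_fin K) (net_bb FG)"
  proof (rule sync_contract[OF F \<open>wire x\<close>])
    fix e m assume "?\<phi> (Pos e m) \<noteq> Pos e m"
    then have "e = u" by (auto split: if_splits)
    then show "e \<in># prems x + mset (map fst (xs @ (p, c) # ys)) \<and> e \<in># concls x + mset (map snd (xs @ (p, c) # ys))"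
      using internal by auto
  next
    fix p q assume "move x p q"
    then show "?\<phi> p = ?\<phi> q" using uv(1) unfolding mv by auto
  next
    fix e m assume "m \<in> atoms (ty e)"
    then show "?\<phi> (Pos e m) = Pos e m \<or> move x (Pos e m) (?\<phi> (Pos e m)) \<or> move x (?\<phi> (Pos e m)) (Pos e m)"
      using MN unfolding mv by auto
  qed simp
  also have "map_prod ?\<phi> ?\<phi> ` sync_arcs xs = sync_arcs xs" 
    by (rule sync_arcs_fixed, erule rename_pos_outside[OF u(1)])
  moreover have "map_prod ?\<phi> ?\<phi> ` sync_arcs ys = sync_arcs ys" 
    by (rule sync_arcs_fixed, erule rename_pos_outside[OF u(2)])
  ultimately show ?thesis unfolding sync_arcs_append sync_arcs_Cons image_Un by (simp add: Un_assoc)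
qed

text \<open>In both nets the tokens go from \<open>e\<close> to \<open>g\<close> through the sync:
  before the step the axiom is passed before the sync, afterwards behind it.\<close>

lemma ax_sync_behaviour:
  assumes F: "flat_net ({#({}, x), ({}, Sync (xs @ (f, g) # ys))#} + FG) K"
    and F': "flat_net ({#({}, Ax h g), ({}, Sync (xs @ (h, e) # ys))#} + FG) K"
    and x: "x \<in> {Ax e f, Ax f e}" and f: "positive (ty f)"
  shows "flat_behaviour ({#({}, x), ({}, Sync (xs @ (f, g) # ys))#} + FG) K =
    flat_behaviour ({#({}, Ax h g), ({}, Sync (xs @ (h, e) # ys))#} + FG) K"
proof -
  have ends: "prems x = {#}" "concls x = {#e, f#}" using x by auto
  have ty: "ty e = dual (ty f)" "ty g = ty f" "ty h = ty e" using F F' x unfolding flat_net_def by auto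
  have ne: "e \<noteq> f" "f \<noteq> g" "e \<noteq> g"
    using distinct_concls[OF F, of "[e, f, g]" "mset (map snd xs) + mset (map snd ys) + fconcls FG"] ends by auto
  have ne': "h \<noteq> g" "h \<noteq> e"
    using distinct_concls[OF F', of "[h, g, e]" "mset (map snd xs) + mset (map snd ys) + fconcls FG"] by auto
  have npos: "\<not> positive (ty h)" using f unfolding ty by (cases "ty f") auto
  have 1: "flat_behaviour ({#({}, x), ({}, Sync (xs @ (f, g) # ys))#} + FG) K = behaviour (net_init K) (net_births FG)
    (insert ({}, sync_arcs xs \<union> map_prod (rename_pos f e) (rename_pos f e) ` pair_arcs f g \<union> sync_arcs ys) (net_rules FG))
    (net_fin K) (net_bb FG)"
    by (rule sync_contract_rename[OF F, of f e "neg_atoms (ty f)" "neg_atoms (ty e)"])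
      (use x ends ne ty in \<open>auto simp: move_Ax[OF x]\<close>)
  have 2: "flat_behaviour ({#({}, Ax h g), ({}, Sync (xs @ (h, e) # ys))#} + FG) K = behaviour (net_init K) (net_births FG)
    (insert ({}, sync_arcs xs \<union> map_prod (rename_pos h g) (rename_pos h g) ` pair_arcs h e \<union> sync_arcs ys) (net_rules FG))
    (net_fin K) (net_bb FG)"
    by (rule sync_contract_rename[OF F', of h g "neg_atoms (ty h)" "neg_atoms (ty g)"])
      (use ne' ty in \<open>auto simp: move_Ax[of "Ax h g" h g]\<close>)
  have "map_prod (rename_pos f e) (rename_pos f e) ` pair_arcs f g = (\<lambda>m. (Pos e m, Pos g m)) ` atoms (ty f)"
    using f ne unfolding pair_arcs_def by (simp add: image_image)
  also have "\<dots> = map_prod (rename_pos h g) (rename_pos h g) ` pair_arcs h e"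
    using npos ne' ty unfolding pair_arcs_def by (simp add: image_image Un_commute)
  finally show ?thesis unfolding 1 2 by simp
qed

text \<open>In both nets the tokens go from \<open>h\<close> to \<open>f\<close>, with the cut
  passed before the sync on the left and behind it on the right.\<close>

lemma cut_sync_behaviour:
  assumes F: "flat_net ({#({}, k), ({}, Sync (xs @ (f, g) # ys))#} + FG) K"
    and F': "flat_net ({#({}, Cut f h'), ({}, Sync (xs @ (h, h') # ys))#} + FG) K"
    and k: "k \<in> {Cut g h, Cut h g}" and g: "negative (ty g)"
  shows "flat_behaviour ({#({}, k), ({}, Sync (xs @ (f, g) # ys))#} + FG) K =
    flat_behaviour ({#({}, Cut f h'), ({}, Sync (xs @ (h, h') # ys))#} + FG) K"
proof -
  have ends: "prems k = {#g, h#}" "concls k = {#}" using k by auto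
  have ty: "ty h = dual (ty g)" "ty g = ty f" "ty h' = ty h" using F F' k unfolding flat_net_def by auto
  have ne: "g \<noteq> h" "f \<noteq> g" "f \<noteq> h"
    using distinct_prems[OF F, of "[g, h, f]" "mset (map fst xs) + mset (map fst ys) + fprems FG"] ends by auto
  have ne': "h' \<noteq> f" "h' \<noteq> h"
    using distinct_prems[OF F', of "[f, h', h]" "mset (map fst xs) + mset (map fst ys) + fprems FG"] by auto
  have npos: "\<not> positive (ty f)" using g negative_not_positive unfolding ty by auto
  have "negative A \<Longrightarrow> positive (dual A)" for A by (induction A) auto
  then have pos: "positive (ty h)" using g unfolding ty(1) .
  have 1: "flat_behaviour ({#({}, k), ({}, Sync (xs @ (f, g) # ys))#} + FG) K = behaviour (net_init K) (net_births FG)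
    (insert ({}, sync_arcs xs \<union> map_prod (rename_pos g h) (rename_pos g h) ` pair_arcs f g \<union> sync_arcs ys) (net_rules FG))
    (net_fin K) (net_bb FG)"
    by (rule sync_contract_rename[OF F, of g h "pos_atoms (ty g)" "pos_atoms (ty h)"])
      (use k ends ne ty in \<open>auto simp: move_Cut[OF k]\<close>)
  have 2: "flat_behaviour ({#({}, Cut f h'), ({}, Sync (xs @ (h, h') # ys))#} + FG) K = behaviour (net_init K) (net_births FG)
    (insert ({}, sync_arcs xs \<union> map_prod (rename_pos h' f) (rename_pos h' f) ` pair_arcs h h' \<union> sync_arcs ys) (net_rules FG))
    (net_fin K) (net_bb FG)"
    by (rule sync_contract_rename[OF F', of h' f "pos_atoms (ty h')" "pos_atoms (ty f)"])
      (use ne' ty in \<open>auto simp: move_Cut[of "Cut f h'" h' f]\<close>)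
  have "map_prod (rename_pos g h) (rename_pos g h) ` pair_arcs f g = (\<lambda>m. (Pos h m, Pos f m)) ` atoms (ty f)"
    using npos ne ty unfolding pair_arcs_def by (simp add: image_image)
  also have "\<dots> = map_prod (rename_pos h' f) (rename_pos h' f) ` pair_arcs h h'"
    using pos ne' ty unfolding pair_arcs_def by (simp add: image_image Un_commute)
  finally show ?thesis unfolding 1 2 by simp
qed

lemma image_map_prod:
  "(\<lambda>x. (G, {map_prod f f x})) ` {(p, q). P p q} = {(G, {(f p, f q)}) | p q. P p q}"
  by force

text \<open>Only the par link and the cut are contracted, onto \<open>a'\<close> and
  \<open>b'\<close>. The tensor is kept: its arcs then run between \<open>a\<close> and
  \<open>a'\<close> and between \<open>b\<close> and \<open>b'\<close>, which are precisely the
  rules of the two new cuts.\<close>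

lemma tens_par_behaviour:
  assumes F: "flat_net ({#({}, Tens a b c), ({}, Par a' b' d), ({}, k)#} + FG) K"
    and k: "k \<in> {Cut c d, Cut d c}"
  shows "flat_behaviour ({#({}, Tens a b c), ({}, Par a' b' d), ({}, k)#} + FG) K =
    flat_behaviour ({#({}, Cut a a'), ({}, Cut b b')#} + FG) K"
proof -
  let ?F = "{#({}, Tens a b c), ({}, Par a' b' d), ({}, k)#} + FG"
  let ?FK = "{#({}, Par a' b' d), ({}, k)#}" and ?FH = "{#({}, Tens a b c)#}"
  let ?\<phi> = "split_pos {c, d} a' b'"
  interpret flat_net_locale ?F K using F by unfold_locales
  have ends: "prems k = {#c, d#}" "concls k = {#}" using k by auto
  have ty: "ty c = TensF (ty a) (ty b)" "ty d = ParF (ty a') (ty b')" "ty a' = dual (ty a)" "ty b' = dual (ty b)"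
    using F k unfolding flat_net_def by auto
  have "distinct [a, b, a', b', c, d]"
    using distinct_prems[OF F, of "[a, b, a', b', c, d]" "fprems FG"] ends by simp
  then have ne: "a \<notin> {c, d}" "b \<notin> {c, d}" "a' \<notin> {c, d}" "b' \<notin> {c, d}" "c \<noteq> d" by auto
  note mvT = move_binary[of "Tens a b c" a b c, simplified] and mvP = move_binary[of "Par a' b' d" a' b' d, simplified]
    and mvk = move_Cut[OF k]
  have inP: "(p, q) \<in> (moves (net_rules ?FK))\<^sup>*" if "move (Par a' b' d) p q" for p q
    using move_in_moves[of "{}" "Par a' b' d" ?FK p q] that by auto
  have ink: "(p, q) \<in> (moves (net_rules ?FK))\<^sup>*" if "move k p q" for p q
    using move_in_moves[of "{}" k ?FK p q] that by auto
  have "flat_behaviour ?F K = behaviour (net_init K) (net_births FG)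
    (push_rules ?\<phi> (net_rules ?FH) \<union> net_rules FG) (net_fin K) (net_bb FG)"
  proof (rule contract_local[where FK = ?FK and FH = ?FH])
    show "G = {} \<and> wire l" if "(G, l) \<in># ?FK" for G l using that k by auto
    fix e m assume "?\<phi> (Pos e m) \<noteq> Pos e m"
    then have "e \<in> {c, d}" using split_pos_other[of e "{c, d}" a' b' m] by argo
    then show "e \<in># fprems (?FK + ?FH) \<and> e \<in># fconcls (?FK + ?FH)" using ends by auto
  next
    fix G l p q assume "(G, l) \<in># ?FK" "move l p q"
    then have "move (Par a' b' d) p q \<or> move k p q" by auto
    then show "?\<phi> p = ?\<phi> q"
    proof
      assume "move (Par a' b' d) p q"
      then show ?thesis using ne unfolding mvP by auto
    next
      assume "move k p q"
      then show ?thesis using ty unfolding mvk by auto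
    qed
  next
    fix e m assume m: "m \<in> atoms (ty e)"
    consider "e \<notin> {c, d}" | "e = d" | "e = c" by auto
    then show "(Pos e m, ?\<phi> (Pos e m)) \<in> (moves (net_rules ?FK))\<^sup>* \<or> (?\<phi> (Pos e m), Pos e m) \<in> (moves (net_rules ?FK))\<^sup>*"
    proof cases
      case 2
      then have "move (Par a' b' d) (Pos e m) (?\<phi> (Pos e m)) \<or> move (Par a' b' d) (?\<phi> (Pos e m)) (Pos e m)"
        using m ty unfolding mvP by auto
      then show ?thesis using inP by blast
    next
      case 3
      \<comment> \<open>A position on \<open>c\<close> is joined to the premisses of the par link by
        two moves, through the same address on \<open>d\<close>.\<close>
      then have "move k (Pos e m) (Pos d m) \<and> move (Par a' b' d) (Pos d m) (?\<phi> (Pos e m)) \<or>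
          move (Par a' b' d) (?\<phi> (Pos e m)) (Pos d m) \<and> move k (Pos d m) (Pos e m)"
        using m ty unfolding mvP mvk by auto
      then show ?thesis using inP ink by (meson rtrancl_trans)
    qed simp
  qed auto
  also have "push_rules ?\<phi> (net_rules ?FH) = net_rules {#({}, Cut a a'), ({}, Cut b b')#}"
  proof -
    have "link_rules (Tens a b c) = (\<lambda>x. {x}) ` {(p, q). move (Tens a b c) p q}"
      unfolding link_rules_move[of "Tens a b c", simplified] by auto
    then have "push_rules ?\<phi> (net_rules ?FH) = (\<lambda>x. ({}, {map_prod ?\<phi> ?\<phi> x})) ` {(p, q). move (Tens a b c) p q}"
      unfolding net_rules_single push_rules_def by (simp add: image_image)
    also have "\<dots> = {({}, {(?\<phi> p, ?\<phi> q)}) | p q. move (Tens a b c) p q}"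
      by (rule image_map_prod)
    also have "\<dots> = {({}, {(p, q)}) | p q. move (Cut a a') p q \<or> move (Cut b b') p q}"
    proof -
      have cut: "m \<in> pos_atoms (ty a) \<Longrightarrow> move (Cut a a') (Pos a m) (Pos a' m)"
        "m \<in> neg_atoms (ty a) \<Longrightarrow> move (Cut a a') (Pos a' m) (Pos a m)"
        "m \<in> pos_atoms (ty b) \<Longrightarrow> move (Cut b b') (Pos b m) (Pos b' m)"
        "m \<in> neg_atoms (ty b) \<Longrightarrow> move (Cut b b') (Pos b' m) (Pos b m)" for m
        by (simp_all add: move.intros(3,4) ty(3,4))
      have "move (Cut a a') (?\<phi> p) (?\<phi> q) \<or> move (Cut b b') (?\<phi> p) (?\<phi> q)" if "move (Tens a b c) p q" for p q
        using that unfolding mvT by (elim exE disjE conjE) (simp_all add: split_pos_other[OF ne(1)] split_pos_other[OF ne(2)] cut)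
      moreover have "\<exists>p' q'. move (Tens a b c) p' q' \<and> p = ?\<phi> p' \<and> q = ?\<phi> q'"
        if "move (Cut a a') p q \<or> move (Cut b b') p q" for p q
      proof -
        from that obtain m where
          "p = Pos a m \<and> q = Pos a' m \<and> m \<in> pos_atoms (ty a) \<or> p = Pos a' m \<and> q = Pos a m \<and> m \<in> neg_atoms (ty a) \<or>
           p = Pos b m \<and> q = Pos b' m \<and> m \<in> pos_atoms (ty b) \<or> p = Pos b' m \<and> q = Pos b m \<and> m \<in> neg_atoms (ty b)"
          using ty unfolding move_Cut[of "Cut a a'" a a', simplified] move_Cut[of "Cut b b'" b b', simplified] by auto
        then show ?thesis
        proof (elim disjE)
          assume "p = Pos a m \<and> q = Pos a' m \<and> m \<in> pos_atoms (ty a)"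
          then show ?thesis using ne unfolding mvT by (intro exI[of _ "Pos a m"] exI[of _ "Pos c (Lft # m)"]) auto
        next
          assume "p = Pos a' m \<and> q = Pos a m \<and> m \<in> neg_atoms (ty a)"
          then show ?thesis using ne unfolding mvT by (intro exI[of _ "Pos c (Lft # m)"] exI[of _ "Pos a m"]) auto
        next
          assume "p = Pos b m \<and> q = Pos b' m \<and> m \<in> pos_atoms (ty b)"
          then show ?thesis using ne unfolding mvT by (intro exI[of _ "Pos b m"] exI[of _ "Pos c (Rgt # m)"]) auto
        next
          assume "p = Pos b' m \<and> q = Pos b m \<and> m \<in> neg_atoms (ty b)"
          then show ?thesis using ne unfolding mvT by (intro exI[of _ "Pos c (Rgt # m)"] exI[of _ "Pos b m"]) auto
        qed
      qed
      ultimately show ?thesis by blast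
    qed
    also have "\<dots> = net_rules {#({}, Cut a a'), ({}, Cut b b')#}"
    proof -
      have "net_rules {#({}, Cut a a'), ({}, Cut b b')#} =
          Pair {} ` link_rules (Cut a a') \<union> Pair {} ` link_rules (Cut b b')"
        using net_rules_Un[of "{#({}, Cut b b')#}" "{#({}, Cut a a')#}"] by (simp add: net_rules_single Un_commute)
      then show ?thesis using link_rules_move[of "Cut a a'"] link_rules_move[of "Cut b b'"] by auto
    qed
    finally show ?thesis .
  qed
  finally show ?thesis
    unfolding net_rules_Un net_births_Un net_bb_Un by (simp add: net_births_def net_bb_def)
qed

section \<open>Renaming edges throughout a net\<close>

fun relabel :: "(edge \<Rightarrow> edge) \<Rightarrow> pos \<Rightarrow> pos" where
  "relabel r (Pos e m) = Pos (r e) m"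
| "relabel r (Lock e i) = Lock (r e) i"

abbreviation relabel_flat ::
  "(edge \<Rightarrow> edge) \<Rightarrow> (edge set \<times> edge link) multiset \<Rightarrow> (edge set \<times> edge link) multiset" where
  "relabel_flat r F \<equiv> image_mset (\<lambda>(G, l). (r ` G, map_link r l)) F"

lemma move_map_link:
  assumes ty: "\<And>a. ty (r a) = ty a"
  shows "move (map_link r l) p q \<longleftrightarrow> (\<exists>p' q'. move l p' q' \<and> p = relabel r p' \<and> q = relabel r q')"
  (is "_ \<longleftrightarrow> ?R")
proof
  assume "\<exists>p' q'. move l p' q' \<and> p = relabel r p' \<and> q = relabel r q'"
  then obtain p' q' where *: "move l p' q'" "p = relabel r p'" "q = relabel r q'" by blast
  from *(1) show "move (map_link r l) p q"
    unfolding *(2,3) by cases (auto simp: ty intro: move.intros)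
next
  assume a: "move (map_link r l) p q"
  have binary: ?R if l: "l \<in> {Tens e f g, Par e f g}" for e f g
  proof -
    have l': "map_link r l \<in> {Tens (r e) (r f) (r g), Par (r e) (r f) (r g)}" using l by auto
    from a have "\<exists>m. p = Pos (r e) m \<and> q = Pos (r g) (Lft # m) \<and> m \<in> pos_atoms (ty e) \<or>
      p = Pos (r f) m \<and> q = Pos (r g) (Rgt # m) \<and> m \<in> pos_atoms (ty f) \<or>
      p = Pos (r g) (Lft # m) \<and> q = Pos (r e) m \<and> m \<in> neg_atoms (ty e) \<or>
      p = Pos (r g) (Rgt # m) \<and> q = Pos (r f) m \<and> m \<in> neg_atoms (ty f)"
      unfolding move_binary[OF l'] ty .
    then show ?thesis
    proof (elim exE disjE)
      fix m assume "p = Pos (r e) m \<and> q = Pos (r g) (Lft # m) \<and> m \<in> pos_atoms (ty e)"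
      then show ?thesis by (intro exI[of _ "Pos e m"] exI[of _ "Pos g (Lft # m)"]) (auto simp: move_binary[OF l])
    next
      fix m assume "p = Pos (r f) m \<and> q = Pos (r g) (Rgt # m) \<and> m \<in> pos_atoms (ty f)"
      then show ?thesis by (intro exI[of _ "Pos f m"] exI[of _ "Pos g (Rgt # m)"]) (auto simp: move_binary[OF l])
    next
      fix m assume "p = Pos (r g) (Lft # m) \<and> q = Pos (r e) m \<and> m \<in> neg_atoms (ty e)"
      then show ?thesis by (intro exI[of _ "Pos g (Lft # m)"] exI[of _ "Pos e m"]) (auto simp: move_binary[OF l])
    next
      fix m assume "p = Pos (r g) (Rgt # m) \<and> q = Pos (r f) m \<and> m \<in> neg_atoms (ty f)"
      then show ?thesis by (intro exI[of _ "Pos g (Rgt # m)"] exI[of _ "Pos f m"]) (auto simp: move_binary[OF l])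
    qed
  qed
  show ?R
  proof (cases l)
    case (Ax e f)
    then obtain m where "p = Pos (r e) m \<and> q = Pos (r f) m \<and> m \<in> neg_atoms (ty e) \<or>
        p = Pos (r f) m \<and> q = Pos (r e) m \<and> m \<in> neg_atoms (ty f)"
      using a move_Ax[of "Ax (r e) (r f)" "r e" "r f" p q] ty by auto
    then show ?thesis unfolding Ax by (metis move.intros(1,2) relabel.simps(1))
  next
    case (Cut e f)
    then obtain m where "p = Pos (r e) m \<and> q = Pos (r f) m \<and> m \<in> pos_atoms (ty e) \<or>
        p = Pos (r f) m \<and> q = Pos (r e) m \<and> m \<in> pos_atoms (ty f)"
      using a move_Cut[of "Cut (r e) (r f)" "r e" "r f" p q] ty by auto
    then show ?thesis unfolding Cut by (metis move.intros(3,4) relabel.simps(1))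
  next
    case (Tens e f g)
    then show ?thesis by (intro binary[of e f g]) simp
  next
    case (Par e f g)
    then show ?thesis by (intro binary[of e f g]) simp
  next
    case (Bot e C)
    then have "p = relabel r (Pos e [])" "q = relabel r (Lock e 0)" using a by (auto elim: move.cases)
    then show ?thesis unfolding Bot using move.intros(9) by blast
  qed (use a in \<open>auto elim: move.cases\<close>)
qed

lemma sync_arcs_map:
  assumes ty: "\<And>a. ty (r a) = ty a"
  shows "sync_arcs (map (map_prod r r) xs) = map_prod (relabel r) (relabel r) ` sync_arcs xs"
proof (induction xs)
  case (Cons x xs)
  obtain p c where x: "x = (p, c)" by (cases x)
  have "pair_arcs (r p) (r c) = map_prod (relabel r) (relabel r) ` pair_arcs p c"
    unfolding pair_arcs_def by (simp add: ty image_image)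
  then show ?case unfolding x using Cons by (simp add: sync_arcs_Cons image_Un)
qed (simp add: sync_arcs_alt)

lemma link_rules_map:
  assumes ty: "\<And>a. ty (r a) = ty a"
  shows "link_rules (map_link r l) = (\<lambda>A. map_prod (relabel r) (relabel r) ` A) ` link_rules l"
proof (cases "\<exists>xs. l = Sync xs")
  case True
  then obtain xs where "l = Sync xs" by blast
  then show ?thesis using sync_arcs_map[OF ty, of xs] by (simp add: link_rules_Sync)
next
  case False
  then have "link_rules l = (\<lambda>x. {x}) ` {(p, q). move l p q}"
    unfolding link_rules_def by auto
  moreover have "map_link r l \<noteq> Sync xs" for xs using False by (cases l) auto
  then have "link_rules (map_link r l) = (\<lambda>x. {x}) ` {(p, q). move (map_link r l) p q}"
    unfolding link_rules_def by auto
  moreover have "{(p, q). move (map_link r l) p q} = map_prod (relabel r) (relabel r) ` {(p, q). move l p q}"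
    using move_map_link[OF ty, of l] by force
  ultimately show ?thesis by (simp add: image_image)
qed

lemma guard_relabel: "guard (r ` G) = relabel r ` guard G"
  unfolding guard_def by (simp add: image_image)

lemma net_rules_relabel:
  assumes ty: "\<And>a. ty (r a) = ty a"
  shows "net_rules (relabel_flat r F) = push_rules (relabel r) (net_rules F)"
proof (induction F)
  case (add x F)
  obtain G l where x: "x = (G, l)" by (cases x)
  have "net_rules {#(r ` G, map_link r l)#} = push_rules (relabel r) (net_rules {#(G, l)#})"
    unfolding net_rules_single link_rules_map[OF ty] guard_relabel push_rules_def by (simp add: image_image)
  then show ?case
    using add net_rules_Un[of "{#(r ` G, map_link r l)#}" "relabel_flat r F"] net_rules_Un[of "{#(G, l)#}" F]
    unfolding x by (simp add: push_rules_Un)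
qed (simp add: net_rules_def push_rules_def)

lemma net_births_relabel: "net_births (relabel_flat r F) = push_births (relabel r) (net_births F)"
proof (induction F)
  case (add x F)
  obtain G l where x: "x = (G, l)" by (cases x)
  have "net_births {#(r ` G, map_link r l)#} = push_births (relabel r) (net_births {#(G, l)#})"
    unfolding net_births_single guard_relabel push_births_def by (cases l) auto
  then show ?case
    using add net_births_Un[of "{#(r ` G, map_link r l)#}" "relabel_flat r F"] net_births_Un[of "{#(G, l)#}" F]
    unfolding x by (simp add: push_births_Un)
qed (simp add: net_births_def push_births_def)

lemma net_bb_relabel: "net_bb (relabel_flat r F) = relabel r ` net_bb F"
proof (induction F)
  case (add x F)
  obtain G l where x: "x = (G, l)" by (cases x)
  have "net_bb {#(r ` G, map_link r l)#} = relabel r ` net_bb {#(G, l)#}"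
    unfolding net_bb_single by (cases l) auto
  then show ?case
    using add net_bb_Un[of "{#(r ` G, map_link r l)#}" "relabel_flat r F"] net_bb_Un[of "{#(G, l)#}" F]
    unfolding x by (simp add: image_Un)
qed (simp add: net_bb_def)

lemma push_rules_comp: "push_rules (f \<circ> g) H = push_rules f (push_rules g H)"
  unfolding push_rules_def image_image
  by (intro image_cong) (auto simp: image_comp map_prod.comp comp_def)

lemma push_births_comp: "push_births (f \<circ> g) B = push_births f (push_births g B)"
  unfolding push_births_def image_image by (intro image_cong) (auto simp: image_comp comp_def)

lemma moves_net_rulesE:
  assumes "(p, q) \<in> moves (net_rules F)"
  obtains G l A where "(G, l) \<in># F" "A \<in> link_rules l" "(p, q) \<in> A"
  using assms unfolding moves_net_rules by (elim exE conjE)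

text \<open>The edges \<open>e\<close>, \<open>f\<close> and \<open>g\<close> collapse to
  \<open>e\<close>. The edge \<open>g\<close> belongs partly to the context and may even be the lock
  of a box, occurring in guards, so a local contraction does not suffice. Hence
  \<open>\<phi>\<close> contracts \<open>f\<close> and then applies the very renaming that the rule
  performs, locks included.\<close>

lemma ax_cut_behaviour:
  assumes F: "flat_net ({#({}, x), ({}, k)#} + FG) K"
    and x: "x \<in> {Ax e f, Ax f e}" and k: "k \<in> {Cut f g, Cut g f}"
  shows "flat_behaviour ({#({}, x), ({}, k)#} + FG) K =
    flat_behaviour (relabel_flat (\<lambda>a. if a = g then e else a) FG) K"
proof -
  let ?F1 = "{#({}, x), ({}, k)#} :: (edge set \<times> edge link) multiset"
  define r where "r = (\<lambda>a. if a = g then e else a)"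
  define \<phi> where "\<phi> = relabel r \<circ> rename_pos f g"
  interpret flat_net_locale "?F1 + FG" K using F by unfold_locales
  have ends: "prems x = {#}" "concls x = {#e, f#}" "prems k = {#f, g#}" "concls k = {#}" using x k by auto
  have "typed x" "typed k" using mem_typed[of "{}" x] mem_typed[of "{}" k] by simp_all
  then have "ty f = dual (ty e)" "ty g = dual (ty f)" using x k by auto
  then have ty: "ty f = dual (ty e)" "ty g = ty e" by simp_all
  have ne: "e \<noteq> f" "f \<noteq> g"
    using distinct_concls[OF F, of "[e, f]" "fconcls FG"] distinct_prems[OF F, of "[f, g]" "fprems FG"] ends by auto
  have r: "ty (r a) = ty a" "r e = e" "r g = e" for a unfolding r_def using ty by auto
  have r_other: "r a = a" if "a \<noteq> g" for a unfolding r_def using that by simp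
  have f: "f \<notin># fprems FG" "f \<notin># fconcls FG" "f \<notin># K"
    using internal_edge[of ?F1 FG f] ends by auto
  have gK: "g \<notin># K" using not_prem_conclusion[of g "{}" k] ends by auto
  have phi: "\<phi> (Pos a m) = (if a = f then Pos e m else Pos (r a) m)" "\<phi> (Lock a i) = Lock (r a) i" for a m i
    unfolding \<phi>_def using r by auto
  have mx: "(p, q) \<in> moves (net_rules ?F1)" if "move x p q \<or> move k p q" for p q
    using that move_in_moves[of "{}" x ?F1 p q] move_in_moves[of "{}" k ?F1 p q] by auto
  have fe: "(Pos f m, Pos e m) \<in> moves (net_rules ?F1)" "(Pos g m, Pos f m) \<in> moves (net_rules ?F1)" if "m \<in> pos_atoms (ty e)" for m
  proof -
    have "m \<in> neg_atoms (ty f)" "m \<in> pos_atoms (ty g)" using that ty by simp_all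
    then have "move x (Pos f m) (Pos e m)" "move k (Pos g m) (Pos f m)" using x k by (auto intro: move.intros(1-4))
    then show "(Pos f m, Pos e m) \<in> moves (net_rules ?F1)" "(Pos g m, Pos f m) \<in> moves (net_rules ?F1)"
      by (simp_all add: mx)
  qed
  have ef: "(Pos e m, Pos f m) \<in> moves (net_rules ?F1)" "(Pos f m, Pos g m) \<in> moves (net_rules ?F1)" if "m \<in> neg_atoms (ty e)" for m
  proof -
    have "m \<in> pos_atoms (ty f)" using that ty by simp
    then have "move x (Pos e m) (Pos f m)" "move k (Pos f m) (Pos g m)" using x k that by (auto intro: move.intros(1-4))
    then show "(Pos e m, Pos f m) \<in> moves (net_rules ?F1)" "(Pos f m, Pos g m) \<in> moves (net_rules ?F1)"
      by (simp_all add: mx)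
  qed
  have point: "(Pos a m, \<phi> (Pos a m)) \<in> (moves (net_rules ?F1))\<^sup>* \<or> (\<phi> (Pos a m), Pos a m) \<in> (moves (net_rules ?F1))\<^sup>*"
    if m: "m \<in> atoms (ty a)" for a m
  proof -
    consider "a \<noteq> f" "a \<noteq> g" | "a = f" | "a = g" by blast
    then show ?thesis
    proof cases
      case 1
      then show ?thesis using phi r_other by simp
    next
      case 2
      then have "m \<in> pos_atoms (ty e) \<or> m \<in> neg_atoms (ty e)" using m ty by auto
      then show ?thesis using fe(1) ef(1) 2 phi by auto
    next
      case 3
      then have "m \<in> pos_atoms (ty e) \<or> m \<in> neg_atoms (ty e)" using m ty by auto
      then show ?thesis
      proof
        assume "m \<in> pos_atoms (ty e)"
        from fe[OF this] show ?thesis using 3 phi ne r by (auto intro: rtrancl_trans)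
      next
        assume "m \<in> neg_atoms (ty e)"
        from ef[OF this] show ?thesis using 3 phi ne r by (auto intro: rtrancl_trans)
      qed
    qed
  qed
  \<comment> \<open>Renaming \<open>Lock g 0\<close> to \<open>Lock e 0\<close> must not merge two
    locks. It does not, as \<open>e\<close> is concluded by the axiom and thus by no bot
    link.\<close>
  have no_e_lock: "Lock e 0 \<notin> carrier (?F1 + FG)"
  proof
    assume "Lock e 0 \<in> carrier (?F1 + FG)"
    then obtain G where G: "(G, Bot e {#}) \<in># ?F1 + FG" unfolding carrier_def net_bb_def by blast
    then have "(G, Bot e {#}) \<in># FG" using x k by auto
    then show False using concl_unique[OF refl, of "({}, x)" "(G, Bot e {#})" e] ends by auto
  qed
  have "flat_behaviour (?F1 + FG) K = behaviour (net_init K) (push_births \<phi> (net_births (?F1 + FG)))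
    (push_rules \<phi> (net_rules FG)) (net_fin K) (\<phi> ` net_bb (?F1 + FG))"
  proof (rule contract[OF refl])
    fix p q assume pq: "(p, q) \<in> moves (net_rules ?F1)"
    then obtain G l A where l: "(G, l) \<in># ?F1" "A \<in> link_rules l" "(p, q) \<in> A"
      by (rule moves_net_rulesE)
    have "l = x \<or> l = k" using l(1) by auto
    then have "move x p q \<or> move k p q" using l x k unfolding link_rules_def by auto
    moreover have "\<phi> (Pos e m) = Pos e m" "\<phi> (Pos f m) = Pos e m" "\<phi> (Pos g m) = Pos e m" for m
      using ne r(2,3) by (simp_all add: phi)
    ultimately show "\<phi> p = \<phi> q" unfolding move_Ax[OF x] move_Cut[OF k] by auto
    show "q \<in> rch" if "p \<in> rch"
      by (rule wire_fires[OF refl _ pq that]) (use x k in auto)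
  next
    fix a m assume "a \<in># K"
    then have "a \<noteq> f" "a \<noteq> g" using f gK by auto
    then show "\<phi> (Pos a m) = Pos a m" using phi r_other by simp
  next
    fix p p' assume p: "p \<in> carrier (?F1 + FG)" "p' \<in> carrier (?F1 + FG)" "\<phi> p = \<phi> p'"
    have cases: "(\<exists>a m. y = Pos a m \<and> m \<in> atoms (ty a)) \<or> (\<exists>a. y = Lock a 0)" if "y \<in> carrier (?F1 + FG)" for y
      using that unfolding carrier_def net_bb_def by blast
    show "(p, p') \<in> (moves (net_rules ?F1))\<^sup>* \<or> (p', p) \<in> (moves (net_rules ?F1))\<^sup>*"
    proof (cases "\<exists>a m. p = Pos a m \<and> m \<in> atoms (ty a)")
      case True
      then obtain a m where a: "p = Pos a m" "m \<in> atoms (ty a)" by blast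
      then have "\<nexists>b i. p' = Lock b i" using p(3) phi by (auto split: if_splits)
      then obtain b m' where b: "p' = Pos b m'" "m' \<in> atoms (ty b)" using cases[OF p(2)] by blast
      show ?thesis
        using comparable_via[OF sub_moves_single_valued[OF refl] point[OF a(2)], of "Pos b m'"] point[OF b(2)] p(3) a b by simp
    next
      case False
      then obtain a where a: "p = Lock a 0" using cases[OF p(1)] by blast
      then obtain b where b: "p' = Lock b 0" using cases[OF p(2)] p(3) phi by (metis pos.distinct(1))
      have "a \<noteq> e" "b \<noteq> e" using a b p no_e_lock by auto
      then have "a = b" using p(3) a b phi unfolding r_def by (auto split: if_splits)
      then show ?thesis using a b by simp
    qed
  qed
  also have "push_births \<phi> (net_births (?F1 + FG)) = net_births (relabel_flat r FG)"
  proof -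
    have "net_births (?F1 + FG) = net_births FG" using x k unfolding net_births_def by auto
    moreover have "push_births (rename_pos f g) (net_births FG) = net_births FG"
      by (rule push_births_fixed) (use f in auto)
    ultimately show ?thesis unfolding \<phi>_def push_births_comp net_births_relabel by simp
  qed
  also have "push_rules \<phi> (net_rules FG) = net_rules (relabel_flat r FG)"
  proof -
    have "push_rules (rename_pos f g) (net_rules FG) = net_rules FG"
    proof (rule push_rules_fixed)
      show "typed l" if "(G, l) \<in># FG" for G l using that mem_typed by auto
    qed (use f in auto)
    then show ?thesis unfolding \<phi>_def push_rules_comp net_rules_relabel[OF r(1)] by simp
  qed
  also have "\<phi> ` net_bb (?F1 + FG) = net_bb (relabel_flat r FG)"
  proof -
    have "net_bb (?F1 + FG) = net_bb FG" using x k unfolding net_bb_def by auto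
    moreover have "rename_pos f g ` net_bb FG = net_bb FG" by (rule image_bb_fixed) simp
    ultimately show ?thesis unfolding \<phi>_def net_bb_relabel image_comp[symmetric] by simp
  qed
  finally show ?thesis unfolding r_def .
qed

text \<open>Here the sync itself is contracted. This is sound since all its inputs are births
  without guards, hence reachable, so it always fires. The births are pushed through it and become
  those of the new one links.\<close>

lemma sync_one_behaviour:
  assumes F: "flat_net ({#({}, Sync xs)#} + mset (map (\<lambda>(p, c). ({}, One p)) xs) + FG) K"
  shows "flat_behaviour ({#({}, Sync xs)#} + mset (map (\<lambda>(p, c). ({}, One p)) xs) + FG) K =
    flat_behaviour (mset (map (\<lambda>(p, c). ({}, One c)) xs) + FG) K"
proof -
  let ?F1 = "{#({}, Sync xs)#} :: (edge set \<times> edge link) multiset"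
  let ?O = "mset (map (\<lambda>(p, c). ({}, One p)) xs) :: (edge set \<times> edge link) multiset"
  let ?O' = "mset (map (\<lambda>(p, c). ({}, One c)) xs) :: (edge set \<times> edge link) multiset"
  interpret flat_net_locale "?F1 + ?O + FG" K using F by unfold_locales
  have F2: "?F1 + ?O + FG = ?F1 + (?O + FG)" by simp
  have one: "fprems (mset (map (\<lambda>(p, c). ({}, One p)) ys)) = {#}"
    "fconcls (mset (map (\<lambda>(p, c). ({}, One p)) ys)) = mset (map fst ys)" for ys :: "(edge \<times> edge) list"
    by (induction ys) auto
  have "distinct (map snd xs @ map fst xs)"
    by (rule distinct_concls[OF F, of _ "fconcls FG"]) (simp add: one del: mset_map)
  then have dist: "distinct (map fst xs)" "distinct (map snd xs)" "set (map snd xs) \<inter> set (map fst xs) = {}" by auto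
  have unit: "ty p = UnitF \<and> ty c = UnitF" if "(p, c) \<in> set xs" for p c
  proof -
    have "({}, One p) \<in># ?O" using that by force
    then have "typed (One p)" using mem_typed[of "{}" "One p"] by simp
    moreover have "typed (Sync xs)" using mem_typed[of "{}" "Sync xs"] by simp
    ultimately show ?thesis using that by auto
  qed
  \<comment> \<open>The formula \<open>1\<close> is positive, so no pair is reversed.\<close>
  have arcs: "arcs xs = xs" unfolding arcs_def
  proof (rule map_idI)
    fix x assume "x \<in> set xs"
    then show "(case x of (p, c) \<Rightarrow> if positive (ty p) then (p, c) else (c, p)) = x"
      using unit[of "fst x" "snd x"] by (simp add: split_beta)
  qed
  let ?\<phi> = "cross xs"
  have phi1: "?\<phi> (Pos p m) = Pos c m" if "(p, c) \<in> set xs" for p c m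
    using that dist(1) arcs by simp
  have phi2: "?\<phi> (Pos a m) = Pos a m" if "a \<notin> fst ` set xs" for a m
    using that arcs by (simp add: map_of_eq_None_iff[symmetric])
  have snd_fst: "c \<notin> fst ` set xs" if "(p, c) \<in> set xs" for p c
    using that dist(3) by force
  have sa: "sync_arcs xs = {(Pos p [], Pos c []) | p c. (p, c) \<in> set xs}"
    unfolding sync_arcs_def arcs using unit by fastforce
  have mv1: "moves (net_rules ?F1) = sync_arcs xs"
    by (simp add: net_rules_single link_rules_Sync moves_def)
  have fst_fixed: "a \<notin># fprems FG \<and> a \<notin># fconcls FG \<and> a \<notin># K" if "a \<in> fst ` set xs" for a
    using internal_edge[of "?F1 + ?O" FG a] that by (simp add: one del: mset_map)
  have births: "net_births (?F1 + ?O + FG) = {({}, Pos p []) | p c. (p, c) \<in> set xs} \<union> net_births FG"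
    unfolding net_births_Un unfolding net_births_def by force
  have "flat_behaviour (?F1 + ?O + FG) K = behaviour (net_init K) (push_births ?\<phi> (net_births (?F1 + ?O + FG)))
    (push_rules ?\<phi> (net_rules (?O + FG))) (net_fin K) (?\<phi> ` net_bb (?F1 + ?O + FG))"
  proof (rule contract[OF F2])
    fix p q assume pq: "(p, q) \<in> moves (net_rules ?F1)"
    then obtain a c where a: "p = Pos a []" "q = Pos c []" "(a, c) \<in> set xs" unfolding mv1 sa by blast
    then show "?\<phi> p = ?\<phi> q" using phi1 phi2[OF snd_fst[OF a(3)]] by simp
    have "p' \<in> rch" if "(p', q') \<in> sync_arcs xs" for p' q'
    proof -
      from that obtain b c where "p' = Pos b []" "(b, c) \<in> set xs" unfolding sa by blast
      then have "({}, p') \<in> net_births (?F1 + ?O + FG)" unfolding births by blast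
      then show ?thesis by (rule reach_birth) simp
    qed
    moreover have "({}, sync_arcs xs) \<in> net_rules (?F1 + ?O + FG)"
    proof -
      have "({}, Sync xs) \<in># ?F1 + ?O + FG" by simp
      moreover have "sync_arcs xs \<in> link_rules (Sync xs)" by (simp add: link_rules_Sync)
      ultimately have "(guard {}, sync_arcs xs) \<in> net_rules (?F1 + ?O + FG)" unfolding net_rules_def by blast
      then show ?thesis unfolding guard_empty .
    qed
    ultimately show "q \<in> rch" using pq unfolding mv1 by (intro reach_rule[of "{}" "sync_arcs xs" _ _ _ p q]) auto
  next
    fix a m assume "a \<in># K"
    then show "?\<phi> (Pos a m) = Pos a m" using fst_fixed phi2 by blast
  next
    fix p p' assume p: "p \<in> carrier (?F1 + ?O + FG)" "p' \<in> carrier (?F1 + ?O + FG)" "?\<phi> p = ?\<phi> p'"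
    have point: "(y, ?\<phi> y) \<in> (moves (net_rules ?F1))\<^sup>* \<or> (?\<phi> y, y) \<in> (moves (net_rules ?F1))\<^sup>*"
      if "y \<in> carrier (?F1 + ?O + FG)" for y
    proof -
      from that consider a m where "y = Pos a m" "m \<in> atoms (ty a)" | a where "y = Lock a 0"
        unfolding carrier_def net_bb_def by blast
      then show ?thesis
      proof cases
        case 1
        show ?thesis
        proof (cases "a \<in> fst ` set xs")
          case True
          then obtain c where c: "(a, c) \<in> set xs" by force
          then have "m = []" using 1(2) unit by auto
          then have "(y, ?\<phi> y) \<in> moves (net_rules ?F1)" unfolding mv1 sa 1(1) phi1[OF c] using c by blast
          then show ?thesis by blast
        next
          case False
          then show ?thesis using phi2 1(1) by simp
        qed
      qed simp
    qed
    show "(p, p') \<in> (moves (net_rules ?F1))\<^sup>* \<or> (p', p) \<in> (moves (net_rules ?F1))\<^sup>*"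
      using comparable_via[OF sub_moves_single_valued[OF F2] point[OF p(1)]] point[OF p(2)] p(3) by simp
  qed
  also have "push_births ?\<phi> (net_births (?F1 + ?O + FG)) = net_births (?O' + FG)"
  proof -
    have "push_births ?\<phi> {({}, Pos p []) | p c. (p, c) \<in> set xs} = {({}, Pos c []) | p c. (p, c) \<in> set xs}"
    proof (intro equalityI subsetI)
      fix y assume "y \<in> push_births ?\<phi> {({}, Pos p []) | p c. (p, c) \<in> set xs}"
      then obtain p c where "(p, c) \<in> set xs" "y = ({}, ?\<phi> (Pos p []))" unfolding push_births_def by force
      then show "y \<in> {({}, Pos c []) | p c. (p, c) \<in> set xs}" using phi1 by blast
    next
      fix y :: "pos birth" assume "y \<in> {({}, Pos c []) | p c. (p, c) \<in> set xs}"
      then obtain p c where pc: "(p, c) \<in> set xs" "y = ({}, Pos c [])" by blast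
      have eq: "y = ({}, ?\<phi> (Pos p []))" using pc(2) phi1[OF pc(1)] by simp
      show "y \<in> push_births ?\<phi> {({}, Pos p []) | p c. (p, c) \<in> set xs}"
        unfolding eq push_births_iff
        by (rule exI[of _ "{}"], rule exI[of _ "Pos p []"]) (use pc(1) in blast)
    qed
    moreover have "push_births ?\<phi> (net_births FG) = net_births FG"
    proof (rule push_births_fixed)
      show "?\<phi> (Pos a m) = Pos a m" if "a \<in># fconcls FG" for a m using phi2 fst_fixed that by blast
    qed simp
    moreover have "net_births (?O' + FG) = {({}, Pos c []) | p c. (p, c) \<in> set xs} \<union> net_births FG"
      unfolding net_births_Un unfolding net_births_def by force
    ultimately show ?thesis unfolding births push_births_Un by simp
  qed
  also have "push_rules ?\<phi> (net_rules (?O + FG)) = net_rules (?O' + FG)"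
  proof -
    have "link_rules (One a) = {}" for a unfolding link_rules_def by (auto elim: move.cases)
    then have "net_rules ?O = {}" "net_rules ?O' = {}" unfolding net_rules_def by auto
    moreover have "push_rules ?\<phi> (net_rules FG) = net_rules FG"
    proof (rule push_rules_fixed)
      show "typed l" if "(G, l) \<in># FG" for G l using that mem_typed[of G l] by simp
      show "?\<phi> (Pos a m) = Pos a m" if "a \<in># fprems FG \<or> a \<in># fconcls FG" for a m using phi2 fst_fixed that by blast
    qed simp
    ultimately show ?thesis unfolding net_rules_Un by simp
  qed
  also have "?\<phi> ` net_bb (?F1 + ?O + FG) = net_bb (?O' + FG)"
  proof -
    have "?\<phi> ` net_bb (?F1 + ?O + FG) = net_bb (?F1 + ?O + FG)" by (rule image_bb_fixed) simp
    also have "\<dots> = net_bb (?O' + FG)" unfolding net_bb_Un unfolding net_bb_def by auto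
    finally show ?thesis .
  qed
  finally show ?thesis .
qed

text \<open>Erasing \<open>?D\<close> also deletes \<open>Lock e 0\<close> from all guards. Since
  \<open>e\<close> occurs in no guard of \<open>FC\<close>, this turns \<open>insert e G\<close>
  back into exactly \<open>G\<close> for the links of the box, and since it occurs in none of
  \<open>FG\<close>, the context is unchanged.\<close>

lemma open_box_behaviour:
  assumes F: "flat_net ({#({}, Bot e {#}), ({}, One f), ({}, k)#} + image_mset (\<lambda>(G, l). (insert e G, l)) FC + FG) K"
    and k: "k \<in> {Cut e f, Cut f e}"
    and eC: "\<And>G l. (G, l) \<in># FC \<Longrightarrow> e \<notin> G" and eG: "\<And>G l. (G, l) \<in># FG \<Longrightarrow> e \<notin> G"
  shows "flat_behaviour ({#({}, Bot e {#}), ({}, One f), ({}, k)#} + image_mset (\<lambda>(G, l). (insert e G, l)) FC + FG) K =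
    flat_behaviour (FC + FG) K"
proof -
  let ?FK = "{#({}, Bot e {#}), ({}, One f), ({}, k)#} :: (edge set \<times> edge link) multiset"
  let ?FH = "image_mset (\<lambda>(G, l). (insert e G, l)) FC + FG"
  let ?D = "{Pos f [], Pos e [], Lock e 0}"
  have F': "flat_net (?FK + ?FH) K" using F by (simp add: add.assoc)
  interpret flat_net_locale "?FK + ?FH" K using F' by unfold_locales
  have ends: "prems k = {#e, f#}" "concls k = {#}" using k by auto
  have ty: "ty e = BotF" "ty f = UnitF" using F unfolding flat_net_def by auto
  have int: "a \<notin># fprems ?FH \<and> a \<notin># fconcls ?FH \<and> a \<notin># K" if "a \<in> {e, f}" for a
    using internal_edge[of ?FK ?FH a] that ends by auto
  have mvK: "(p, q) \<in> moves (net_rules ?FK) \<longleftrightarrow> p = Pos e [] \<and> q = Lock e 0 \<or> p = Pos f [] \<and> q = Pos e []" for p q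
  proof
    assume "(p, q) \<in> moves (net_rules ?FK)"
    then obtain G l A where l: "(G, l) \<in># ?FK" "A \<in> link_rules l" "(p, q) \<in> A" by (rule moves_net_rulesE)
    then have "move (Bot e {#}) p q \<or> move (One f) p q \<or> move k p q" using k unfolding link_rules_def by auto
    then show "p = Pos e [] \<and> q = Lock e 0 \<or> p = Pos f [] \<and> q = Pos e []"
      using ty unfolding move_Cut[OF k] by (auto elim: move.cases)
  next
    assume "p = Pos e [] \<and> q = Lock e 0 \<or> p = Pos f [] \<and> q = Pos e []"
    then have "move (Bot e {#}) p q \<or> move k p q" using ty unfolding move_Cut[OF k] by (auto intro: move.intros)
    then show "(p, q) \<in> moves (net_rules ?FK)"
      using move_in_moves[of "{}" "Bot e {#}" ?FK p q] move_in_moves[of "{}" k ?FK p q] by auto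
  qed
  have mvH: "p \<notin> ?D \<and> q \<notin> ?D" if "(p, q) \<in> moves (net_rules ?FH)" for p q
  proof -
    from that obtain G l A where l: "(G, l) \<in># ?FH" "A \<in> link_rules l" "(p, q) \<in> A" by (rule moves_net_rulesE)
    have "typed l" using mem_typed[of G l] l(1) by simp
    then have le: "leaves l p" "enters l q" using link_rule_ends[OF l(2) _ l(3)] by auto
    have no: "a \<notin># prems l" "a \<notin># concls l" if "a \<in> {e, f}" for a
      using int[OF that] prems_le_fprems[OF l(1)] concls_le_fconcls[OF l(1)] by (auto dest: mset_subset_eqD)
    have "l \<noteq> Bot e C" for C using no(2)[of e] by auto
    then show ?thesis using le no[of e] no[of f] unfolding leaves_def enters_def by auto
  qed
  have eq: "net_rules (?FK + ?FH) = net_rules ?FK \<union> net_rules ?FH" by (rule net_rules_Un)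
  have step: "q \<in> rch" if "move l p q" "p \<in> rch" "({}, l) \<in># ?FK" for l p q
  proof -
    have "({}, l) \<in># ?FK + ?FH" using that(3) unfolding union_iff by blast
    moreover have "{(p, q)} \<in> link_rules l" using that(1) unfolding link_rules_def by blast
    ultimately have "(guard {}, {(p, q)}) \<in> net_rules (?FK + ?FH)" unfolding net_rules_def by blast
    then show ?thesis by (rule reach_rule[where p = p]) (use that(2) in auto)
  qed
  have f_rch: "Pos f [] \<in> rch"
  proof (rule reach_birth)
    have "({}, One f) \<in># ?FK + ?FH" by simp
    then have "(guard {}, Pos f []) \<in> net_births (?FK + ?FH)" unfolding net_births_def by blast
    then show "({}, Pos f []) \<in> net_births (?FK + ?FH)" unfolding guard_empty .
  qed simp
  have e_rch: "Pos e [] \<in> rch"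
    by (rule step[OF _ f_rch, of k]) (use ty in \<open>auto simp: move_Cut[OF k]\<close>)
  have l_rch: "Lock e 0 \<in> rch"
    by (rule step[OF _ e_rch, of "Bot e {#}"]) (auto intro: move.intros)
  have guard_D: "guard (insert e G) - ?D = guard G" "guard G - ?D = guard G" if "e \<notin> G" for G
    using that unfolding guard_def by auto
  have in_FH: "(insert e G, l) \<in># ?FH" if "(G, l) \<in># FC" for G l
    using imageI[OF that, of "\<lambda>(G, l). (insert e G, l)"] by simp
  have rules: "(\<lambda>(G, A). (G - ?D, A)) ` net_rules ?FH = net_rules (FC + FG)"
  proof (intro equalityI subsetI)
    fix y assume "y \<in> (\<lambda>(G, A). (G - ?D, A)) ` net_rules ?FH"
    then obtain z where "y = (case z of (G, A) \<Rightarrow> (G - ?D, A))" "z \<in> net_rules ?FH" by (rule imageE)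
    then obtain Gp A where "(Gp, A) \<in> net_rules ?FH" "y = (Gp - ?D, A)" by (cases z) simp
    then obtain G l where l: "(G, l) \<in># ?FH" "A \<in> link_rules l" "y = (guard G - ?D, A)"
      unfolding net_rules_def by blast
    then consider G' where "(G', l) \<in># FC" "G = insert e G'" | "(G, l) \<in># FG" by auto
    then show "y \<in> net_rules (FC + FG)"
    proof cases
      case 1
      then have "y = (guard G', A)" using l(3) guard_D(1)[OF eC[OF 1(1)]] by simp
      then show ?thesis using 1 l(2) unfolding net_rules_def by auto
    next
      case 2
      then have "y = (guard G, A)" using l(3) guard_D(2)[OF eG[OF 2]] by simp
      then show ?thesis using 2 l(2) unfolding net_rules_def by auto
    qed
  next
    fix y assume "y \<in> net_rules (FC + FG)"
    then obtain G l A where l: "(G, l) \<in># FC \<or> (G, l) \<in># FG" "A \<in> link_rules l" "y = (guard G, A)" unfolding net_rules_def by auto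
    from l(1) show "y \<in> (\<lambda>(G, A). (G - ?D, A)) ` net_rules ?FH"
    proof
      assume C: "(G, l) \<in># FC"
      then have "(insert e G, l) \<in># ?FH" by (rule in_FH)
      then have "(guard (insert e G), A) \<in> net_rules ?FH" using l(2) unfolding net_rules_def by blast
      then show ?thesis unfolding l(3) guard_D(1)[OF eC[OF C], symmetric]
        by (rule rev_image_eqI) simp
    next
      assume C: "(G, l) \<in># FG"
      then have "(G, l) \<in># ?FH" by simp
      then have "(guard G, A) \<in> net_rules ?FH" using l(2) unfolding net_rules_def by blast
      then show ?thesis unfolding l(3)
        by (rule rev_image_eqI) (simp add: guard_D(2)[OF eG[OF C]])
    qed
  qed
  have births: "net_births (FC + FG) = {(G - ?D, p) | G p. (G, p) \<in> net_births (?FK + ?FH) \<and> p \<notin> ?D}"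
  proof (intro equalityI subsetI)
    fix y assume "y \<in> net_births (FC + FG)"
    then obtain G a where a: "(G, One a) \<in># FC \<or> (G, One a) \<in># FG" "y = (guard G, Pos a [])" unfolding net_births_def by auto
    from a(1) obtain G' where G': "(G', One a) \<in># ?FH" "guard G' - ?D = guard G"
    proof
      assume C: "(G, One a) \<in># FC"
      then have "(insert e G, One a) \<in># ?FH" by (rule in_FH)
      then show ?thesis using that guard_D(1)[OF eC[OF C]] by blast
    next
      assume C: "(G, One a) \<in># FG"
      then have "(G, One a) \<in># ?FH" by simp
      then show ?thesis using that guard_D(2)[OF eG[OF C]] by blast
    qed
    have "a \<in># fconcls ?FH" using concls_le_fconcls[OF G'(1)] by (auto dest: mset_subset_eqD)
    then have "Pos a [] \<notin> ?D" using int[of e] int[of f] by auto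
    moreover have "(G', One a) \<in># ?FK + ?FH" using G'(1) unfolding union_iff[of _ ?FK] by blast
    then have "(guard G', Pos a []) \<in> net_births (?FK + ?FH)" unfolding net_births_def by blast
    ultimately show "y \<in> {(G - ?D, p) | G p. (G, p) \<in> net_births (?FK + ?FH) \<and> p \<notin> ?D}"
      using a(2) G'(2) by blast
  next
    fix y assume "y \<in> {(G - ?D, p) | G p. (G, p) \<in> net_births (?FK + ?FH) \<and> p \<notin> ?D}"
    then obtain G a where a: "(G, One a) \<in># ?FK + ?FH" "Pos a [] \<notin> ?D" "y = (guard G - ?D, Pos a [])"
      unfolding net_births_def by blast
    then have "(G, One a) \<in># ?FH" using k by auto
    then consider G' where "(G', One a) \<in># FC" "G = insert e G'" | "(G, One a) \<in># FG" by auto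
    then show "y \<in> net_births (FC + FG)"
    proof cases
      case 1
      then have "y = (guard G', Pos a [])" using a(3) guard_D(1)[OF eC[OF 1(1)]] by simp
      moreover have "(G', One a) \<in># FC + FG" using 1 by simp
      ultimately show ?thesis unfolding net_births_def by blast
    next
      case 2
      then have "y = (guard G, Pos a [])" using a(3) guard_D(2)[OF eG[OF 2]] by simp
      moreover have "(G, One a) \<in># FC + FG" using 2 by simp
      ultimately show ?thesis unfolding net_births_def by blast
    qed
  qed
  have bb: "net_bb (?FK + ?FH) - ?D = net_bb (FC + FG)"
  proof -
    have "Lock e 0 \<notin> net_bb ?FH"
    proof
      assume "Lock e 0 \<in> net_bb ?FH"
      then obtain G where "(G, Bot e {#}) \<in># ?FH" unfolding net_bb_def by blast
      then have "e \<in># fconcls ?FH" using concls_le_fconcls[of "(G, Bot e {#})" ?FH] by (simp add: mset_subset_eq_insertD)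
      then show False using int[of e] by simp
    qed
    moreover have "net_bb ?FH = net_bb (FC + FG)" unfolding net_bb_Un unfolding net_bb_def by force
    moreover have "net_bb (?FK + ?FH) = insert (Lock e 0) (net_bb ?FH)"
      unfolding net_bb_Un using k unfolding net_bb_def by (cases e) auto
    moreover have "Pos a m \<notin> net_bb ?FH" for a m unfolding net_bb_def by auto
    ultimately show ?thesis by auto
  qed
  have "({}, Bot e {#}) \<in># ?FK + ?FH" by simp
  then have lock_bb: "Lock e 0 \<in> net_bb (?FK + ?FH)" unfolding net_bb_def by blast
  have "behaviour (net_init K) (net_births (?FK + ?FH)) (net_rules ?FK \<union> net_rules ?FH) (net_fin K) (net_bb (?FK + ?FH)) =
    behaviour (net_init K) (net_births (FC + FG)) ((\<lambda>(G, A). (G - ?D, A)) ` net_rules ?FH) (net_fin K) (net_bb (?FK + ?FH) - ?D)"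
  proof (rule behaviour_erase)
    show "?D \<subseteq> reach (net_init K) (net_births (?FK + ?FH)) (net_rules ?FK \<union> net_rules ?FH)"
      using f_rch e_rch l_rch unfolding eq by auto
    show "?D \<inter> net_init K = {}" "?D \<inter> net_fin K = {}" using int[of e] int[of f] unfolding net_init_def net_fin_def by auto
    show "moves (net_rules ?FK) \<subseteq> ?D \<times> ?D"
    proof
      fix z assume "z \<in> moves (net_rules ?FK)"
      then show "z \<in> ?D \<times> ?D" using mvK[of "fst z" "snd z"] by (cases z) auto
    qed
    show "moves (net_rules ?FH) \<inter> (?D \<times> UNIV \<union> UNIV \<times> ?D) = {}" using mvH by blast
    show "d \<in> net_bb (?FK + ?FH) \<or> (\<exists>q\<in>?D. (d, q) \<in> moves (net_rules ?FK))" if "d \<in> ?D" for d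
      using that lock_bb unfolding mvK by blast
  qed (rule births)
  then show ?thesis unfolding rules bb net_rules_Un[of ?FK ?FH, symmetric] by (simp add: add.assoc)
qed

section \<open>Invariance under reduction\<close>

lemma edges_simps [simp]:
  "edges {#} = {#}" "edges (add_mset l R) = link_edges l + edges R" "edges (R + S) = edges R + edges S"
  by (simp_all add: edges_def)

lemma concls_le_link_edges: "concls l \<subseteq># link_edges l"
proof (induction l)
  case (Bot a C)
  have "concls_of C \<subseteq># sum_mset (image_mset link_edges C)"
    using Bot.IH by (induction C) (auto intro: subset_mset.add_mono)
  then have "concls_of C - prems_of C \<subseteq># sum_mset (image_mset link_edges C)"
    using diff_subset_eq_self subset_mset.order_trans by blast
  then show ?case by simp
qed auto

lemma concls_of_le_edges: "concls_of R \<subseteq># edges R"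
  by (induction R) (auto intro: subset_mset.add_mono concls_le_link_edges)

text \<open>\<open>X\<close> and \<open>Y\<close> are the edges internal to the old and the new
  redex; they cancel when premisses are subtracted from conclusions, and \<open>M\<close>,
  \<open>N\<close> are the same on both sides.\<close>

lemma balanced_net_concls:
  assumes "concls_of R = X + M" "prems_of R = X + N" "concls_of S = Y + M" "prems_of S = Y + N"
    and "prems_of R \<subseteq># concls_of R"
  shows "prems_of S \<subseteq># concls_of S" "net_concls S = net_concls R"
  using assms by (simp_all add: net_concls_def)

lemma wf_net_local:
  assumes R: "wf_net R" "concls_of R = X + M" "prems_of R = X + N"
    and S: "concls_of S = Y + M" "prems_of S = Y + N"
    and ok: "\<And>l. l \<in># S \<Longrightarrow> wf_link l" and edges: "\<And>e. count (edges S) e \<le> 1"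
  shows "wf_net S \<and> net_concls S = net_concls R"
  using balanced_net_concls[OF R(2,3) S] R(1) ok edges unfolding wf_net_def by blast+

lemma prems_map_link: "prems (map_link r l) = image_mset r (prems l)"
  by (cases l) (auto simp: multiset.map_comp)

lemma image_sum_mset: "image_mset r (sum_mset M) = sum_mset (image_mset (image_mset r) M)"
  by (induction M) auto

text \<open>The renaming may identify edges, and the conclusions of a box are a multiset difference.
  An image commutes with that difference only because the premisses are contained in the
  conclusions, so both claims have to go through one induction.\<close>

lemma wf_link_map_link:
  assumes ty: "\<And>a. ty (r a) = ty a"
  shows "wf_link l \<Longrightarrow> wf_link (map_link r l) \<and> concls (map_link r l) = image_mset r (concls l)"
proof (induction l)
  case (Bot a C)
  then have C: "\<forall>l \<in># C. wf_link (map_link r l) \<and> concls (map_link r l) = image_mset r (concls l)" by simp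
  have sub: "prems_of C \<subseteq># concls_of C" using Bot.prems by simp
  have P: "prems_of (image_mset (map_link r) C) = image_mset r (prems_of C)"
    by (simp add: image_sum_mset multiset.map_comp comp_def prems_map_link)
  have "image_mset (concls \<circ> map_link r) C = image_mset (image_mset r \<circ> concls) C"
    using C by (intro image_mset_cong) simp
  then have Q: "concls_of (image_mset (map_link r) C) = image_mset r (concls_of C)"
    by (simp add: image_sum_mset multiset.map_comp)
  have "concls (map_link r (Bot a C)) = add_mset (r a) (image_mset r (concls_of C) - image_mset r (prems_of C))"
    using P Q by simp
  also have "\<dots> = image_mset r (concls (Bot a C))" using image_mset_Diff[OF sub, of r] by simp
  finally have "concls (map_link r (Bot a C)) = image_mset r (concls (Bot a C))" .
  moreover have "image_mset r (prems_of C) \<subseteq># image_mset r (concls_of C)" using sub by (rule image_mset_subseteq_mono)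
  then have "wf_link (map_link r (Bot a C))" using C Bot.prems ty unfolding link.map wf_link_Bot P Q by auto
  ultimately show ?case by blast
qed (auto simp: ty multiset.map_comp comp_def split_beta map_prod_def)

lemma link_edges_map_link: "link_edges (map_link r l) = image_mset r (link_edges l)"
proof (induction l)
  case (Bot a C)
  have "image_mset (link_edges \<circ> map_link r) C = image_mset (image_mset r \<circ> link_edges) C"
    using Bot by (intro image_mset_cong) simp
  then show ?case by (simp add: image_sum_mset multiset.map_comp)
qed (auto simp: multiset.map_comp)

lemma image_mset_rename:
  assumes "r = (\<lambda>a. if a = g then e else a)"
  shows "g \<notin># M \<Longrightarrow> image_mset r M = M"
  by (induction M) (auto simp: assms)

text \<open>The renaming acts on the whole context, so \<open>wf_net_local\<close> does not apply
  and the counts are done by hand.\<close>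

lemma wf_net_ax_cut:
  assumes R: "wf_net ({#x, k#} + G)" and x: "x \<in> {Ax e f, Ax f e}" and k: "k \<in> {Cut f g, Cut g f}"
    and r: "r = (\<lambda>a. if a = g then e else a)"
  shows "wf_net (image_mset (map_link r) G) \<and> net_concls (image_mset (map_link r) G) = net_concls ({#x, k#} + G)"
proof -
  let ?R = "{#x, k#} + G" and ?S = "image_mset (map_link r) G"
  have ends: "prems x = {#}" "concls x = {#e, f#}" "link_edges x = {#e, f#}"
    "prems k = {#f, g#}" "concls k = {#}" "link_edges k = {#}"
    using x k by auto
  have typed: "typed x" "typed k" using R x k unfolding wf_net_def by auto
  then have "ty f = dual (ty e)" "ty g = dual (ty f)" using x k by auto
  then have ty: "ty (r a) = ty a" for a unfolding r by simp
  have okG: "\<forall>l \<in># G. wf_link l" using R unfolding wf_net_def by simp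
  then have okS: "\<forall>l \<in># ?S. wf_link l" using wf_link_map_link[of r, OF ty] by auto
  have prems_S: "prems_of ?S = image_mset r (prems_of G)"
    by (simp add: image_sum_mset multiset.map_comp comp_def prems_map_link)
  have "image_mset (concls \<circ> map_link r) G = image_mset (image_mset r \<circ> concls) G"
    using okG wf_link_map_link[of r, OF ty] by (intro image_mset_cong) simp
  then have concls_S: "concls_of ?S = image_mset r (concls_of G)"
    by (simp add: image_sum_mset multiset.map_comp)
  have edges_S: "edges ?S = image_mset r (edges G)"
    by (simp add: edges_def image_sum_mset multiset.map_comp comp_def link_edges_map_link)
  have edges_R: "edges ?R = {#e, f#} + edges G" using ends by simp
  have count_R: "count (edges ?R) a \<le> 1" for a using R unfolding wf_net_def by blast
  have concls_R: "concls_of ?R = {#e, f#} + concls_of G" and prems_R: "prems_of ?R = {#f, g#} + prems_of G"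
    using ends by simp_all
  have sub: "add_mset g (prems_of G) \<subseteq># add_mset e (concls_of G)"
  proof -
    have "add_mset f (add_mset g (prems_of G)) \<subseteq># add_mset f (add_mset e (concls_of G))"
      using R unfolding wf_net_def concls_R prems_R by (simp add: add_mset_commute)
    then show ?thesis by simp
  qed
  \<comment> \<open>With the axiom one occurrence of \<open>e\<close> disappears, so renaming the
    single \<open>g\<close> to \<open>e\<close> creates no duplicate.\<close>
  have count_S: "count (edges ?S) a \<le> 1" for a
  proof (cases "g \<in># edges G")
    case False
    then have "edges ?S = edges G" using image_mset_rename[OF r] unfolding edges_S by simp
    moreover have "count (edges G) a \<le> count (edges ?R) a" unfolding edges_R by simp
    ultimately show ?thesis using count_R[of a] by simp
  next
    case True
    then obtain M where M: "edges G = add_mset g M" by (meson mset_add)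
    have "count (edges G) g \<le> count (edges ?R) g" unfolding edges_R by simp
    then have "count (edges G) g \<le> 1" using count_R[of g] by simp
    then have "g \<notin># M" unfolding M by (simp add: count_eq_zero_iff)
    then have "edges ?S = add_mset e M" unfolding edges_S M using image_mset_rename[OF r] by (simp add: r)
    moreover have "count (add_mset e M) a \<le> count (edges ?R) a" unfolding edges_R M by simp
    ultimately show ?thesis using count_R[of a] by simp
  qed
  have "prems_of ?S \<subseteq># concls_of ?S \<and> net_concls ?S = net_concls ?R"
  proof (cases "g = e")
    \<comment> \<open>The cut closes the axiom on itself, which \<open>wf_net\<close> does not
      exclude; the renaming is then the identity.\<close>
    case True
    then have "image_mset r M = M" for M by (induction M) (auto simp: r)
    then show ?thesis using sub True unfolding net_concls_def prems_S concls_S prems_R concls_R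
      by (simp add: add_mset_commute)
  next
    case False
    have "g \<in># add_mset e (concls_of G)" using mset_subset_eqD[OF sub] by simp
    then have "g \<in># concls_of G" using False by simp
    then obtain M where M: "concls_of G = add_mset g M" by (meson mset_add)
    have "concls_of G \<subseteq># edges G" by (rule concls_of_le_edges)
    then have "count (concls_of G) g \<le> count (edges G) g" by (rule mset_subset_eq_count)
    also have "\<dots> \<le> count (edges ?R) g" unfolding edges_R by simp
    finally have "count (concls_of G) g \<le> 1" using count_R[of g] by simp
    then have gM: "g \<notin># M" unfolding M by (simp add: count_eq_zero_iff)
    have sub': "prems_of G \<subseteq># add_mset e M" using sub unfolding M by (simp add: add_mset_commute[of e g])
    then have gP: "g \<notin># prems_of G" using gM False mset_subset_eqD by fastforce
    have "prems_of ?S = prems_of G" "concls_of ?S = add_mset e M"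
      unfolding prems_S concls_S M using image_mset_rename[OF r] gM gP by (simp_all add: r)
    moreover have "net_concls ?R = add_mset e M - prems_of G"
      unfolding net_concls_def prems_R concls_R M by (simp add: add_mset_commute[of e f] add_mset_commute[of e g])
    ultimately show ?thesis using sub' unfolding net_concls_def by simp
  qed
  then show ?thesis using okS count_S unfolding wf_net_def by blast
qed

lemma flatten_guard:
  fixes R :: net
  assumes "(H, l) \<in># flatten R" "g \<in> H"
  shows "g \<in># edges R"
proof -
  obtain x where x: "x \<in># R" "(H, l) \<in># flat x" using assms(1) unfolding mem_flatten by blast
  obtain H' where "(H', Bot g {#}) \<in># flat x" using flat_guard[OF x(2) assms(2)] by blast
  then have "(H', Bot g {#}) \<in># flatten R" using x(1) unfolding mem_flatten by blast
  from concls_le_fconcls[OF this] show ?thesis unfolding edges_flatten by (simp add: mset_subset_eq_insertD)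
qed

section \<open>The reduction rules one by one\<close>

definition same_behaviour :: "net \<Rightarrow> net \<Rightarrow> bool" where
  "same_behaviour R S \<longleftrightarrow> wf_net S \<and> net_concls S = net_concls R \<and>
     flat_behaviour (flatten S) (net_concls R) = flat_behaviour (flatten R) (net_concls R)"

lemma flatten_wire: "wire l \<Longrightarrow> flat l = {#({}, l)#}"
  by (cases l) auto

text \<open>\<open>h\<close> stands for either projection of the pairs, so the same equations serve
  the one links above the sync and those that replace it.\<close>

lemma ones_simps:
  "concls_of (mset (map (\<lambda>(p, c). One (h p c)) xs)) = mset (map (\<lambda>(p, c). h p c) xs)"
  "prems_of (mset (map (\<lambda>(p, c). One (h p c)) xs)) = {#}"
  "edges (mset (map (\<lambda>(p, c). One (h p c)) xs)) = mset (map (\<lambda>(p, c). h p c) xs)"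
  "flatten (mset (map (\<lambda>(p, c). One (h p c)) xs)) = mset (map (\<lambda>(p, c). ({}, One (h p c))) xs)"
  by (induction xs) auto

lemma red_tens_par:
  assumes R: "wf_net ({#Tens a b c, Par a' b' d, k#} + G)" and k: "k \<in> {Cut c d, Cut d c}"
  shows "same_behaviour ({#Tens a b c, Par a' b' d, k#} + G) ({#Cut a a', Cut b b'#} + G)"
proof -
  let ?R = "{#Tens a b c, Par a' b' d, k#} + G" and ?S = "{#Cut a a', Cut b b'#} + G"
  have ends: "prems k = {#c, d#}" "concls k = {#}" "link_edges k = {#}" "wire k" using k by auto
  have ok: "\<forall>l \<in># ?R. wf_link l" using R unfolding wf_net_def by blast
  then have ty: "ty c = TensF (ty a) (ty b)" "ty d = ParF (ty a') (ty b')" "ty a' = dual (ty a)" "ty b' = dual (ty b)"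
    using k by auto
  have count: "count (edges ?R) e \<le> 1" for e using R unfolding wf_net_def by blast
  have S: "wf_net ?S \<and> net_concls ?S = net_concls ?R"
  proof (rule wf_net_local[OF R, where X = "{#c, d#}" and Y = "{#}"])
    show "concls_of ?R = {#c, d#} + concls_of G" "concls_of ?S = {#} + concls_of G" using ends by simp_all
    show "prems_of ?R = {#c, d#} + ({#a, b, a', b'#} + prems_of G)"
      "prems_of ?S = {#} + ({#a, b, a', b'#} + prems_of G)" using ends by simp_all
    show "wf_link l" if "l \<in># ?S" for l using that ok ty by auto
    show "count (edges ?S) e \<le> 1" for e using count[of e] by (simp split: if_splits)
  qed
  have "flatten ?R = {#({}, Tens a b c), ({}, Par a' b' d), ({}, k)#} + flatten G"
    "flatten ?S = {#({}, Cut a a'), ({}, Cut b b')#} + flatten G"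
    using flatten_wire[OF ends(4)] by simp_all
  then show ?thesis
    unfolding same_behaviour_def using S tens_par_behaviour[OF _ k] flat_net_flatten[OF R] by metis
qed

text \<open>Shared bookkeeping for the four rules that move a sync past a link: \<open>x\<close>
  becomes \<open>x'\<close> and the pairs \<open>vs\<close> become \<open>ws\<close>.
  \<open>X\<close> and \<open>Y\<close> are the internal edges before and after the step, and
  \<open>Y'\<close> consists of the fresh names.\<close>

lemma red_sync_local:
  assumes R: "wf_net ({#x, Sync (xs @ vs @ ys)#} + G)"
    and wire: "wire x" "wire x'"
    and ends: "concls x + mset (map snd vs) = X + M" "prems x + mset (map fst vs) = X + N"
      "concls x' + mset (map snd ws) = Y + M" "prems x' + mset (map fst ws) = Y + N"
    and ok: "typed x'" "ws \<noteq> []" "\<forall>(p, c) \<in> set ws. ty p = ty c \<and> (positive (ty p) \<or> negative (ty p))"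
    and fresh: "\<And>e. e \<in># Y' \<Longrightarrow> e \<notin># edges ({#x, Sync (xs @ vs @ ys)#} + G)" "\<And>e. count Y' e \<le> 1"
    and edges: "concls x' + mset (map snd ws) \<subseteq># Y' + (concls x + mset (map snd vs))"
    and beh: "\<And>K. flat_net ({#({}, x), ({}, Sync (xs @ vs @ ys))#} + flatten G) K \<Longrightarrow>
        flat_net ({#({}, x'), ({}, Sync (xs @ ws @ ys))#} + flatten G) K \<Longrightarrow>
        flat_behaviour ({#({}, x), ({}, Sync (xs @ vs @ ys))#} + flatten G) K =
        flat_behaviour ({#({}, x'), ({}, Sync (xs @ ws @ ys))#} + flatten G) K"
  shows "same_behaviour ({#x, Sync (xs @ vs @ ys)#} + G) ({#x', Sync (xs @ ws @ ys)#} + G)"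
proof -
  let ?R = "{#x, Sync (xs @ vs @ ys)#} + G" and ?S = "{#x', Sync (xs @ ws @ ys)#} + G"
  let ?P = "mset (map fst xs) + mset (map fst ys) + prems_of G" and ?C = "mset (map snd xs) + mset (map snd ys) + concls_of G"
  have okR: "\<forall>l \<in># ?R. wf_link l" using R unfolding wf_net_def by blast
  have count: "count (edges ?R) e \<le> 1" for e using R unfolding wf_net_def by blast
  have le: "link_edges l = concls l" if "wire l" for l using that by (cases l) auto
  have eR: "edges ?R = (concls x + mset (map snd vs)) + (mset (map snd xs) + mset (map snd ys) + edges G)"
    and eS: "edges ?S = (concls x' + mset (map snd ws)) + (mset (map snd xs) + mset (map snd ys) + edges G)"
    using le[OF wire(1)] le[OF wire(2)] by simp_all
  have "edges ?S \<subseteq># Y' + edges ?R"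
    using mset_subset_eq_mono_add[OF edges subset_mset.order_refl[of "mset (map snd xs) + mset (map snd ys) + edges G"]]
    unfolding eR eS by (simp only: add.assoc)
  then have count_S: "count (edges ?S) e \<le> 1" for e
  proof -
    have "count (edges ?S) e \<le> count Y' e + count (edges ?R) e"
      using mset_subset_eq_count[OF \<open>edges ?S \<subseteq># Y' + edges ?R\<close>, of e] unfolding count_union[of Y'] .
    moreover have "count Y' e = 0 \<or> count (edges ?R) e = 0"
      using fresh(1)[of e] unfolding count_eq_zero_iff by blast
    ultimately show ?thesis using fresh(2)[of e] count[of e] by linarith
  qed
  have S: "wf_net ?S \<and> net_concls ?S = net_concls ?R"
  proof (rule wf_net_local[OF R, where X = X and Y = Y])
    have "concls_of ?R = (concls x + mset (map snd vs)) + ?C" by simp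
    then show "concls_of ?R = X + (M + ?C)" unfolding ends by (simp only: add.assoc)
    have "prems_of ?R = (prems x + mset (map fst vs)) + ?P" by simp
    then show "prems_of ?R = X + (N + ?P)" unfolding ends by (simp only: add.assoc)
    have "concls_of ?S = (concls x' + mset (map snd ws)) + ?C" by simp
    then show "concls_of ?S = Y + (M + ?C)" unfolding ends by (simp only: add.assoc)
    have "prems_of ?S = (prems x' + mset (map fst ws)) + ?P" by simp
    then show "prems_of ?S = Y + (N + ?P)" unfolding ends by (simp only: add.assoc)
    have "typed (Sync (xs @ vs @ ys))" using okR by simp
    then have "typed (Sync (xs @ ws @ ys))" using ok(2,3) by (simp add: ball_Un)
    moreover have "wf_link x'" using wire(2) ok(1) by (cases x') auto
    ultimately show "wf_link l" if "l \<in># ?S" for l using that okR by auto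
    show "count (edges ?S) e \<le> 1" for e by (rule count_S)
  qed
  have "flatten ?R = {#({}, x), ({}, Sync (xs @ vs @ ys))#} + flatten G"
    "flatten ?S = {#({}, x'), ({}, Sync (xs @ ws @ ys))#} + flatten G"
    using flatten_wire[OF wire(1)] flatten_wire[OF wire(2)] by simp_all
  then show ?thesis
    unfolding same_behaviour_def using S beh flat_net_flatten[OF R] flat_net_flatten[OF conjunct1[OF S]] by metis
qed

lemma red_sync_binary:
  assumes R: "wf_net ({#x, Sync (xs @ (c, d) # ys)#} + G)"
    and x: "x = Tens a b c \<and> x' = Tens a' b' d \<or> x = Par a b c \<and> x' = Par a' b' d"
    and fresh: "a' \<notin># edges ({#x, Sync (xs @ (c, d) # ys)#} + G)" "b' \<notin># edges ({#x, Sync (xs @ (c, d) # ys)#} + G)"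
      "a' \<noteq> b'" "ty a' = ty a" "ty b' = ty b"
  shows "same_behaviour ({#x, Sync (xs @ (c, d) # ys)#} + G) ({#x', Sync (xs @ (a, a') # (b, b') # ys)#} + G)"
proof -
  have "wf_link x" "wf_link (Sync (xs @ (c, d) # ys))" using R unfolding wf_net_def by auto
  then have ty: "ty d = ty c" "positive (ty c) \<or> negative (ty c)"
    "ty c = TensF (ty a) (ty b) \<and> x' = Tens a' b' d \<or> ty c = ParF (ty a) (ty b) \<and> x' = Par a' b' d"
    using x by auto
  have "same_behaviour ({#x, Sync (xs @ [(c, d)] @ ys)#} + G) ({#x', Sync (xs @ [(a, a'), (b, b')] @ ys)#} + G)"
  proof (rule red_sync_local[where X = "{#c#}" and M = "{#d#}" and N = "{#a, b#}" and Y = "{#a', b'#}" and Y' = "{#a', b'#}"])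
    show "typed x'" using ty fresh(4,5) by auto
    show "\<forall>(p, e) \<in> set [(a, a'), (b, b')]. ty p = ty e \<and> (positive (ty p) \<or> negative (ty p))"
      using ty fresh(4,5) by auto
    show "e \<notin># edges ({#x, Sync (xs @ [(c, d)] @ ys)#} + G)" if "e \<in># {#a', b'#}" for e
      using that fresh by auto
    show "flat_behaviour ({#({}, x), ({}, Sync (xs @ [(c, d)] @ ys))#} + flatten G) K =
        flat_behaviour ({#({}, x'), ({}, Sync (xs @ [(a, a'), (b, b')] @ ys))#} + flatten G) K"
      if "flat_net ({#({}, x), ({}, Sync (xs @ [(c, d)] @ ys))#} + flatten G) K"
        "flat_net ({#({}, x'), ({}, Sync (xs @ [(a, a'), (b, b')] @ ys))#} + flatten G) K" for K
      using binary_sync_behaviour[of x xs c d ys "flatten G" K x' a a' b b'] that x by simp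
  qed (use R x fresh(3) in auto)
  then show ?thesis by simp
qed

lemma red_sync_ax:
  assumes R: "wf_net ({#x, Sync (xs @ (f, g) # ys)#} + G)"
    and x: "x \<in> {Ax e f, Ax f e}" "positive (ty f)"
    and h: "h \<notin># edges ({#x, Sync (xs @ (f, g) # ys)#} + G)" "ty h = ty e"
  shows "same_behaviour ({#x, Sync (xs @ (f, g) # ys)#} + G) ({#Ax h g, Sync (xs @ (h, e) # ys)#} + G)"
proof -
  have "wf_link x" "wf_link (Sync (xs @ (f, g) # ys))" using R unfolding wf_net_def by auto
  then have ty: "ty g = ty f" "ty e = dual (ty f)" using x by auto
  have "positive A \<Longrightarrow> negative (dual A)" for A by (induction A) auto
  then have neg: "negative (ty e)" using x(2) unfolding ty .
  have "same_behaviour ({#x, Sync (xs @ [(f, g)] @ ys)#} + G) ({#Ax h g, Sync (xs @ [(h, e)] @ ys)#} + G)"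
  proof (rule red_sync_local[where X = "{#f#}" and M = "{#e, g#}" and N = "{#}" and Y = "{#h#}" and Y' = "{#h#}"])
    show "typed (Ax h g)" using ty h(2) by simp
    show "\<forall>(p, c) \<in> set [(h, e)]. ty p = ty c \<and> (positive (ty p) \<or> negative (ty p))"
      using h(2) neg by simp
    show "a \<notin># edges ({#x, Sync (xs @ [(f, g)] @ ys)#} + G)" if "a \<in># {#h#}" for a
      using that h(1) by simp
    show "flat_behaviour ({#({}, x), ({}, Sync (xs @ [(f, g)] @ ys))#} + flatten G) K =
        flat_behaviour ({#({}, Ax h g), ({}, Sync (xs @ [(h, e)] @ ys))#} + flatten G) K"
      if "flat_net ({#({}, x), ({}, Sync (xs @ [(f, g)] @ ys))#} + flatten G) K"
        "flat_net ({#({}, Ax h g), ({}, Sync (xs @ [(h, e)] @ ys))#} + flatten G) K" for K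
      using ax_sync_behaviour[of x xs f g ys "flatten G" K h e] that x by simp
  qed (use R x in auto)
  then show ?thesis by simp
qed

lemma red_sync_cut:
  assumes R: "wf_net ({#k, Sync (xs @ (f, g) # ys)#} + G)"
    and k: "k \<in> {Cut g h, Cut h g}" "negative (ty g)"
    and h': "h' \<notin># edges ({#k, Sync (xs @ (f, g) # ys)#} + G)" "ty h' = ty h"
  shows "same_behaviour ({#k, Sync (xs @ (f, g) # ys)#} + G) ({#Cut f h', Sync (xs @ (h, h') # ys)#} + G)"
proof -
  have "wf_link k" "wf_link (Sync (xs @ (f, g) # ys))" using R unfolding wf_net_def by auto
  then have ty: "ty f = ty g" "ty h = dual (ty g)" using k by auto
  have "negative A \<Longrightarrow> positive (dual A)" for A by (induction A) auto
  then have pos: "positive (ty h)" using k(2) unfolding ty .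
  have "same_behaviour ({#k, Sync (xs @ [(f, g)] @ ys)#} + G) ({#Cut f h', Sync (xs @ [(h, h')] @ ys)#} + G)"
  proof (rule red_sync_local[where X = "{#g#}" and M = "{#}" and N = "{#f, h#}" and Y = "{#h'#}" and Y' = "{#h'#}"])
    show "typed (Cut f h')" using ty h'(2) by simp
    show "\<forall>(p, c) \<in> set [(h, h')]. ty p = ty c \<and> (positive (ty p) \<or> negative (ty p))"
      using h'(2) pos by simp
    show "a \<notin># edges ({#k, Sync (xs @ [(f, g)] @ ys)#} + G)" if "a \<in># {#h'#}" for a
      using that h'(1) by simp
    show "flat_behaviour ({#({}, k), ({}, Sync (xs @ [(f, g)] @ ys))#} + flatten G) K =
        flat_behaviour ({#({}, Cut f h'), ({}, Sync (xs @ [(h, h')] @ ys))#} + flatten G) K"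
      if "flat_net ({#({}, k), ({}, Sync (xs @ [(f, g)] @ ys))#} + flatten G) K"
        "flat_net ({#({}, Cut f h'), ({}, Sync (xs @ [(h, h')] @ ys))#} + flatten G) K" for K
      using cut_sync_behaviour[of k xs f g ys "flatten G" K h' h] that k by simp
  qed (use R k in auto)
  then show ?thesis by simp
qed

lemma red_ax_cut:
  assumes R: "wf_net ({#x, k#} + G)" and x: "x \<in> {Ax e f, Ax f e}" and k: "k \<in> {Cut f g, Cut g f}"
  shows "same_behaviour ({#x, k#} + G) (image_mset (map_link (\<lambda>a. if a = g then e else a)) G)"
proof -
  have "wire x" "wire k" using x k by auto
  then have flat: "flatten ({#x, k#} + G) = {#({}, x), ({}, k)#} + flatten G"
    by (simp add: flatten_wire add_mset_commute)
  have "flat_net ({#({}, x), ({}, k)#} + flatten G) (net_concls ({#x, k#} + G))"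
    using flat_net_flatten[OF R] unfolding flat .
  from ax_cut_behaviour[OF this x k] wf_net_ax_cut[OF R x k refl] show ?thesis
    unfolding same_behaviour_def flatten_map_link flat by (intro conjI) simp_all
qed

lemma red_sync_one:
  assumes R: "wf_net (add_mset (Sync xs) (mset (map (\<lambda>(p, c). One p) xs)) + G)"
  shows "same_behaviour (add_mset (Sync xs) (mset (map (\<lambda>(p, c). One p) xs)) + G) (mset (map (\<lambda>(p, c). One c) xs) + G)"
proof -
  let ?R = "add_mset (Sync xs) (mset (map (\<lambda>(p, c). One p) xs)) + G" and ?S = "mset (map (\<lambda>(p, c). One c) xs) + G"
  note ones = ones_simps[of "\<lambda>p c. p" xs] ones_simps[of "\<lambda>p c. c" xs]
  have proj: "map (\<lambda>(p, c). p) xs = map fst xs" "map (\<lambda>(p, c). c) xs = map snd xs" by (simp_all add: split_beta)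
  have ok: "\<forall>l \<in># ?R. wf_link l" and count: "count (edges ?R) e \<le> 1" for e using R unfolding wf_net_def by blast+
  have edges_R: "edges ?R = mset (map snd xs) + mset (map fst xs) + edges G"
    and edges_S: "edges ?S = mset (map snd xs) + edges G"
    using ones proj by (simp_all del: mset_map)
  have unit: "ty c = UnitF" if "(p, c) \<in> set xs" for p c
  proof -
    have "One p \<in># ?R" using that by force
    then have "wf_link (One p)" using ok by blast
    moreover have "wf_link (Sync xs)" using ok by simp
    ultimately show ?thesis using that by auto
  qed
  have S: "wf_net ?S \<and> net_concls ?S = net_concls ?R"
  proof (rule wf_net_local[OF R, where X = "mset (map fst xs)" and Y = "{#}"])
    show "concls_of ?R = mset (map fst xs) + (mset (map snd xs) + concls_of G)"
      "concls_of ?S = {#} + (mset (map snd xs) + concls_of G)"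
      "prems_of ?R = mset (map fst xs) + prems_of G" "prems_of ?S = {#} + prems_of G"
      using ones proj by (simp_all del: mset_map)
    show "wf_link l" if "l \<in># ?S" for l using that ok unit by auto
    show "count (edges ?S) e \<le> 1" for e using count[of e] unfolding edges_R edges_S count_union by linarith
  qed
  have "flatten ?R = {#({}, Sync xs)#} + mset (map (\<lambda>(p, c). ({}, One p)) xs) + flatten G"
    "flatten ?S = mset (map (\<lambda>(p, c). ({}, One c)) xs) + flatten G"
    using ones by (simp_all del: mset_map)
  then show ?thesis
    unfolding same_behaviour_def using S sync_one_behaviour flat_net_flatten[OF R] by metis
qed

lemma red_open_box:
  assumes R: "wf_net ({#Bot e C, One f, k#} + G)" and k: "k \<in> {Cut e f, Cut f e}"
  shows "same_behaviour ({#Bot e C, One f, k#} + G) (C + G)"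
proof -
  let ?R = "{#Bot e C, One f, k#} + G" and ?S = "C + G"
  have ends: "prems k = {#e, f#}" "concls k = {#}" "link_edges k = {#}" "wire k" using k by auto
  have ok: "\<forall>l \<in># ?R. wf_link l" and count: "count (edges ?R) a \<le> 1" for a using R unfolding wf_net_def by blast+
  have okC: "prems_of C \<subseteq># concls_of C" "\<forall>l \<in># C. wf_link l" using ok by auto
  define D where "D = concls_of C - prems_of C"
  have D: "concls_of C = prems_of C + D" using okC(1) unfolding D_def by simp
  have edges_R: "edges ?R = {#e, f#} + (edges C + edges G)" using ends by (simp add: edges_def[of C])
  have S: "wf_net ?S \<and> net_concls ?S = net_concls ?R"
  \<comment> \<open>Opening the box brings its inner edges to depth 0: \<open>Y\<close> consists of
    the premisses of \<open>C\<close>, which the box had cancelled against its conclusions.\<close>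
  proof (rule wf_net_local[OF R, where X = "{#e, f#}" and Y = "prems_of C"])
    show "concls_of ?R = {#e, f#} + (D + concls_of G)" using ends by (simp add: D_def)
    show "concls_of ?S = prems_of C + (D + concls_of G)" using D by simp
    show "prems_of ?R = {#e, f#} + prems_of G" "prems_of ?S = prems_of C + prems_of G" using ends by simp_all
    show "wf_link l" if "l \<in># ?S" for l using that ok okC(2) by auto
    show "count (edges ?S) a \<le> 1" for a
    proof -
      have "count {#e, f#} a + (count (edges C) a + count (edges G) a) \<le> 1"
        using count[of a] unfolding edges_R count_union .
      then show ?thesis by simp
    qed
  qed
  \<comment> \<open>A guard containing \<open>e\<close> would make \<open>e\<close> an edge of
    \<open>C\<close> or \<open>G\<close> as well, but it is already counted as the lock of the
    opened box.\<close>
  have guard: "e \<notin> H" if "(H, l) \<in># flatten C \<or> (H, l) \<in># flatten G" for H l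
  proof
    assume e: "e \<in> H"
    have "e \<in># edges C \<or> e \<in># edges G" using that flatten_guard[OF _ e] by blast
    then have "count (edges C) e + count (edges G) e \<ge> 1" by (auto simp: Suc_le_eq)
    moreover have "count {#e, f#} e + (count (edges C) e + count (edges G) e) \<le> 1"
      using count[of e] unfolding edges_R count_union .
    ultimately show False by simp
  qed
  have fR: "flatten ?R = {#({}, Bot e {#}), ({}, One f), ({}, k)#} + image_mset (\<lambda>(H, l). (insert e H, l)) (flatten C) + flatten G"
    using flatten_wire[OF ends(4)] by (simp add: flat_Bot del: flat.simps(6))
  have "flat_net (flatten ?R) (net_concls ?R)" using R by (rule flat_net_flatten)
  then have "flat_behaviour (flatten ?R) (net_concls ?R) = flat_behaviour (flatten C + flatten G) (net_concls ?R)"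
    unfolding fR using guard by (intro open_box_behaviour[OF _ k]) blast+
  then show ?thesis unfolding same_behaviour_def using S by simp
qed

lemma red_same_behaviour:
  assumes "red R S" "wf_net R"
  shows "same_behaviour R S"
  using assms
proof cases
  case (ax_cut x e f k g G)
  then show ?thesis using red_ax_cut assms(2) by blast
next
  case (tens_par k c d a b a' b' G)
  then show ?thesis using red_tens_par assms(2) by blast
next
  case (sync_tens a b c xs d ys G a' b')
  then show ?thesis using red_sync_binary[of "Tens a b c" xs c d ys G a b "Tens a' b' d" a' b'] assms(2) by (simp add: add_mset_commute)
next
  case (sync_par a b c xs d ys G a' b')
  then show ?thesis using red_sync_binary[of "Par a b c" xs c d ys G a b "Par a' b' d" a' b'] assms(2) by (simp add: add_mset_commute)
next
  case (sync_ax x xs f g ys G e h)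
  then show ?thesis using red_sync_ax[of x xs f g ys G e h] assms(2) by (simp add: add_mset_commute)
next
  case (sync_cut k xs f g ys G h h')
  then show ?thesis using red_sync_cut[of k xs f g ys G h h'] assms(2) by (simp add: add_mset_commute)
next
  case (sync_one xs G)
  then show ?thesis using red_sync_one assms(2) by blast
next
  case (open_box k e f C G)
  then show ?thesis using red_open_box assms(2) by blast
qed

lemma interp_red:
  assumes "red R S" "wf_net R"
  shows "wf_net S \<and> interp S = interp R"
proof -
  have S: "wf_net S" "net_concls S = net_concls R"
    "flat_behaviour (flatten S) (net_concls R) = flat_behaviour (flatten R) (net_concls R)"
    using red_same_behaviour[OF assms] unfolding same_behaviour_def by auto
  have "interp N = result_of (flat_behaviour (flatten N) (net_concls N))" if "wf_net N" for N
    using that wf_net_locale.interp_behaviour[OF wf_net_locale.intro] by blast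
  then show ?thesis using S assms(2) by simp
qed

theorem mainTheorem10:
  fixes R S :: net
  assumes "smll_net R"
    and "red\<^sup>*\<^sup>* R S"
    and "\<nexists>S'. red S S'"
  shows "interp R = interp S"
proof -
  have "wf_net R" using assms(1) smll_structure_wf_net unfolding smll_net_def by blast
  \<comment> \<open>The invariant carried along the reduction sequence is \<open>wf_net\<close>,
    which every step preserves together with the interpretation.\<close>
  with assms(2) have "wf_net S \<and> interp S = interp R"
  proof (induction rule: rtranclp_induct)
    case (step S S')
    then show ?case using interp_red[of S S'] by simp
  qed simp
  then show ?thesis by simp
qed

end
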